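(* Suppose that $I$ is a $\boldsymbol{\Sigma}^0_2$ $P$-ideal on $\mathbb{N}$ which contains $\mathrm{Fin}$ and is not a trivial modification of $\mathrm{Fin}$. Then the group $S_I = \{ g \in S_\infty : \mathrm{supp}(g) \in I \}$, equipped with its Polish group topology $\tau_I$, is a Polish group with ample generics that is not non-archimedean. In particular, there exists a Polish group with ample generics that is not non-archimedean, e.g. $S_{I_S}$, where $I_S = \{A \subseteq \mathbb{N} : \sum_{n \in A,\, n \geq 1} 1/n < \infty\}$ is the summable ideal.
   Context: $\mathbb{N}=\{0,1,2,\ldots\}$; $\mathrm{Fin}$ is the ideal of finite subsets of $\mathbb{N}$; $S_\infty$ is the group of all permutations of $\mathbb{N}$ (with the topology of pointwise convergence); for $g \in S_\infty$, $\mathrm{supp}(g) = \{n \in \mathbb{N} : g(n) \neq n\}$. An ideal $I$ on $\mathbb{N}$ is a family of subsets of $\mathbb{N}$ closed under taking subsets and finite unions. It is $\boldsymbol{\Sigma}^0_2$ if it is an $F_\sigma$ subset of $\mathcal{P}(\mathbb{N}) \cong 2^{\mathbb{N}}$ (in particular it is then analytic). It is a $P$-ideal if for every sequence $(A_k)_{k\in\mathbb{N}}$ of elements of $I$ there is $A \in I$ such that $A_k \setminus A$ is finite for every $k$. An ideal $I$ is a trivial modification of $\mathrm{Fin}$ if there exists $A \subseteq \mathbb{N}$ such that $I = \{B \subseteq \mathbb{N} : A \cap B \in \mathrm{Fin}\}$. A lower semi-continuous submeasure on $\mathbb{N}$ is a function $\phi: \mathcal{P}(\mathbb{N}) \to [0,\infty]$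 such that: $\phi(\emptyset)=0$; $A \subseteq B$ implies $\phi(A) \leq \phi(B)$; $\phi(A\cup B) \leq \phi(A)+\phi(B)$ and $\phi(\{n\})<\infty$ for $n \in \mathbb{N}$; and $\phi(\bigcup_m A_m) = \lim_m \phi(A_m)$ whenever $A_0 \subseteq A_1 \subseteq \ldots$. Put $\mathrm{Exh}(\phi) = \{A \subseteq \mathbb{N} : \lim_m \phi(A \setminus [0,m]) = 0\}$. Every analytic $P$-ideal $I \supseteq \mathrm{Fin}$ is of the form $I = \mathrm{Exh}(\phi)$ for some lower semi-continuous submeasure $\phi$ (known result of Solecki), and $\phi$ can be chosen with $\phi(\{n\})>0$ for all $n$. The group $S_I$ is a Polish group in the topology $\tau_I$ given by the metric $d(f,g) = \phi(\{n \in \mathbb{N} : f(n) \neq g(n)\})$ for such a $\phi$ (known result of Tsankov). A Polish group is a separable, completely metrizable topological group. A Polish group $G$ has ample generics if for every $n \in \mathbb{N}$ the diagonal conjugation action of $G$ on $G^{n+1}$, $g.(g_0,\ldots,g_n) = (g g_0 g^{-1}, \ldots, g g_n g^{-1})$, has a comeager orbit. A Polish group is non-archimedean if it is isomorphic, as a topological group, to a (closed) subgroup of $S_\infty$; equivalently, if the identity has a neighborhood basis consisting of open subgroups. *)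

theory Defs
  imports "HOL-Analysis.Analysis" "HOL-Algebra.Group_Action"
begin

section \<open>Ideals on the natural numbers\<close>

definition ideal_on_nat :: "nat set set \<Rightarrow> bool" where
  "ideal_on_nat I \<longleftrightarrow>
     {} \<in> I \<and> (\<forall>A\<in>I. \<forall>B. B \<subseteq> A \<longrightarrow> B \<in> I) \<and> (\<forall>A\<in>I. \<forall>B\<in>I. A \<union> B \<in> I)"

definition Fin :: "nat set set" where
  "Fin = {A. finite A}"

text \<open>The power set of the naturals is identified, via characteristic functions, with the
  Cantor space; the \<open>\<Sigma>\<^sup>0\<^sub>2\<close> sets are the countable unions of closed sets.\<close>

definition cantor_space :: "(nat \<Rightarrow> bool) topology" where
  "cantor_space = product_topology (\<lambda>_. discrete_topology UNIV) UNIV"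

definition Sigma02 :: "nat set set \<Rightarrow> bool" where
  "Sigma02 I \<longleftrightarrow> fsigma_in cantor_space ((\<lambda>A n. n \<in> A) ` I)"

definition P_ideal :: "nat set set \<Rightarrow> bool" where
  "P_ideal I \<longleftrightarrow> ideal_on_nat I \<and>
     (\<forall>A :: nat \<Rightarrow> nat set. (\<forall>k. A k \<in> I) \<longrightarrow> (\<exists>B\<in>I. \<forall>k. finite (A k - B)))"

definition trivial_modification_of_Fin :: "nat set set \<Rightarrow> bool" where
  "trivial_modification_of_Fin I \<longleftrightarrow> (\<exists>A. I = {B. A \<inter> B \<in> Fin})"

definition summable_ideal :: "nat set set" where
  "summable_ideal = {A. (\<lambda>n. 1 / real n) summable_on {n \<in> A. n \<ge> 1}}"


section \<open>Lower semi-continuous submeasures\<close>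

definition lsc_submeasure :: "(nat set \<Rightarrow> ennreal) \<Rightarrow> bool" where
  "lsc_submeasure \<phi> \<longleftrightarrow>
     \<phi> {} = 0 \<and>
     (\<forall>A B. A \<subseteq> B \<longrightarrow> \<phi> A \<le> \<phi> B) \<and>
     (\<forall>A B. \<phi> (A \<union> B) \<le> \<phi> A + \<phi> B) \<and>
     (\<forall>n. \<phi> {n} < \<infinity>) \<and>
     (\<forall>A :: nat \<Rightarrow> nat set. (\<forall>m. A m \<subseteq> A (Suc m)) \<longrightarrow> (\<lambda>m. \<phi> (A m)) \<longlonglongrightarrow> \<phi> (\<Union>m. A m))"

definition Exh :: "(nat set \<Rightarrow> ennreal) \<Rightarrow> nat set set" where
  "Exh \<phi> = {A. (\<lambda>m. \<phi> (A - {0..m})) \<longlonglongrightarrow> 0}"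

text \<open>The submeasures from which the topology on \<open>S\<^sub>I\<close> is built.\<close>

definition represents :: "(nat set \<Rightarrow> ennreal) \<Rightarrow> nat set set \<Rightarrow> bool" where
  "represents \<phi> I \<longleftrightarrow> lsc_submeasure \<phi> \<and> (\<forall>n. \<phi> {n} > 0) \<and> I = Exh \<phi>"


section \<open>Permutation groups\<close>

definition S_infty :: "(nat \<Rightarrow> nat) monoid" where
  "S_infty = \<lparr>carrier = {g. bij g}, mult = (\<circ>), one = id\<rparr>"

text \<open>The topology of pointwise convergence.\<close>

definition S_infty_topology :: "(nat \<Rightarrow> nat) topology" where
  "S_infty_topology =
     subtopology (product_topology (\<lambda>_. discrete_topology UNIV) UNIV) (carrier S_infty)"

definition supp :: "(nat \<Rightarrow> nat) \<Rightarrow> nat set" where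
  "supp g = {n. g n \<noteq> n}"

definition S_ideal :: "nat set set \<Rightarrow> (nat \<Rightarrow> nat) monoid" where
  "S_ideal I = S_infty\<lparr>carrier := {g \<in> carrier S_infty. supp g \<in> I}\<rparr>"

text \<open>Truncating to the reals by \<^const>\<open>enn2real\<close> is harmless: \<open>\<phi>\<close> is finite on \<open>Exh \<phi>\<close>,
  see \<open>Metric_space_S_ideal\<close> below.\<close>

definition diff_dist :: "(nat set \<Rightarrow> ennreal) \<Rightarrow> (nat \<Rightarrow> nat) \<Rightarrow> (nat \<Rightarrow> nat) \<Rightarrow> real" where
  "diff_dist \<phi> f g = enn2real (\<phi> {n. f n \<noteq> g n})"

definition tau_ideal :: "nat set set \<Rightarrow> (nat set \<Rightarrow> ennreal) \<Rightarrow> (nat \<Rightarrow> nat) topology" where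
  "tau_ideal I \<phi> = Metric_space.mtopology (carrier (S_ideal I)) (diff_dist \<phi>)"


section \<open>Polish groups\<close>

locale topological_group = group G for G :: "('a, 'b) monoid_scheme" (structure) +
  fixes T :: "'a topology"
  assumes topspace_eq: "topspace T = carrier G"
    and continuous_mult: "continuous_map (prod_topology T T) T (\<lambda>(x, y). x \<otimes> y)"
    and continuous_inv: "continuous_map T T (\<lambda>x. inv x)"

definition Polish_group :: "('a, 'b) monoid_scheme \<Rightarrow> 'a topology \<Rightarrow> bool" where
  "Polish_group G T \<longleftrightarrow>
     topological_group G T \<and> separable_space T \<and> completely_metrizable_space T"

definition nowhere_dense_in :: "'a topology \<Rightarrow> 'a set \<Rightarrow> bool" where
  "nowhere_dense_in X A \<longleftrightarrow> A \<subseteq> topspace X \<and> X interior_of (X closure_of A) = {}"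

definition meagre_in :: "'a topology \<Rightarrow> 'a set \<Rightarrow> bool" where
  "meagre_in X A \<longleftrightarrow> (countable union_of nowhere_dense_in X) A"

definition comeagre_in :: "'a topology \<Rightarrow> 'a set \<Rightarrow> bool" where
  "comeagre_in X A \<longleftrightarrow> A \<subseteq> topspace X \<and> meagre_in X (topspace X - A)"

text \<open>\<open>G\<^sup>n\<^sup>+\<^sup>1\<close> consists of the extensional functions on \<open>{..n}\<close> with values in \<open>G\<close>.\<close>

definition diag_conj ::
    "('a, 'b) monoid_scheme \<Rightarrow> nat \<Rightarrow> 'a \<Rightarrow> (nat \<Rightarrow> 'a) \<Rightarrow> (nat \<Rightarrow> 'a)" where
  "diag_conj G n g x = (\<lambda>i\<in>{..n}. g \<otimes>\<^bsub>G\<^esub> x i \<otimes>\<^bsub>G\<^esub> inv\<^bsub>G\<^esub> g)"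

definition ample_generics :: "('a, 'b) monoid_scheme \<Rightarrow> 'a topology \<Rightarrow> bool" where
  "ample_generics G T \<longleftrightarrow>
     (\<forall>n. \<exists>x \<in> {..n} \<rightarrow>\<^sub>E carrier G.
        comeagre_in (product_topology (\<lambda>_. T) {..n}) (orbit G (diag_conj G n) x))"

text \<open>The subgroup is not required to be closed in \<open>S\<^sub>\<infinity>\<close>: for a Polish group it
  automatically is.\<close>

definition non_archimedean :: "('a, 'b) monoid_scheme \<Rightarrow> 'a topology \<Rightarrow> bool" where
  "non_archimedean G T \<longleftrightarrow>
     (\<exists>H h. subgroup H S_infty \<and>
        h \<in> iso G (S_infty\<lparr>carrier := H\<rparr>) \<and>
        homeomorphic_map T (subtopology S_infty_topology H) h)"


section \<open>Well-definedness of the group and of the metric\<close>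

lemma group_S_infty: "group S_infty"
proof (rule groupI)
  fix x assume "x \<in> carrier S_infty"
  then show "\<exists>y\<in>carrier S_infty. y \<otimes>\<^bsub>S_infty\<^esub> x = \<one>\<^bsub>S_infty\<^esub>"
    by (intro bexI[of _ "Hilbert_Choice.inv x"])
       (auto simp: S_infty_def bij_imp_bij_inv bij_is_inj)
qed (auto simp: S_infty_def bij_comp o_assoc)

lemma inv_S_infty:
  assumes "bij g"
  shows "inv\<^bsub>S_infty\<^esub> g = Hilbert_Choice.inv g"
  by (rule group.inv_equality[OF group_S_infty])
     (use assms in \<open>auto simp: S_infty_def bij_imp_bij_inv bij_is_inj\<close>)

lemma supp_comp: "supp (f \<circ> g) \<subseteq> supp f \<union> supp g"
  by (auto simp: supp_def)

lemma supp_inv: "bij g \<Longrightarrow> supp (Hilbert_Choice.inv g) = supp g"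
  by (auto simp: supp_def bij_inv_eq_iff) (metis bij_inv_eq_iff)+

lemma subgroup_S_ideal:
  assumes "ideal_on_nat I"
  shows "subgroup (carrier (S_ideal I)) S_infty"
proof -
  have dn: "A \<in> I \<Longrightarrow> B \<subseteq> A \<Longrightarrow> B \<in> I" and un: "A \<in> I \<Longrightarrow> B \<in> I \<Longrightarrow> A \<union> B \<in> I"
    and em: "{} \<in> I" for A B
    using assms by (auto simp: ideal_on_nat_def)
  show ?thesis
  proof
    show "x \<otimes>\<^bsub>S_infty\<^esub> y \<in> carrier (S_ideal I)"
      if "x \<in> carrier (S_ideal I)" "y \<in> carrier (S_ideal I)" for x y
      using that dn[OF un supp_comp, of x y] by (auto simp: S_ideal_def S_infty_def bij_comp)
    show "inv\<^bsub>S_infty\<^esub> x \<in> carrier (S_ideal I)" if "x \<in> carrier (S_ideal I)" for x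
      using that by (auto simp: S_ideal_def S_infty_def bij_imp_bij_inv supp_inv
          inv_S_infty[unfolded S_infty_def])
  qed (use em in \<open>auto simp: S_ideal_def S_infty_def supp_def\<close>)
qed

lemma group_S_ideal: "ideal_on_nat I \<Longrightarrow> group (S_ideal I)"
  using subgroup.subgroup_is_group[OF subgroup_S_ideal group_S_infty]
  by (simp add: S_ideal_def)

lemma lsc_submeasure_finite:
  assumes "lsc_submeasure \<phi>" "finite A"
  shows "\<phi> A < \<infinity>"
  using assms(2)
proof (induction A rule: finite_induct)
  case empty
  then show ?case using assms(1) by (simp add: lsc_submeasure_def)
next
  case (insert n A)
  have "\<phi> ({n} \<union> A) \<le> \<phi> {n} + \<phi> A" "\<phi> {n} < \<infinity>"
    using assms(1) unfolding lsc_submeasure_def by blast+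
  then show ?case
    using insert.IH by (auto simp: le_less_trans)
qed

lemma Exh_finite:
  assumes "lsc_submeasure \<phi>" "A \<in> Exh \<phi>"
  shows "\<phi> A < \<infinity>"
proof -
  have "(\<lambda>m. \<phi> (A - {0..m})) \<longlonglongrightarrow> 0"
    using assms(2) by (simp add: Exh_def)
  then have "eventually (\<lambda>m. \<phi> (A - {0..m}) < 1) sequentially"
    by (rule order_tendstoD) simp
  then obtain m where m: "\<phi> (A - {0..m}) < 1"
    by (auto simp: eventually_sequentially)
  have "\<phi> A \<le> \<phi> ({0..m} \<union> (A - {0..m}))"
    using assms(1) unfolding lsc_submeasure_def by (metis Un_Diff_cancel Un_upper2)
  also have "\<dots> \<le> \<phi> {0..m} + \<phi> (A - {0..m})"
    using assms(1) unfolding lsc_submeasure_def by blast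
  also have "\<dots> < \<infinity>"
    using m lsc_submeasure_finite[OF assms(1), of "{0..m}"]
    by (auto intro: less_trans[OF m] simp: ennreal_one_less_top)
  finally show ?thesis .
qed

lemma Metric_space_S_ideal:
  assumes "represents \<phi> I" "ideal_on_nat I"
  shows "Metric_space (carrier (S_ideal I)) (diff_dist \<phi>)"
proof -
  have lsc: "lsc_submeasure \<phi>" and pos: "\<And>n. \<phi> {n} > 0" and I: "I = Exh \<phi>"
    using assms(1) by (auto simp: represents_def)
  have mono: "A \<subseteq> B \<Longrightarrow> \<phi> A \<le> \<phi> B" and sub: "\<phi> (A \<union> B) \<le> \<phi> A + \<phi> B"
    and emp: "\<phi> {} = 0" for A B
    using lsc unfolding lsc_submeasure_def by blast+
  have fin: "\<phi> {n. f n \<noteq> g n} < \<infinity>"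
    if "f \<in> carrier (S_ideal I)" "g \<in> carrier (S_ideal I)" for f g
  proof (rule Exh_finite[OF lsc])
    have "supp f \<union> supp g \<in> I" "{n. f n \<noteq> g n} \<subseteq> supp f \<union> supp g"
      using that assms(2) by (auto simp: S_ideal_def ideal_on_nat_def supp_def)
    then show "{n. f n \<noteq> g n} \<in> Exh \<phi>"
      using assms(2) I by (auto simp: ideal_on_nat_def)
  qed
  show ?thesis
  proof
    show "0 \<le> diff_dist \<phi> f g" for f g
      by (simp add: diff_dist_def)
    show "diff_dist \<phi> f g = diff_dist \<phi> g f" for f g
      by (simp add: diff_dist_def eq_commute)
    show "(diff_dist \<phi> f g = 0) = (f = g)"
      if "f \<in> carrier (S_ideal I)" "g \<in> carrier (S_ideal I)" for f g
    proof
      assume "diff_dist \<phi> f g = 0"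
      then have 0: "\<phi> {n. f n \<noteq> g n} = 0"
        using fin[OF that] by (auto simp: diff_dist_def enn2real_eq_0_iff)
      have "f n = g n" for n
      proof (rule ccontr)
        assume "f n \<noteq> g n"
        then have "\<phi> {n} \<le> 0" using mono[of "{n}" "{n. f n \<noteq> g n}"] 0 by auto
        then show False using pos[of n] by simp
      qed
      then show "f = g" by auto
    qed (simp add: diff_dist_def emp)
    show "diff_dist \<phi> f h \<le> diff_dist \<phi> f g + diff_dist \<phi> g h"
      if "f \<in> carrier (S_ideal I)" "g \<in> carrier (S_ideal I)" "h \<in> carrier (S_ideal I)" for f g h
    proof -
      have "\<phi> {n. f n \<noteq> h n} \<le> \<phi> ({n. f n \<noteq> g n} \<union> {n. g n \<noteq> h n})"
        by (rule mono) auto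
      also have "\<dots> \<le> \<phi> {n. f n \<noteq> g n} + \<phi> {n. g n \<noteq> h n}"
        by (rule sub)
      finally have "diff_dist \<phi> f h \<le> enn2real (\<phi> {n. f n \<noteq> g n} + \<phi> {n. g n \<noteq> h n})"
        unfolding diff_dist_def using fin[OF that(1,2)] fin[OF that(2,3)]
        by (intro enn2real_mono) auto
      also have "\<dots> = diff_dist \<phi> f g + diff_dist \<phi> g h"
        unfolding diff_dist_def using fin[OF that(1,2)] fin[OF that(2,3)]
        by (intro enn2real_plus) auto
      finally show ?thesis .
    qed
  qed
qed

end

theory Submission
  imports Defs
begin

text \<open>
  \<^emph>\<open>Existence of the submeasure.\<close> Call a hereditary family \<open>K\<close> absorbing if every member of \<open>I\<close> has a
  tail in \<open>K\<close>. If a P-ideal is a countable union of hereditary families, one of them is absorbing,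
  so \<open>I\<close> contains a closed hereditary absorbing family. Any such \<open>L\<close> has a half: a family \<open>K\<close> of
  the same kind with \<open>A \<union> B \<in> L\<close> for \<open>A, B \<in> K\<close>. Otherwise one builds finite blocks \<open>s\<^sub>n, t\<^sub>n\<close> with
  \<open>s\<^sub>n \<union> t\<^sub>n \<notin> L\<close>, far out, while all finite unions of the \<open>s\<^sub>n\<close>, and of the \<open>t\<^sub>n\<close>, stay in \<open>L\<close>; by
  compactness both infinite unions are in \<open>L \<subseteq> I\<close>, yet no tail of their union is in \<open>L\<close>. Iterating,
  a Birkhoff-Kakutani construction gives the submeasure.

  \<^emph>\<open>Ample generics.\<close> Fix an infinite \<open>B \<in> I\<close>. A generic tuple has only finite orbits, and \<open>B\<close>
  contains infinitely many disjoint copies of every finite action of the free group. Given two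
  generic tuples \<open>x, y\<close>, let \<open>A \<in> I\<close> be the union of \<open>B\<close> and all their supports; a back-and-forth
  inside \<open>A\<close> yields a permutation conjugating \<open>x\<close> to \<open>y\<close> with support in \<open>A\<close>.

  \<^emph>\<open>Not non-archimedean.\<close> An open subgroup inside the \<open>\<epsilon>\<close>-ball contains the transpositions of points
  of \<open>D\<^sub>\<delta> = {n. \<phi> {n} < \<delta>}\<close> for some \<open>\<delta>\<close>, hence permutations with support any finite subset of
  \<open>D\<^sub>\<delta>\<close> with at least two elements, so \<open>\<phi> D\<^sub>\<delta> \<le> \<epsilon>\<close>. If this happens for all \<open>\<epsilon>\<close> while no \<open>D\<^sub>\<delta>\<close> is in
  \<open>I\<close> (which would make \<open>I\<close> a trivial modification), then a diagonal set in \<open>I\<close> escapes any given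
  countable sequence of closed subsets of \<open>I\<close>.
\<close>


section \<open>Closed families of sets\<close>

text \<open>Closedness in the Cantor space, phrased through initial segments so that arguments can
  stay with sets instead of characteristic functions; \<open>closed_family_iff_closedin\<close> is
  the bridge.\<close>

definition closed_family :: "nat set set \<Rightarrow> bool" where
  "closed_family C \<longleftrightarrow> (\<forall>A. (\<forall>m. \<exists>B\<in>C. \<forall>n<m. n \<in> A \<longleftrightarrow> n \<in> B) \<longrightarrow> A \<in> C)"

definition hereditary :: "nat set set \<Rightarrow> bool" where
  "hereditary K \<longleftrightarrow> (\<forall>A\<in>K. \<forall>B. B \<subseteq> A \<longrightarrow> B \<in> K)"

definition absorbing :: "nat set set \<Rightarrow> nat set set \<Rightarrow> bool" where
  "absorbing I K \<longleftrightarrow> (\<forall>A\<in>I. \<exists>m. A - {..m} \<in> K)"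

lemma topspace_cantor_space [simp]: "topspace cantor_space = UNIV"
  by (simp add: cantor_space_def)

lemma openin_cantor_coordinate: "openin cantor_space {f. f i = b}"
proof -
  have "continuous_map cantor_space (discrete_topology UNIV) (\<lambda>f. f i)"
    unfolding cantor_space_def by (rule continuous_map_product_projection) simp
  from openin_continuous_map_preimage[OF this, of "{b}"] show ?thesis by simp
qed

lemma openin_cantor_cylinder: "openin cantor_space {f. \<forall>i<m. f i = a i}"
proof -
  have "openin cantor_space (topspace cantor_space \<inter> (\<Inter>i\<in>{..<m}. {f. f i = a i}))"
    using openin_topspace[of cantor_space]
    by (cases "m = 0") (auto intro!: openin_cantor_coordinate)
  also have "topspace cantor_space \<inter> (\<Inter>i\<in>{..<m}. {f. f i = a i}) = {f. \<forall>i<m. f i = a i}"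
    by auto
  finally show ?thesis .
qed

lemma cantor_open_contains_cylinder:
  assumes "openin cantor_space U" "a \<in> U"
  shows "\<exists>m. {f. \<forall>i<m. f i = a i} \<subseteq> U"
proof -
  obtain V where V: "finite {i. V i \<noteq> UNIV}" "a \<in> Pi\<^sub>E UNIV V" "Pi\<^sub>E UNIV V \<subseteq> U"
    using assms unfolding cantor_space_def openin_product_topology_alt by fastforce
  obtain m where m: "\<And>i. V i \<noteq> UNIV \<Longrightarrow> i < m"
    using V(1) finite_nat_set_iff_bounded by auto
  have "{f. \<forall>i<m. f i = a i} \<subseteq> Pi\<^sub>E UNIV V"
  proof (clarsimp simp: PiE_iff)
    fix f i assume "\<forall>i<m. f i = a i"
    then show "f i \<in> V i"
      using V(2) m[of i] by (cases "V i = UNIV") (auto simp: PiE_iff)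
  qed
  then show ?thesis using V(3) by (meson order_trans)
qed

lemma closed_family_iff_closedin:
  "closed_family C \<longleftrightarrow> closedin cantor_space ((\<lambda>A n. n \<in> A) ` C)"
proof
  assume L: "closed_family C"
  have "openin cantor_space (UNIV - (\<lambda>A n. n \<in> A) ` C)"
  proof (subst openin_subopen, intro ballI)
    fix f assume f: "f \<in> UNIV - (\<lambda>A n. n \<in> A) ` C"
    have "{n. f n} \<notin> C" using f by (auto simp: image_iff)
    then obtain m where m: "\<And>B. B \<in> C \<Longrightarrow> \<not> (\<forall>n<m. f n \<longleftrightarrow> n \<in> B)"
      using L[unfolded closed_family_def, THEN spec, of "{n. f n}"] by auto
    have "{g. \<forall>i<m. g i = f i} \<subseteq> UNIV - (\<lambda>A n. n \<in> A) ` C"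
    proof clarsimp
      fix A assume "A \<in> C" "\<forall>i<m. (i \<in> A) = f i"
      then show False using m[of A] by auto
    qed
    then show "\<exists>T. openin cantor_space T \<and> f \<in> T \<and> T \<subseteq> UNIV - (\<lambda>A n. n \<in> A) ` C"
      using openin_cantor_cylinder[of m f] by blast
  qed
  then show "closedin cantor_space ((\<lambda>A n. n \<in> A) ` C)" by (simp add: closedin_def)
next
  assume R: "closedin cantor_space ((\<lambda>A n. n \<in> A) ` C)"
  show "closed_family C" unfolding closed_family_def
  proof (intro allI impI, rule ccontr)
    fix A assume A: "\<forall>m. \<exists>B\<in>C. \<forall>n<m. n \<in> A \<longleftrightarrow> n \<in> B" "A \<notin> C"
    have "openin cantor_space (UNIV - (\<lambda>A n. n \<in> A) ` C)" using R by (simp add: closedin_def)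
    moreover have "(\<lambda>n. n \<in> A) \<in> UNIV - (\<lambda>A n. n \<in> A) ` C"
    proof -
      have "(\<lambda>n. n \<in> A) \<noteq> (\<lambda>n. n \<in> B)" if "B \<in> C" for B
        using that A(2) by (metis Collect_mem_eq)
      then show ?thesis by auto
    qed
    ultimately obtain m where m: "{f. \<forall>i<m. f i = (i \<in> A)} \<subseteq> UNIV - (\<lambda>A n. n \<in> A) ` C"
      using cantor_open_contains_cylinder by meson
    obtain B where B: "B \<in> C" "\<forall>n<m. n \<in> A \<longleftrightarrow> n \<in> B" using A(1) by auto
    then have "(\<lambda>n. n \<in> B) \<in> {f. \<forall>i<m. f i = (i \<in> A)}" by auto
    with m B(1) show False by (meson DiffE imageI subsetD)
  qed
qed

lemma Sigma02_iff:
  "Sigma02 I \<longleftrightarrow> (\<exists>C::nat \<Rightarrow> nat set set. (\<forall>n. closed_family (C n)) \<and> I = (\<Union>n. C n))"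
proof
  let ?c = "\<lambda>A n::nat. n \<in> A"
  have inj: "inj ?c" by (auto simp: inj_def fun_eq_iff)
  assume "Sigma02 I"
  then obtain \<U> where U: "countable \<U>" "\<And>S. S \<in> \<U> \<Longrightarrow> closedin cantor_space S" "\<Union>\<U> = ?c ` I"
    by (auto simp: Sigma02_def fsigma_in_def union_of_def)
  \<comment> \<open>\<open>from_nat_into\<close> enumerates only nonempty families, and
    \<open>\<U>\<close> may be empty. Inserting the closed set \<open>{}\<close> leaves the union
    unchanged.\<close>
  define V where "V = insert {} \<U>"
  define C where "C n = ?c -` from_nat_into V n" for n
  have V: "countable V" "V \<noteq> {}" using U(1) by (auto simp: V_def)
  have im: "?c ` C n = from_nat_into V n" for n
  proof -
    have "\<exists>A. f = ?c A" for f :: "nat \<Rightarrow> bool" by (rule exI[of _ "{n. f n}"]) simp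
    then show ?thesis unfolding C_def by (simp add: image_vimage_eq) blast
  qed
  have "closed_family (C n)" for n
    unfolding closed_family_iff_closedin im
    using from_nat_into[OF V(2), of n] U(2) by (auto simp: V_def)
  moreover have "I = (\<Union>n. C n)"
  proof -
    have "?c ` I = \<Union>V" using U(3) by (simp add: V_def)
    also have "\<dots> = (\<Union>n. from_nat_into V n)" using range_from_nat_into[OF V(2,1)] by metis
    also have "\<dots> = ?c ` (\<Union>n. C n)" by (simp add: image_UN im)
    finally show ?thesis using inj by (simp add: inj_image_eq_iff)
  qed
  ultimately show "\<exists>C::nat \<Rightarrow> nat set set. (\<forall>n. closed_family (C n)) \<and> I = (\<Union>n. C n)" by blast
next
  assume "\<exists>C::nat \<Rightarrow> nat set set. (\<forall>n. closed_family (C n)) \<and> I = (\<Union>n. C n)"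
  then obtain C :: "nat \<Rightarrow> nat set set" where "\<And>n. closed_family (C n)" and I: "I = (\<Union>n. C n)" by blast
  then show "Sigma02 I"
    unfolding Sigma02_def I image_UN closed_family_iff_closedin
    by (intro fsigma_in_Union) (auto intro: closed_imp_fsigma_in)
qed

text \<open>Compactness: the members of \<open>C\<close> that contain \<open>B\<close> below
  \<open>m\<close> form a decreasing sequence of nonempty closed sets, and any point of its
  intersection is a member of \<open>C\<close> containing all of \<open>B\<close>.\<close>

lemma closed_family_downward_closure:
  assumes "closed_family C"
  shows "closed_family {B. \<exists>A\<in>C. B \<subseteq> A}"
  unfolding closed_family_def mem_Collect_eq
proof (intro allI impI)
  fix B assume B': "\<forall>m. \<exists>D\<in>{B. \<exists>A\<in>C. B \<subseteq> A}. \<forall>n<m. n \<in> B \<longleftrightarrow> n \<in> D"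
  have B: "\<exists>A\<in>C. \<forall>n<m. n \<in> B \<longrightarrow> n \<in> A" for m 
  proof -
    obtain D where "D \<in> {B. \<exists>A\<in>C. B \<subseteq> A}" and D: "\<forall>n<m. n \<in> B \<longleftrightarrow> n \<in> D"
      using B' by metis
    then obtain A where "A \<in> C" "D \<subseteq> A" by auto
    with D show ?thesis by auto
  qed
  let ?c = "\<lambda>A n::nat. n \<in> A"
  define R where "R m = {A\<in>C. \<forall>n<m. n \<in> B \<longrightarrow> n \<in> A}" for m
  have "compact_space cantor_space"
    unfolding cantor_space_def by (simp add: compact_space_product_topology compact_space_discrete_topology)
  moreover have "closedin cantor_space (?c ` R m)" for m
    unfolding closed_family_iff_closedin[symmetric] closed_family_def
  proof (intro allI impI)
    fix A assume A: "\<forall>k. \<exists>D\<in>R m. \<forall>n<k. n \<in> A \<longleftrightarrow> n \<in> D"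
    have R: "D \<in> C" "\<forall>n<m. n \<in> B \<longrightarrow> n \<in> D" if "D \<in> R m" for D
      using that by (auto simp: R_def)
    have "A \<in> C" using assms A R(1) unfolding closed_family_def by metis
    moreover have "\<forall>n<m. n \<in> B \<longrightarrow> n \<in> A" using A R(2) by metis
    ultimately show "A \<in> R m" by (simp add: R_def)
  qed
  moreover have "?c ` R m \<noteq> {}" for m
    using B[of m] by (auto simp: R_def)
  moreover have "decseq (\<lambda>m. ?c ` R m)" unfolding decseq_def R_def by (intro allI impI image_mono) auto
  ultimately have "(\<Inter>m. ?c ` R m) \<noteq> {}" by (rule compact_space_imp_nest)
  then obtain f where "f \<in> (\<Inter>m. ?c ` R m)" by (meson ex_in_conv)
  then have f: "f \<in> ?c ` R m" for m by (rule INT_D) simp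
  define A where "A = {n. f n}"
  have A: "A \<in> R m" for m
  proof -
    obtain A' where "A' \<in> R m" "f = ?c A'" using f[of m] by (rule imageE)
    then show ?thesis by (simp add: A_def)
  qed
  have "A \<in> C" using A[of 0] by (simp add: R_def)
  moreover have "B \<subseteq> A"
  proof
    fix n assume "n \<in> B"
    then show "n \<in> A" using A[of "Suc n"] by (simp add: R_def)
  qed
  ultimately show "\<exists>A\<in>C. B \<subseteq> A" by blast
qed

text \<open>The initial segments of \<open>A\<close> serve as approximations. This is how infinite
  unions are brought into a closed family when only finite sets are under control.\<close>

lemma closed_familyD_finite:
  assumes "closed_family K" "\<And>F. finite F \<Longrightarrow> F \<subseteq> A \<Longrightarrow> F \<in> K"
  shows "A \<in> K"
proof -
  have "\<exists>B\<in>K. \<forall>n<m. n \<in> A \<longleftrightarrow> n \<in> B" for m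
    by (rule bexI[of _ "A \<inter> {..<m}"]) (auto intro!: assms(2))
  then show ?thesis using assms(1) unfolding closed_family_def by blast
qed

section \<open>Absorbing families\<close>

lemma finite_subset_increasing_union:
  fixes g :: "nat \<Rightarrow> 'a set"
  assumes "\<And>n. g n \<subseteq> g (Suc n)" "finite F" "F \<subseteq> (\<Union>n. g n)"
  obtains n where "F \<subseteq> g n"
proof -
  have mono: "g m \<subseteq> g n" if "m \<le> n" for m n using lift_Suc_mono_le[of g, OF assms(1) that] .
  have "\<exists>n. F \<subseteq> g n" using assms(2,3)
  proof (induction F rule: finite_induct)
    case (insert x F)
    then obtain n k where "F \<subseteq> g n" "x \<in> g k" by auto
    then have "insert x F \<subseteq> g (max n k)" using mono[of n "max n k"] mono[of k "max n k"] by auto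
    then show ?case by blast
  qed auto
  then show ?thesis using that by (elim exE)
qed

lemma hereditaryD: "hereditary K \<Longrightarrow> A \<in> K \<Longrightarrow> B \<subseteq> A \<Longrightarrow> B \<in> K"
  by (auto simp: hereditary_def)

lemma hereditaryI: "(\<And>A B. A \<in> K \<Longrightarrow> B \<subseteq> A \<Longrightarrow> B \<in> K) \<Longrightarrow> hereditary K"
  unfolding hereditary_def by simp

lemma hereditary_Int: "hereditary K \<Longrightarrow> hereditary L \<Longrightarrow> hereditary (K \<inter> L)"
  by (rule hereditaryI) (blast dest: hereditaryD)

lemma absorbingE:
  assumes "absorbing I K" "A \<in> I" obtains m where "A - {..m} \<in> K"
  using assms by (auto simp: absorbing_def)

lemma absorbing_mono: "absorbing I K \<Longrightarrow> K \<subseteq> L \<Longrightarrow> absorbing I L"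
  unfolding absorbing_def by blast

lemma ideal_on_nat_hereditary: "ideal_on_nat I \<Longrightarrow> hereditary I"
  by (auto simp: ideal_on_nat_def hereditary_def)

lemma P_idealE:
  fixes A :: "nat \<Rightarrow> nat set"
  assumes "P_ideal I" "\<And>k. A k \<in> I"
  obtains B m where "B \<in> I" "\<And>k. A k - {..m k} \<subseteq> B"
proof -
  obtain B where B: "B \<in> I" "\<And>k. finite (A k - B)"
    using assms(2) assms(1)[unfolded P_ideal_def, THEN conjunct2, THEN spec, of A] by blast
  have "\<exists>m. A k - B \<subseteq> {..m}" for k
    using B(2)[of k] finite_nat_set_iff_bounded_le by auto
  then obtain m where m: "\<And>k. A k - B \<subseteq> {..m k}" by metis
  show ?thesis by (rule that[OF B(1), of m]) (use m in auto)
qed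

text \<open>Diagonal argument: otherwise each \<open>X k\<close> contains no tail of some
  \<open>A k\<close> in \<open>I\<close>. A set \<open>B\<close> in \<open>I\<close> almost
  containing all \<open>A k\<close> lies in one of the \<open>X k\<close>, which by heredity then
  contains a tail of \<open>A k\<close>.\<close>

lemma P_ideal_absorbing_piece:
  fixes X :: "nat \<Rightarrow> nat set set"
  assumes "P_ideal I" "I \<subseteq> (\<Union>k. X k)" "\<And>k. hereditary (X k)"
  shows "\<exists>k. absorbing I (X k)"
proof (rule ccontr)
  assume "\<nexists>k. absorbing I (X k)"
  then have "\<forall>k. \<exists>A\<in>I. \<forall>m. A - {..m} \<notin> X k" by (auto simp: absorbing_def)
  then obtain A where A: "\<And>k. A k \<in> I" "\<And>k m. A k - {..m} \<notin> X k" by metis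
  obtain B m where B: "B \<in> I" "\<And>k. A k - {..m k} \<subseteq> B" using P_idealE[where A=A, OF assms(1) A(1)] by blast
  obtain k where "B \<in> X k" using B(1) assms(2) by auto
  then have "A k - {..m k} \<in> X k" using B(2) assms(3) hereditaryD by metis
  with A(2) show False by blast
qed

text \<open>In the halving argument the partial unions of blocks are kept in this subfamily of
  \<open>L\<close>: from such a set the construction can always be continued far out.\<close>

definition internal :: "nat set set \<Rightarrow> nat set set \<Rightarrow> nat set set" where
  "internal I L = {A. \<forall>B\<in>I. \<exists>k. A \<union> (B - {..k}) \<in> L}"

lemma internal_subset:
  assumes "{} \<in> I" shows "internal I L \<subseteq> L"
proof
  fix A assume "A \<in> internal I L"
  then have "\<exists>k. A \<union> ({} - {..k}) \<in> L" using assms unfolding internal_def mem_Collect_eq by (rule bspec)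
  then show "A \<in> L" by simp
qed

lemma hereditary_internal:
  assumes "hereditary L" shows "hereditary (internal I L)"
proof (rule hereditaryI, unfold internal_def mem_Collect_eq, rule ballI)
  fix A B C assume A: "\<forall>B\<in>I. \<exists>k. A \<union> (B - {..k}) \<in> L" and "B \<subseteq> A" and "C \<in> I"
  then obtain k where "A \<union> (C - {..k}) \<in> L" by blast
  moreover have "B \<union> (C - {..k}) \<subseteq> A \<union> (C - {..k})" using \<open>B \<subseteq> A\<close> by blast
  ultimately show "\<exists>k. B \<union> (C - {..k}) \<in> L" using assms hereditaryD by metis
qed

text \<open>If no tail of \<open>A\<close> were internal, some \<open>B m\<close> in
  \<open>I\<close> would witness this for each tail. Let \<open>C\<close> in \<open>I\<close> almost
  contain all \<open>B m\<close>; a tail of \<open>A \<union> C\<close> lies in \<open>L\<close>,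
  and it contains a forbidden union for that \<open>m\<close>.\<close>

lemma absorbing_internal:
  assumes I: "P_ideal I" and L: "hereditary L" "absorbing I L"
  shows "absorbing I (internal I L)"
  unfolding absorbing_def
proof (rule ballI, rule ccontr)
  fix A assume A: "A \<in> I" and "\<nexists>m. A - {..m} \<in> internal I L"
  then have "\<forall>m. \<exists>B\<in>I. \<forall>k. (A - {..m}) \<union> (B - {..k}) \<notin> L" by (auto simp: internal_def)
  then obtain B where B: "\<And>m. B m \<in> I" "\<And>m k. (A - {..m}) \<union> (B m - {..k}) \<notin> L" by metis
  obtain C j where C: "C \<in> I" "\<And>m. B m - {..j m} \<subseteq> C" using P_idealE[where A=B, OF I B(1)] by blast
  have "A \<union> C \<in> I" using I A C(1) by (auto simp: P_ideal_def ideal_on_nat_def)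
  then obtain m where m: "(A \<union> C) - {..m} \<in> L" using L(2) by (auto simp: absorbing_def)
  have "(A - {..m}) \<union> (B m - {..max m (j m)}) \<subseteq> (A \<union> C) - {..m}" using C(2)[of m] by auto
  with m L(1) B(2) show False using hereditaryD by metis
qed

lemma closed_family_finite_subsets:
  "closed_family {A. \<forall>F. finite F \<longrightarrow> F \<subseteq> A \<longrightarrow> F \<in> L}"
  unfolding closed_family_def mem_Collect_eq
proof (intro allI impI)
  fix A F assume A: "\<forall>m. \<exists>B\<in>{A. \<forall>F. finite F \<longrightarrow> F \<subseteq> A \<longrightarrow> F \<in> L}. \<forall>n<m. (n \<in> A) = (n \<in> B)"
    and F: "finite F" "F \<subseteq> A"
  obtain m where m: "F \<subseteq> {..<m}" using F(1) finite_nat_bounded by blast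
  obtain B where "B \<in> {A. \<forall>F. finite F \<longrightarrow> F \<subseteq> A \<longrightarrow> F \<in> L}" "\<forall>n<m. (n \<in> A) = (n \<in> B)"
    using A[THEN spec, of m] by (rule bexE)
  moreover from this m F(2) have "F \<subseteq> B" by auto
  ultimately show "F \<in> L" using F(1) by simp
qed

lemma closed_family_Int:
  assumes "closed_family C" "closed_family D" shows "closed_family (C \<inter> D)"
  unfolding closed_family_def
proof (intro allI impI IntI)
  fix A assume A: "\<forall>m. \<exists>B\<in>C \<inter> D. \<forall>n<m. (n \<in> A) = (n \<in> B)"
  have "\<exists>B\<in>C. \<forall>n<m. (n \<in> A) = (n \<in> B)" "\<exists>B\<in>D. \<forall>n<m. (n \<in> A) = (n \<in> B)" for m
    using A[THEN spec, of m] by auto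
  then show "A \<in> C" "A \<in> D" using assms by (auto simp: closed_family_def)
qed

section \<open>Halving a closed hereditary absorbing family\<close>

definition good_family :: "nat set set \<Rightarrow> nat set set \<Rightarrow> bool" where
  "good_family I K \<longleftrightarrow> closed_family K \<and> hereditary K \<and> absorbing I K \<and> K \<subseteq> I"

lemma good_family_halving:
  assumes I: "P_ideal I" "Fin \<subseteq> I" and L: "good_family I L"
  shows "\<exists>K. good_family I K \<and> (\<forall>A\<in>K. \<forall>B\<in>K. A \<union> B \<in> L)"
proof (rule ccontr)
  assume neg: "\<nexists>K. good_family I K \<and> (\<forall>A\<in>K. \<forall>B\<in>K. A \<union> B \<in> L)"
  have clL: "closed_family L" and heL: "hereditary L" and abL: "absorbing I L" and LI: "L \<subseteq> I"
    using L by (auto simp: good_family_def)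
  have emp: "{} \<in> I" and un: "\<And>A B. A \<in> I \<Longrightarrow> B \<in> I \<Longrightarrow> A \<union> B \<in> I"
    using I(1) by (auto simp: P_ideal_def ideal_on_nat_def)
  \<comment> \<open>Membership in \<open>L\<close> alone would not allow a further step; both
    partial unions are therefore kept in \<open>N\<close>.\<close>
  define N where "N = internal I L"
  have NL: "N \<subseteq> L" and heN: "hereditary N"
    using internal_subset[OF emp] hereditary_internal[OF heL] by (auto simp: N_def)
  define Lr where "Lr s = {A. s \<union> A \<in> L}" for s
  have heLr: "hereditary (Lr s)" for s
    by (rule hereditaryI, unfold Lr_def mem_Collect_eq) (erule hereditaryD[OF heL], auto)
  have intLr: "internal I (Lr s) = {A. s \<union> A \<in> N}" for s
    by (auto simp: internal_def Lr_def N_def Un_assoc)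
  have abLr: "absorbing I (internal I (Lr s))" if "s \<in> N" for s
  proof (rule absorbing_internal[OF I(1) heLr])
    show "absorbing I (Lr s)" using that unfolding absorbing_def Lr_def N_def internal_def by simp
  qed
  \<comment> \<open>\<open>{A. s \<union> A \<in> N}\<close> is not known to be closed. Testing
    finite subsets only gives a closed hereditary family that contains it and still controls the
    finite blocks to be added to \<open>s\<close>.\<close>
  define Q where "Q s = {A. \<forall>F. finite F \<longrightarrow> F \<subseteq> A \<longrightarrow> s \<union> F \<in> N}" for s
  have clQ: "closed_family (Q s)" for s
    using closed_family_finite_subsets[of "{A. s \<union> A \<in> N}"] by (simp add: Q_def)
  have heQ: "hereditary (Q s)" for s
    by (rule hereditaryI, unfold Q_def mem_Collect_eq) (meson order_trans)
  have subQ: "internal I (Lr s) \<subseteq> Q s" for s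
  proof
    fix A assume "A \<in> internal I (Lr s)"
    then have A: "s \<union> A \<in> N" by (simp add: intLr)
    have "s \<union> F \<in> N" if "F \<subseteq> A" for F
      by (rule hereditaryD[OF heN A]) (use that in auto)
    then show "A \<in> Q s" by (simp add: Q_def)
  qed
  have step: "\<exists>u v. finite u \<and> finite v \<and> s \<union> u \<in> N \<and> t \<union> v \<in> N \<and> u \<union> v \<notin> L \<and> u \<union> v \<subseteq> {n<..}"
    if s: "s \<in> N" and t: "t \<in> N" for s t n
  proof -
    \<comment> \<open>\<open>K'\<close> is a good family, so by \<open>neg\<close> it cannot be a
      half of \<open>L\<close>: two of its members have a union outside \<open>L\<close>. The last
      condition, also tested on finite sets to stay closed, pushes the members beyond
      \<open>n\<close>.\<close>
    define K' where "K' = (Q s \<inter> Q t) \<inter> (L \<inter> {A. \<forall>F. finite F \<longrightarrow> F \<subseteq> A \<longrightarrow> F \<subseteq> {n<..}})"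
    have K'n: "A \<subseteq> {n<..}" if "A \<in> K'" for A
    proof
      fix x assume "x \<in> A"
      then have "finite {x}" "{x} \<subseteq> A" by auto
      moreover have "\<forall>F. finite F \<longrightarrow> F \<subseteq> A \<longrightarrow> F \<subseteq> {n<..}" using that by (simp add: K'_def)
      ultimately have "{x} \<subseteq> {n<..}" by metis
      then show "x \<in> {n<..}" by simp
    qed
    have "closed_family K'"
      unfolding K'_def
      using closed_family_finite_subsets[of "{F. F \<subseteq> {n<..}}"]
      by (intro closed_family_Int clQ clL) simp
    moreover have "hereditary K'"
      unfolding K'_def
      by (intro hereditary_Int heQ heL) (rule hereditaryI, unfold mem_Collect_eq, meson order_trans)
    moreover have "absorbing I K'"
      unfolding absorbing_def
    proof
      fix A assume A: "A \<in> I"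
      obtain m1 where m1: "A - {..m1} \<in> Q s" using absorbingE[OF absorbing_mono[OF abLr[OF s] subQ] A] .
      obtain m2 where m2: "A - {..m2} \<in> Q t" using absorbingE[OF absorbing_mono[OF abLr[OF t] subQ] A] .
      obtain m3 where m3: "A - {..m3} \<in> L" using absorbingE[OF abL A] .
      define m where "m = m1 + m2 + m3 + n"
      have "A - {..m} \<in> Q s" by (rule hereditaryD[OF heQ m1]) (auto simp: m_def)
      moreover have "A - {..m} \<in> Q t" by (rule hereditaryD[OF heQ m2]) (auto simp: m_def)
      moreover have "A - {..m} \<in> L" by (rule hereditaryD[OF heL m3]) (auto simp: m_def)
      moreover have "A - {..m} \<subseteq> {n<..}" by (auto simp: m_def)
      then have "\<forall>F. finite F \<longrightarrow> F \<subseteq> A - {..m} \<longrightarrow> F \<subseteq> {n<..}" by (meson order_trans)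
      ultimately have "A - {..m} \<in> K'" by (simp add: K'_def)
      then show "\<exists>m. A - {..m} \<in> K'" by (rule exI)
    qed
    moreover have "K' \<subseteq> I" using LI unfolding K'_def by (meson Int_lower1 Int_lower2 order_trans)
    ultimately obtain A B where AB: "A \<in> K'" "B \<in> K'" "A \<union> B \<notin> L"
      using neg unfolding good_family_def by meson
    \<comment> \<open>Closedness of \<open>L\<close> makes the failure visible on a finite
      \<open>F\<close>; its traces on \<open>A\<close> and \<open>B\<close> are the two
      blocks.\<close>
    then obtain F where F: "finite F" "F \<subseteq> A \<union> B" "F \<notin> L"
      using closed_familyD_finite[OF clL, of "A \<union> B"] by meson
    have "s \<union> (F \<inter> A) \<in> N" "t \<union> (F \<inter> B) \<in> N"
      using AB(1,2) F(1) by (simp_all add: K'_def Q_def)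
    moreover have "F \<inter> A \<union> F \<inter> B = F" using F(2) by auto
    moreover have "F \<subseteq> {n<..}" using F(2) K'n[OF AB(1)] K'n[OF AB(2)] by blast
    ultimately show ?thesis using F(1,3) by (intro exI[of _ "F \<inter> A"] exI[of _ "F \<inter> B"]) auto
  qed
  define P where "P x \<longleftrightarrow> fst x \<in> N \<and> snd x \<in> N" for x :: "nat set \<times> nat set"
  define R where "R n x y \<longleftrightarrow> (\<exists>u v. fst y = fst x \<union> u \<and> snd y = snd x \<union> v \<and> u \<union> v \<notin> L \<and> u \<union> v \<subseteq> {n<..})"
    for n :: nat and x y :: "nat set \<times> nat set"
  have "\<exists>f. \<forall>n. P (f n) \<and> R n (f n) (f (Suc n))"
  proof (rule dependent_nat_choice)
    have "{} \<in> N" using abL by (simp add: absorbing_def N_def internal_def)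
    then show "\<exists>x. P x" unfolding P_def by (intro exI[of _ "({},{})"]) simp
  next
    fix x n assume "P x"
    then obtain u v where "fst x \<union> u \<in> N \<and> snd x \<union> v \<in> N \<and> u \<union> v \<notin> L \<and> u \<union> v \<subseteq> {n<..}"
      using step unfolding P_def by meson
    then show "\<exists>y. P y \<and> R n x y" unfolding P_def R_def
      by (intro exI[of _ "(fst x \<union> u, snd x \<union> v)"] conjI exI[of _ u] exI[of _ v]) simp_all
  qed
  then obtain f where "\<forall>n. P (f n) \<and> R n (f n) (f (Suc n))" by (rule exE)
  then have f: "fst (f n) \<in> N" "snd (f n) \<in> N" and st: "R n (f n) (f (Suc n))" for n
    by (simp_all add: P_def)
  have inc: "fst (f n) \<subseteq> fst (f (Suc n))" "snd (f n) \<subseteq> snd (f (Suc n))" for n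
    using st[of n] by (auto simp: R_def)
  have lim: "(\<Union>n. g n) \<in> I" if g: "\<And>n. g n \<in> N" "\<And>n. g n \<subseteq> g (Suc n)" for g :: "nat \<Rightarrow> nat set"
  proof -
    have "(\<Union>n. g n) \<in> L"
    proof (rule closed_familyD_finite[OF clL])
      fix F assume F: "finite F" "F \<subseteq> (\<Union>n. g n)"
      obtain n where "F \<subseteq> g n" using finite_subset_increasing_union[of g, OF g(2) F] .
      then show "F \<in> L" using g(1) NL heL hereditaryD by (metis subsetD)
    qed
    then show ?thesis using LI by blast
  qed
  define S where "S = (\<Union>n. fst (f n)) \<union> (\<Union>n. snd (f n))"
  have "S \<in> I"
    unfolding S_def by (intro un lim f inc)
  then obtain m where m: "S - {..m} \<in> L" by (rule absorbingE[OF abL])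
  \<comment> \<open>The blocks of stage \<open>m\<close> lie beyond \<open>m\<close>, so they
    survive in the tail of \<open>S\<close> although their union is not in \<open>L\<close>.\<close>
  obtain u v where uv: "fst (f (Suc m)) = fst (f m) \<union> u" "snd (f (Suc m)) = snd (f m) \<union> v"
     "u \<union> v \<notin> L" "u \<union> v \<subseteq> {m<..}" using st[of m] unfolding R_def by metis
  have "u \<subseteq> fst (f (Suc m))" "v \<subseteq> snd (f (Suc m))" using uv by auto
  then have "u \<union> v \<subseteq> S - {..m}" using uv(4) unfolding S_def by auto
  with m uv(3) heL show False using hereditaryD by metis
qed

section \<open>Solecki's theorem for \<open>\<Sigma>\<^sup>0\<^sub>2\<close> P-ideals\<close>

text \<open>The lists replace the chains of the Birkhoff-Kakutani metrization: an entry
  \<open>k\<close> pays \<open>(1/2) ^ k\<close> for the use of one piece from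
  \<open>K k\<close>.\<close>

primrec cover_sets :: "(nat \<Rightarrow> nat set set) \<Rightarrow> nat list \<Rightarrow> nat set set" where
  "cover_sets K [] = {{}}"
| "cover_sets K (k # ks) = {A \<union> B | A B. A \<in> K k \<and> B \<in> cover_sets K ks}"

definition weight :: "nat list \<Rightarrow> real" where
  "weight ks = (\<Sum>k\<leftarrow>ks. (1/2) ^ k)"

lemma weight_simps [simp]:
  "weight [] = 0" "weight (k # ks) = (1/2) ^ k + weight ks" "weight (ks @ ls) = weight ks + weight ls"
  by (simp_all add: weight_def)

lemma weight_nonneg [simp]: "0 \<le> weight ks"
  by (induction ks) auto

lemma cover_sets_appendI:
  "A \<in> cover_sets K ks \<Longrightarrow> B \<in> cover_sets K ls \<Longrightarrow> A \<union> B \<in> cover_sets K (ks @ ls)"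
proof (induction ks arbitrary: A)
  case (Cons k ks)
  then obtain A1 A2 where A: "A = A1 \<union> A2" "A1 \<in> K k" "A2 \<in> cover_sets K ks" by auto
  with Cons have "A2 \<union> B \<in> cover_sets K (ks @ ls)" by simp
  moreover have "A \<union> B = A1 \<union> (A2 \<union> B)" using A(1) by (simp add: Un_assoc)
  ultimately show ?case using A(2) by auto
qed simp

lemma cover_sets_appendE:
  assumes "A \<in> cover_sets K (ks @ ls)"
  obtains B C where "A = B \<union> C" "B \<in> cover_sets K ks" "C \<in> cover_sets K ls"
  using assms
proof (induction ks arbitrary: A thesis)
  case Nil
  from Nil(1)[of "{}" A] Nil(2) show ?case by simp
next
  case (Cons k ks)
  from Cons(3) obtain A1 A2 where A: "A = A1 \<union> A2" "A1 \<in> K k" "A2 \<in> cover_sets K (ks @ ls)" by auto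
  from Cons(1)[OF _ A(3)] obtain B C where "A2 = B \<union> C" "B \<in> cover_sets K ks" "C \<in> cover_sets K ls" by metis
  moreover have "A = (A1 \<union> B) \<union> C" using A(1) \<open>A2 = B \<union> C\<close> by (simp add: Un_assoc)
  moreover have "A1 \<union> B \<in> cover_sets K (k # ks)" using A(2) \<open>B \<in> cover_sets K ks\<close> by auto
  ultimately show ?case using Cons(2) by metis
qed

lemma hereditary_cover_sets:
  assumes "\<And>k. hereditary (K k)" shows "hereditary (cover_sets K ks)"
proof (induction ks)
  case Nil show ?case by (rule hereditaryI) auto
next
  case (Cons k ks)
  show ?case
  proof (rule hereditaryI)
    fix A B assume "A \<in> cover_sets K (k # ks)" and BA: "B \<subseteq> A"
    then obtain A1 A2 where A: "A = A1 \<union> A2" "A1 \<in> K k" "A2 \<in> cover_sets K ks" by auto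
    have "B \<inter> A1 \<in> K k" "B \<inter> A2 \<in> cover_sets K ks"
      using hereditaryD[OF assms A(2)] hereditaryD[OF Cons.IH A(3)] by auto
    moreover have "B = (B \<inter> A1) \<union> (B \<inter> A2)" using BA A(1) by auto
    ultimately show "B \<in> cover_sets K (k # ks)" by auto
  qed
qed

text \<open>The entry \<open>k\<close> is the one at which the running weight first exceeds
  \<open>c\<close>.\<close>

lemma weight_split:
  assumes "0 \<le> c" "c < weight ks"
  shows "\<exists>ls k rs. ks = ls @ k # rs \<and> weight ls \<le> c \<and> c < weight ls + (1/2) ^ k"
  using assms
proof (induction ks arbitrary: c)
  case (Cons k ks)
  show ?case
  proof (cases "c < (1/2) ^ k")
    case True
    then show ?thesis using Cons.prems by (intro exI[of _ "[]"] exI[of _ k] exI[of _ ks]) simp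
  next
    case False
    then obtain ls l rs where "ks = ls @ l # rs" "weight ls \<le> c - (1/2) ^ k" "c - (1/2) ^ k < weight ls + (1/2) ^ l"
      using Cons.IH[of "c - (1/2)^k"] Cons.prems by auto
    then show ?thesis by (intro exI[of _ "k # ls"] exI[of _ l] exI[of _ rs]) simp
  qed
qed simp

text \<open>The chain argument of the Birkhoff-Kakutani metrization: cut the list in the middle of its
  weight.\<close>

lemma cover_sets_light:
  assumes emp: "\<And>j. {} \<in> K j"
    and tri: "\<And>j A B C. A \<in> K (Suc j) \<Longrightarrow> B \<in> K (Suc j) \<Longrightarrow> C \<in> K (Suc j) \<Longrightarrow> A \<union> B \<union> C \<in> K j"
    and "A \<in> cover_sets K ks" "weight ks < (1/2) ^ j"
  shows "A \<in> K j"
  using assms(3,4)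
proof (induction ks arbitrary: A j rule: length_induct)
  case (1 ks)
  have anti: "K j \<subseteq> K i" if "i \<le> j" for i j
    using that
  proof (induction j)
    case (Suc j)
    have "K (Suc j) \<subseteq> K j" using tri[of _ j "{}" "{}"] emp by auto
    then show ?case using Suc by (cases "i = Suc j") auto
  qed simp
  show ?case
  proof (cases "ks = []")
    case True then show ?thesis using 1(2) emp by simp
  next
    case False
    then have pos: "0 < weight ks" by (cases ks) (auto intro: add_pos_nonneg)
    then obtain ls k rs where ks: "ks = ls @ k # rs"
      and ls: "weight ls \<le> weight ks / 2" "weight ks / 2 < weight ls + (1/2) ^ k"
      using weight_split[of "weight ks / 2" ks] by auto
    have rs: "weight rs < weight ks / 2" using ks ls by simp
    obtain L A' where A': "A = L \<union> A'" "L \<in> cover_sets K ls" "A' \<in> cover_sets K (k # rs)"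
      using cover_sets_appendE 1(2) unfolding ks by metis
    then obtain M R where MR: "A' = M \<union> R" "M \<in> K k" "R \<in> cover_sets K rs" by auto
    \<comment> \<open>With the cut at half the weight, the parts before and after the entry
      \<open>k\<close> are shorter lists of weight at most half, hence below
      \<open>(1/2) ^ Suc j\<close>.\<close>
    have IH: "B \<in> K (Suc j)"
      if "length us < length ks" "B \<in> cover_sets K us" "weight us \<le> weight ks / 2" for us B
    proof -
      have "weight us < (1/2) ^ Suc j" using that(3) 1(3) by simp
      then show ?thesis using 1(1) that(1,2) by blast
    qed
    have "L \<in> K (Suc j)" using A'(2) ls(1) by (intro IH[of ls]) (auto simp: ks)
    moreover have "R \<in> K (Suc j)" using MR(3) less_imp_le[OF rs] by (intro IH[of rs]) (auto simp: ks)
    \<comment> \<open>A single entry lighter than \<open>(1/2) ^ j\<close> has an index above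
      \<open>j\<close>, and the families decrease with the index.\<close>
    moreover have "M \<in> K (Suc j)"
    proof -
      have "(1/2::real) ^ k \<le> weight ks" using ks by simp
      then have "(1/2::real) ^ k < (1/2) ^ j" using 1(3) by (rule le_less_trans)
      then have "Suc j \<le> k" by (simp add: power_strict_decreasing_iff)
      then show ?thesis using anti MR(2) by blast
    qed
    ultimately have "L \<union> M \<union> R \<in> K j" by (intro tri)
    then show ?thesis using A'(1) MR(1) by (simp add: Un_assoc)
  qed
qed

text \<open>An empty infimum is infinite, so sets without a cover get infinite weight. For
  hereditary families it makes no difference whether \<open>A\<close> equals such a union or is
  contained in one.\<close>

definition cover_weight :: "(nat \<Rightarrow> nat set set) \<Rightarrow> nat set \<Rightarrow> ennreal" where
  "cover_weight K A = (INF ks\<in>{ks. A \<in> cover_sets K ks}. ennreal (weight ks))"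

text \<open>The supremum over finite subsets forces lower semi-continuity. In exchange a small value
  only says something about finite subsets, and closedness of the families has to carry it to the
  whole set.\<close>

definition cover_submeasure :: "(nat \<Rightarrow> nat set set) \<Rightarrow> nat set \<Rightarrow> ennreal" where
  "cover_submeasure K A = (SUP F\<in>{F. finite F \<and> F \<subseteq> A}. cover_weight K F)"

lemma cover_weight_le: "A \<in> cover_sets K ks \<Longrightarrow> cover_weight K A \<le> ennreal (weight ks)"
  unfolding cover_weight_def by (rule INF_lower) simp

lemma cover_weight_lessE:
  assumes "cover_weight K A < c"
  obtains ks where "A \<in> cover_sets K ks" "ennreal (weight ks) < c"
  using assms unfolding cover_weight_def INF_less_iff by auto

lemma cover_weight_mono:
  assumes "\<And>k. hereditary (K k)" "A \<subseteq> B"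
  shows "cover_weight K A \<le> cover_weight K B"
  unfolding cover_weight_def
  by (rule INF_superset_mono) (use hereditaryD[OF hereditary_cover_sets[of K, OF assms(1)]] assms(2) in auto)

text \<open>Concatenate lists that are optimal up to \<open>e/2\<close>.\<close>

lemma cover_weight_Un: "cover_weight K (A \<union> B) \<le> cover_weight K A + cover_weight K B"
proof (rule ennreal_le_epsilon)
  fix e :: real assume fin: "cover_weight K A + cover_weight K B < Orderings.top" and e: "0 < e"
  have "cover_weight K A < cover_weight K A + ennreal (e/2)" "cover_weight K B < cover_weight K B + ennreal (e/2)"
    using fin e by (auto simp: ennreal_add_left_cancel_less less_top[symmetric] top_unique)
  then obtain ks ls where "A \<in> cover_sets K ks" "B \<in> cover_sets K ls"
    and w: "ennreal (weight ks) < cover_weight K A + ennreal (e/2)" "ennreal (weight ls) < cover_weight K B + ennreal (e/2)"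
    by (metis cover_weight_lessE)
  then have "cover_weight K (A \<union> B) \<le> ennreal (weight (ks @ ls))"
    by (intro cover_weight_le cover_sets_appendI)
  also have "\<dots> = ennreal (weight ks) + ennreal (weight ls)" by (simp add: ennreal_plus)
  also have "\<dots> \<le> (cover_weight K A + ennreal (e/2)) + (cover_weight K B + ennreal (e/2))"
    using w by (intro add_mono) auto
  also have "\<dots> = cover_weight K A + cover_weight K B + (ennreal (e/2) + ennreal (e/2))"
    by (simp add: ac_simps)
  also have "ennreal (e/2) + ennreal (e/2) = ennreal e"
    using e by (simp flip: ennreal_plus)
  finally show "cover_weight K (A \<union> B) \<le> cover_weight K A + cover_weight K B + ennreal e" .
qed

text \<open>Singletons in \<open>K 0\<close> bound the value at points by 1. For continuity along
  increasing unions, a finite subset of the union already lies in one term.\<close>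

lemma cover_submeasure_lsc:
  assumes her: "\<And>k. hereditary (K k)" and sing: "\<And>n. {n} \<in> K 0"
  shows "lsc_submeasure (cover_submeasure K)"
  unfolding lsc_submeasure_def
proof (intro conjI allI impI)
  have le: "cover_weight K F \<le> cover_submeasure K A" if "finite F" "F \<subseteq> A" for F A
    unfolding cover_submeasure_def using that by (intro SUP_upper) simp
  show mono: "cover_submeasure K A \<le> cover_submeasure K B" if "A \<subseteq> B" for A B
    unfolding cover_submeasure_def by (rule SUP_subset_mono) (use that in auto)
  have "cover_weight K {} \<le> 0" using cover_weight_le[of "{}" K "[]"] by simp
  then have "cover_weight K {} = 0" by simp
  moreover have "{F::nat set. finite F \<and> F \<subseteq> {}} = {{}}" by auto
  ultimately show "cover_submeasure K {} = 0"
    unfolding cover_submeasure_def by simp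
  show "cover_submeasure K (A \<union> B) \<le> cover_submeasure K A + cover_submeasure K B" for A B
    unfolding cover_submeasure_def[of K "A \<union> B"]
  proof (rule SUP_least)
    fix F assume "F \<in> {F. finite F \<and> F \<subseteq> A \<union> B}"
    then have F: "finite F" "F = (F \<inter> A) \<union> (F \<inter> B)" by auto
    have "cover_weight K F \<le> cover_weight K (F \<inter> A) + cover_weight K (F \<inter> B)"
      using cover_weight_Un[of K "F \<inter> A" "F \<inter> B"] F(2) by simp
    also have "\<dots> \<le> cover_submeasure K A + cover_submeasure K B"
      using F(1) by (intro add_mono le) auto
    finally show "cover_weight K F \<le> cover_submeasure K A + cover_submeasure K B" .
  qed
  show "cover_submeasure K {n} < \<infinity>" for n
  proof -
    have "cover_submeasure K {n} \<le> cover_weight K {n}"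
      unfolding cover_submeasure_def by (rule SUP_least) (auto intro: cover_weight_mono her)
    also have "\<dots> \<le> ennreal (weight [0])" by (rule cover_weight_le) (use sing in auto)
    also have "\<dots> < \<infinity>" by (simp add: ennreal_less_top)
    finally show ?thesis .
  qed
  fix A :: "nat \<Rightarrow> nat set" assume A: "\<forall>m. A m \<subseteq> A (Suc m)"
  have inc: "A m \<subseteq> A n" if "m \<le> n" for m n
    using A by (intro lift_Suc_mono_le[of A, OF _ that]) simp
  have "(\<lambda>m. cover_submeasure K (A m)) \<longlonglongrightarrow> (SUP m. cover_submeasure K (A m))"
    by (intro LIMSEQ_SUP) (simp add: incseq_def mono inc)
  moreover have "(SUP m. cover_submeasure K (A m)) = cover_submeasure K (\<Union>m. A m)"
  proof (rule antisym)
    show "(SUP m. cover_submeasure K (A m)) \<le> cover_submeasure K (\<Union>m. A m)"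
      by (intro SUP_least mono) auto
    show "cover_submeasure K (\<Union>m. A m) \<le> (SUP m. cover_submeasure K (A m))"
      unfolding cover_submeasure_def[of K "\<Union>m. A m"]
    proof (rule SUP_least)
      fix F assume "F \<in> {F. finite F \<and> F \<subseteq> (\<Union>m. A m)}"
      then have F: "finite F" "F \<subseteq> (\<Union>m. A m)" by auto
      obtain n where "F \<subseteq> A n" using finite_subset_increasing_union[of A, OF A[rule_format] F] .
      then have "cover_weight K F \<le> cover_submeasure K (A n)" using F(1) by (intro le)
      also have "\<dots> \<le> (SUP m. cover_submeasure K (A m))" by (rule SUP_upper) simp
      finally show "cover_weight K F \<le> (SUP m. cover_submeasure K (A m))" .
    qed
  qed
  ultimately show "(\<lambda>m. cover_submeasure K (A m)) \<longlonglongrightarrow> cover_submeasure K (\<Union>m. A m)" by simp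
qed

section \<open>From a sequence of good families to the representing submeasure\<close>

lemma closed_family_Pow: "closed_family (Pow X)"
  unfolding closed_family_def by (metis PowD PowI lessI subset_iff)

text \<open>The closed pieces of \<open>I\<close> need not be hereditary. Their downward closures
  are, remain closed by compactness, stay inside \<open>I\<close>, and one of them is
  absorbing.\<close>

lemma Sigma02_P_ideal_good_family:
  assumes "Sigma02 I" "P_ideal I"
  shows "\<exists>K. good_family I K"
proof -
  obtain C :: "nat \<Rightarrow> nat set set" where C: "\<And>n. closed_family (C n)" and I: "I = (\<Union>n. C n)"
    using assms(1) unfolding Sigma02_iff by metis
  define X where "X n = {B. \<exists>A\<in>C n. B \<subseteq> A}" for n
  have her: "hereditary (X n)" for n
    by (rule hereditaryI) (auto simp: X_def)
  have "A \<in> X n" if "A \<in> C n" for A n using that unfolding X_def by blast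
  then have "I \<subseteq> (\<Union>n. X n)" unfolding I by blast
  then obtain k where k: "absorbing I (X k)"
    using P_ideal_absorbing_piece[where X=X, OF assms(2) _ her] by meson
  have "hereditary I" using assms(2) by (meson P_ideal_def ideal_on_nat_hereditary)
  have "X k \<subseteq> I"
  proof
    fix B assume "B \<in> X k"
    then obtain A where "A \<in> C k" "B \<subseteq> A" unfolding X_def by (elim CollectE bexE)
    then have "A \<in> I" unfolding I by (meson UNIV_I UN_I)
    then show "B \<in> I" using \<open>hereditary I\<close> \<open>B \<subseteq> A\<close> hereditaryD by metis
  qed
  then have "good_family I (X k)"
    using her k closed_family_downward_closure[OF C[of k]] by (simp add: good_family_def X_def)
  then show ?thesis by (rule exI)
qed

text \<open>Two halvings in a row, with \<open>C\<close> paired with itself in the first union.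
  Three-fold unions are what the cut into left part, middle entry and right part requires.\<close>

lemma good_family_third:
  assumes "P_ideal I" "Fin \<subseteq> I" "good_family I L"
  shows "\<exists>K. good_family I K \<and> (\<forall>A\<in>K. \<forall>B\<in>K. \<forall>C\<in>K. A \<union> B \<union> C \<in> L)"
proof -
  obtain K where K: "good_family I K" "\<And>A B. A \<in> K \<Longrightarrow> B \<in> K \<Longrightarrow> A \<union> B \<in> L"
    using good_family_halving[OF assms] by metis
  obtain K' where K': "good_family I K'" "\<And>A B. A \<in> K' \<Longrightarrow> B \<in> K' \<Longrightarrow> A \<union> B \<in> K"
    using good_family_halving[OF assms(1,2) K(1)] by metis
  have "A \<union> B \<union> C \<in> L" if "A \<in> K'" "B \<in> K'" "C \<in> K'" for A B C
    using K(2)[OF K'(2)[OF that(1,2)] K'(2)[OF that(3,3)]] by simp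
  with K'(1) show ?thesis by meson
qed

text \<open>Restricting the \<open>j\<close>-th family to subsets of \<open>{j..}\<close> keeps it
  good. It excludes \<open>{n}\<close> from level \<open>Suc n\<close>, which later makes the
  submeasure positive at every point.\<close>

lemma good_family_sequence:
  assumes "Sigma02 I" "P_ideal I" "Fin \<subseteq> I"
  obtains K :: "nat \<Rightarrow> nat set set" where "\<And>j. good_family I (K j)"
    "\<And>j A B C. A \<in> K (Suc j) \<Longrightarrow> B \<in> K (Suc j) \<Longrightarrow> C \<in> K (Suc j) \<Longrightarrow> A \<union> B \<union> C \<in> K j"
    "\<And>j A. A \<in> K j \<Longrightarrow> A \<subseteq> {j..}"
proof -
  define R where "R L K \<longleftrightarrow> (\<forall>A\<in>K. \<forall>B\<in>K. \<forall>C\<in>K. A \<union> B \<union> C \<in> L)" for L K :: "nat set set"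
  have "\<exists>f. \<forall>n::nat. good_family I (f n) \<and> R (f n) (f (Suc n))"
  proof (rule dependent_nat_choice)
    show "\<exists>K. good_family I K" using assms(1,2) by (rule Sigma02_P_ideal_good_family)
    show "\<exists>K. good_family I K \<and> R L K" if "good_family I L" for L
      using good_family_third[OF assms(2,3) that] unfolding R_def .
  qed
  then obtain f where "\<forall>n::nat. good_family I (f n) \<and> R (f n) (f (Suc n))" by (rule exE)
  then have f: "good_family I (f n)" and R: "R (f n) (f (Suc n))" for n by simp_all
  show ?thesis
  proof (rule that[of "\<lambda>j. f j \<inter> Pow {j..}"])
    fix j
    have "hereditary (Pow {j..})" by (rule hereditaryI) auto
    moreover have "absorbing I (f j \<inter> Pow {j..})"
      unfolding absorbing_def
    proof
      fix A assume "A \<in> I"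
      then obtain m where m: "A - {..m} \<in> f j" using f[of j] by (auto simp: good_family_def absorbing_def)
      have "A - {..m + j} \<in> f j"
        by (rule hereditaryD[OF _ m]) (use f[of j] in \<open>auto simp: good_family_def\<close>)
      then show "\<exists>m. A - {..m} \<in> f j \<inter> Pow {j..}" by (intro exI[of _ "m + j"]) auto
    qed
    ultimately show "good_family I (f j \<inter> Pow {j..})"
      using f[of j] unfolding good_family_def
      by (auto intro: closed_family_Int closed_family_Pow hereditary_Int)
  next
    fix j A B C
    assume A: "A \<in> f (Suc j) \<inter> Pow {Suc j..}" "B \<in> f (Suc j) \<inter> Pow {Suc j..}" "C \<in> f (Suc j) \<inter> Pow {Suc j..}"
    then have "A \<union> B \<union> C \<in> f j" using R[of j] by (simp add: R_def)
    moreover have "{Suc j..} \<subseteq> {j..}" by auto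
    then have "A \<union> B \<union> C \<subseteq> {j..}" using A unfolding le_sup_iff by (meson IntD2 PowD order_trans)
    ultimately show "A \<union> B \<union> C \<in> f j \<inter> Pow {j..}" by simp
  qed simp
qed

theorem Sigma02_P_ideal_represents:
  assumes "Sigma02 I" "P_ideal I" "Fin \<subseteq> I"
  shows "\<exists>\<phi>. represents \<phi> I"
proof -
  obtain L :: "nat \<Rightarrow> nat set set" where good: "\<And>j. good_family I (L j)"
    and tri: "\<And>j A B C. A \<in> L (Suc j) \<Longrightarrow> B \<in> L (Suc j) \<Longrightarrow> C \<in> L (Suc j) \<Longrightarrow> A \<union> B \<union> C \<in> L j"
    and tail: "\<And>j A. A \<in> L j \<Longrightarrow> A \<subseteq> {j..}"
    using good_family_sequence[OF assms] by metis
  have Icup: "A \<union> B \<in> I" if "A \<in> I" "B \<in> I" for A B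
    using assms(2) that by (auto simp: P_ideal_def ideal_on_nat_def)
  have "{} \<in> I" using assms(2) by (auto simp: P_ideal_def ideal_on_nat_def)
  have her: "hereditary (L j)" and ab: "absorbing I (L j)" and LI: "L j \<subseteq> I" and cl: "closed_family (L j)" for j
    using good[of j] by (auto simp: good_family_def)
  have empL: "{} \<in> L j" for j
  proof -
    obtain m where "{} - {..m} \<in> L j" using absorbingE[OF ab \<open>{} \<in> I\<close>] .
    then show ?thesis by simp
  qed
  \<comment> \<open>Level 0 also receives all singletons, so that the submeasure is finite at
    points. The higher levels are untouched, so the three-fold union property persists.\<close>
  define K where "K j = (if j = 0 then L 0 \<union> range (\<lambda>n. {n}) else L j)" for j
  have KL: "L j \<subseteq> K j" for j by (auto simp: K_def)
  have K_Suc: "K (Suc j) = L (Suc j)" for j by (simp add: K_def)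
  have herK: "hereditary (K j)" for j
  proof (cases j)
    case 0
    show ?thesis
    proof (rule hereditaryI)
      fix A B assume "A \<in> K j" "B \<subseteq> A"
      then consider "A \<in> L 0" | n where "B \<subseteq> {n}" using 0 by (auto simp: K_def)
      then show "B \<in> K j"
      proof cases
        case 1
        then have "B \<in> L 0" using \<open>B \<subseteq> A\<close> her hereditaryD by metis
        then show ?thesis using 0 by (simp add: K_def)
      next
        case 2
        then have "B = {} \<or> B = {n}" by auto
        then show ?thesis using 0 empL[of 0] by (auto simp: K_def)
      qed
    qed
  qed (use her K_Suc in simp)
  have triK: "A \<union> B \<union> C \<in> K j" if "A \<in> K (Suc j)" "B \<in> K (Suc j)" "C \<in> K (Suc j)" for A B C j
    using tri[of A j B C] that KL[of j] unfolding K_Suc by auto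
  have empK: "{} \<in> K j" for j using KL empL by auto
  let ?\<phi> = "cover_submeasure K"
  have lsc: "lsc_submeasure ?\<phi>"
    by (rule cover_submeasure_lsc[OF herK]) (simp add: K_def)
  have small: "F \<in> K j" if light: "cover_weight K F < ennreal ((1/2) ^ j)" for F j
  proof -
    obtain ks where "F \<in> cover_sets K ks" "ennreal (weight ks) < ennreal ((1/2) ^ j)"
      using cover_weight_lessE[OF light] .
    then show ?thesis
      by (intro cover_sets_light[of K F ks, OF empK triK]) (simp_all add: ennreal_less_iff)
  qed
  have le_phi: "cover_weight K F \<le> ?\<phi> A" if "finite F" "F \<subseteq> A" for F A
    unfolding cover_submeasure_def using that by (intro SUP_upper) simp
  have "?\<phi> {n} > 0" for n
  proof (rule ccontr)
    assume "\<not> ?\<phi> {n} > 0"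
    then have "cover_weight K {n} \<le> 0" using le_phi[of "{n}" "{n}"] by simp
    also have "0 < ennreal ((1/2) ^ Suc n)" by (simp add: ennreal_less_zero_iff)
    finally have "{n} \<in> K (Suc n)" by (rule small)
    then show False using tail[of "{n}" "Suc n"] by (simp add: K_Suc)
  qed
  moreover have "I = Exh ?\<phi>"
  proof (intro equalityI subsetI)
    fix A assume A: "A \<in> I"
    have "(\<lambda>m. ?\<phi> (A - {0..m})) \<longlonglongrightarrow> 0"
    proof (rule order_tendstoI)
      fix e :: ennreal assume "0 < e"
      obtain j where j: "ennreal ((1/2) ^ j) < e"
      proof (cases e)
        case (real r)
        then have "0 < r" using \<open>0 < e\<close> by simp
        then obtain j where "(1/2) ^ j < r" using real_arch_pow_inv[of r "1/2"] by auto
        then show ?thesis using that real by (simp add: ennreal_less_iff)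
      next
        case top
        then show ?thesis by (intro that[of 0]) simp
      qed
      obtain m where m: "A - {..m} \<in> L j" using absorbingE[OF ab A] .
      have "?\<phi> (A - {0..n}) < e" if "n \<ge> m" for n
      proof -
        have "?\<phi> (A - {0..n}) \<le> ennreal ((1/2) ^ j)"
          unfolding cover_submeasure_def
        proof (rule SUP_least)
          fix F assume "F \<in> {F. finite F \<and> F \<subseteq> A - {0..n}}"
          then have "F \<subseteq> A - {..m}" using that by auto
          then have "F \<in> L j" using m her hereditaryD by metis
          then have "F \<union> {} \<in> cover_sets K [j]" using KL by auto
          from cover_weight_le[OF this] show "cover_weight K F \<le> ennreal ((1/2) ^ j)" by simp
        qed
        with j show ?thesis by simp
      qed
      then show "\<forall>\<^sub>F n in sequentially. ?\<phi> (A - {0..n}) < e" by (auto simp: eventually_sequentially)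
    qed simp
    then show "A \<in> Exh ?\<phi>" by (simp add: Exh_def)
  next
    fix A assume "A \<in> Exh ?\<phi>"
    then have lim: "(\<lambda>m. ?\<phi> (A - {0..m})) \<longlonglongrightarrow> 0" by (simp add: Exh_def)
    have "(0::ennreal) < ennreal 1" using ennreal_zero_less_one by simp
    from order_tendstoD(2)[OF lim this]
    have "\<forall>\<^sub>F m in sequentially. ?\<phi> (A - {0..m}) < ennreal 1" .
    then obtain m where m: "?\<phi> (A - {0..m}) < ennreal 1" by (auto simp: eventually_sequentially)
    let ?B = "A - {0..m}"
    have sub: "F \<in> K 0" if "finite F" "F \<subseteq> ?B" for F
      using small[of F 0] le_less_trans[OF le_phi[OF that] m] by simp
    have "?B \<in> I"
    proof (cases "\<exists>n. ?B \<subseteq> {n}")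
      case True
      then have "finite ?B" by (meson finite.simps finite_subset)
      then show ?thesis using assms(3) by (auto simp: Fin_def)
    next
      case False
      have "?B \<in> L 0"
      proof (rule closed_familyD_finite[OF cl])
        fix F assume F: "finite F" "F \<subseteq> ?B"
        \<comment> \<open>Members of \<open>K 0\<close> outside \<open>L 0\<close> are singletons.
          Adding two fixed points of the set to \<open>F\<close> rules these out, and heredity then
          removes the points again.\<close>
        obtain a where a: "a \<in> ?B" using False by blast
        then obtain b where b: "b \<in> ?B" "b \<noteq> a" using False by blast
        have "F \<union> {a, b} \<in> K 0" using F a b(1) by (intro sub) auto
        moreover have "F \<union> {a, b} \<noteq> {n}" for n using b(2) by auto
        ultimately have "F \<union> {a, b} \<in> L 0" by (auto simp: K_def)
        then show "F \<in> L 0" using her hereditaryD by (metis Un_upper1)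
      qed
      then show ?thesis using LI by blast
    qed
    moreover have "{0..m} \<in> I" using assms(3) by (auto simp: Fin_def)
    ultimately have "?B \<union> {0..m} \<in> I" by (rule Icup)
    moreover have "hereditary I" using assms(2) by (meson P_ideal_def ideal_on_nat_hereditary)
    moreover have "A \<subseteq> ?B \<union> {0..m}" by auto
    ultimately show "A \<in> I" using hereditaryD by metis
  qed
  ultimately show ?thesis using lsc unfolding represents_def by metis
qed

section \<open>The Polish group of a represented ideal\<close>

lemma ennreal_positive_real_below:
  fixes e :: ennreal
  assumes "0 < e"
  obtains r where "0 < r" "ennreal r \<le> e"
proof (cases e)
  case (real x)
  then show ?thesis using assms by (intro that[of x]) auto
next
  case top
  then show ?thesis by (intro that[of 1]) auto
qed

text \<open>Stands in for halving \<open>e\<close>, uniformly for finite and infinite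
  \<open>e\<close>, and keeps the final inequality strict.\<close>

lemma ennreal_half_gauge:
  fixes e :: ennreal
  assumes "0 < e"
  obtains d :: ennreal where "0 < d" "d \<le> e" "\<And>a b. a \<le> d \<Longrightarrow> b \<le> d \<Longrightarrow> a + b < e"
proof -
  obtain r where r: "0 < r" "ennreal r < e"
  proof (cases e)
    case (real x)
    then show ?thesis using assms by (intro that[of "x/2"]) (auto simp: ennreal_less_iff)
  next
    case top
    then show ?thesis by (intro that[of 1]) auto
  qed
  show ?thesis
  proof (rule that[of "ennreal (r/2)"])
    show "0 < ennreal (r/2)" using r(1) by simp
    show "ennreal (r/2) \<le> e" 
    proof -
      have "ennreal (r/2) \<le> ennreal r" using r(1) by (intro ennreal_leI) simp
      then show ?thesis using r(2) by simp
    qed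
    fix a b assume "a \<le> ennreal (r/2)" "b \<le> ennreal (r/2)"
    then have "a + b \<le> ennreal (r/2) + ennreal (r/2)" by (rule add_mono)
    also have "\<dots> = ennreal r" using r(1) by (simp flip: ennreal_plus)
    also have "\<dots> < e" by (rule r(2))
    finally show "a + b < e" .
  qed
qed

lemma bij_extend_id:
  assumes "bij_betw h E E" "\<And>n. n \<notin> E \<Longrightarrow> h n = n"
  shows "bij h"
proof -
  have "bij_betw h (-E) (-E)"
    by (rule bij_betwI[of _ _ _ id]) (use assms(2) in auto)
  from bij_betw_combine[OF assms(1) this] show ?thesis by simp
qed

text \<open>\<open>F\<close> and its image have equally many points, so what \<open>F\<close> leaves
  out of their union can be matched with what the image leaves out. This closes the restriction of
  \<open>g\<close> to a permutation of that union.\<close>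

lemma finite_permutation_extending:
  assumes "inj g" "finite F"
  obtains h where "bij h" "finite (supp h)" "\<And>n. n \<in> F \<Longrightarrow> h n = g n" "\<And>n. n \<notin> F \<union> g ` F \<Longrightarrow> h n = n"
proof -
  let ?E = "F \<union> g ` F"
  have "card (?E - F) = card (?E - g ` F)"
    using assms by (simp add: card_Diff_subset card_image inj_on_subset)
  then obtain b where b: "bij_betw b (?E - F) (?E - g ` F)"
    using assms(2) by (metis finite_Diff finite_UnI finite_imageI finite_same_card_bij)
  define h where "h n = (if n \<in> F then g n else if n \<in> ?E then b n else n)" for n
  have "bij_betw h F (g ` F)"
    using assms(1) by (auto simp: bij_betw_def h_def inj_on_def)
  moreover have "bij_betw h (?E - F) (?E - g ` F)"
    using b by (subst bij_betw_cong[of _ h b]) (auto simp: h_def)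
  moreover have "g ` F \<inter> (?E - g ` F) = {}" by auto
  ultimately have "bij_betw h (F \<union> (?E - F)) (g ` F \<union> (?E - g ` F))" by (rule bij_betw_combine)
  moreover have "F \<union> (?E - F) = ?E" "g ` F \<union> (?E - g ` F) = ?E" by auto
  ultimately have "bij_betw h ?E ?E" by simp
  then have "bij h" by (rule bij_extend_id) (auto simp: h_def)
  moreover have "supp h \<subseteq> ?E" by (auto simp: supp_def h_def)
  then have "finite (supp h)" using assms(2) by (meson finite_UnI finite_imageI finite_subset)
  ultimately show ?thesis by (rule that) (auto simp: h_def)
qed

text \<open>The graph over the support is a finite set of pairs and determines the map.\<close>

lemma countable_finite_support: "countable {g :: nat \<Rightarrow> nat. finite (supp g)}"
proof (rule countable_image_inj_on)
  let ?G = "\<lambda>g. (\<lambda>n. (n, g n)) ` supp g"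
  have "?G ` {g. finite (supp g)} \<subseteq> {F. finite F}" by auto
  then show "countable (?G ` {g. finite (supp g)})"
    using countable_Collect_finite countable_subset by blast
  show "inj_on ?G {g. finite (supp g)}"
  proof (rule inj_onI)
    fix f g :: "nat \<Rightarrow> nat" assume eq: "?G f = ?G g"
    have *: "f n = k \<longleftrightarrow> (n, k) \<in> ?G f \<or> k = n \<and> (\<forall>l. (n, l) \<notin> ?G f)" for f :: "nat \<Rightarrow> nat" and n k
      by (auto simp: supp_def image_iff)
    have "f n = k \<longleftrightarrow> g n = k" for n k unfolding * eq by (rule refl)
    then show "f = g" by auto
  qed
qed

section \<open>Calculus with the submeasure and the topology it induces\<close>

locale represented_ideal =
  fixes \<phi> :: "nat set \<Rightarrow> ennreal" and I :: "nat set set"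
  assumes rep: "represents \<phi> I" and ideal: "ideal_on_nat I"
begin

abbreviation S :: "(nat \<Rightarrow> nat) set" where "S \<equiv> carrier (S_ideal I)"
abbreviation T :: "(nat \<Rightarrow> nat) topology" where "T \<equiv> tau_ideal I \<phi>"

lemma lsc: "lsc_submeasure \<phi>" and phi_pos: "0 < \<phi> {n}" and I_Exh: "I = Exh \<phi>"
  using rep by (simp_all add: represents_def)

lemma phi_mono: "A \<subseteq> B \<Longrightarrow> \<phi> A \<le> \<phi> B"
  using lsc by (simp add: lsc_submeasure_def)

lemma phi_Un: "\<phi> (A \<union> B) \<le> \<phi> A + \<phi> B"
  using lsc by (simp add: lsc_submeasure_def)

lemma phi_empty [simp]: "\<phi> {} = 0"
  using lsc by (simp add: lsc_submeasure_def)

lemma phi_le_finite: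
  assumes "\<And>F. finite F \<Longrightarrow> F \<subseteq> A \<Longrightarrow> \<phi> F \<le> c"
  shows "\<phi> A \<le> c"
proof -
  define B where "B m = A \<inter> {..<m}" for m
  have "\<forall>m. B m \<subseteq> B (Suc m)" by (auto simp: B_def)
  then have "(\<lambda>m. \<phi> (B m)) \<longlonglongrightarrow> \<phi> (\<Union>m. B m)"
    using lsc unfolding lsc_submeasure_def by blast
  moreover have "(\<Union>m. B m) = A" by (auto simp: B_def)
  moreover have "\<phi> (B m) \<le> c" for m by (rule assms) (auto simp: B_def)
  ultimately show ?thesis by (metis LIMSEQ_le_const2)
qed

lemma I_subset: "A \<in> I \<Longrightarrow> B \<subseteq> A \<Longrightarrow> B \<in> I"
  and I_Un: "A \<in> I \<Longrightarrow> B \<in> I \<Longrightarrow> A \<union> B \<in> I"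
  using ideal by (auto simp: ideal_on_nat_def)

lemma I_tail:
  assumes "A \<in> I" "0 < e"
  obtains m where "\<phi> (A - {..m}) < e"
proof -
  have "(\<lambda>m. \<phi> (A - {0..m})) \<longlonglongrightarrow> 0" using assms(1) by (simp add: I_Exh Exh_def)
  then have "\<forall>\<^sub>F m in sequentially. \<phi> (A - {0..m}) < e" using assms(2) by (rule order_tendstoD(2))
  then show ?thesis using that by (auto simp: eventually_sequentially atLeast0AtMost)
qed

lemma I_intro:
  assumes "\<And>e. 0 < e \<Longrightarrow> \<exists>m. \<phi> (A - {..m}) < e"
  shows "A \<in> I"
proof -
  have "(\<lambda>m. \<phi> (A - {0..m})) \<longlonglongrightarrow> 0"
  proof (rule order_tendstoI)
    fix e :: ennreal assume "0 < e"
    then obtain m where m: "\<phi> (A - {..m}) < e" using assms by metis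
    have "\<phi> (A - {0..n}) < e" if "m \<le> n" for n
      by (rule le_less_trans[OF phi_mono m]) (use that in auto)
    then show "\<forall>\<^sub>F m in sequentially. \<phi> (A - {0..m}) < e" by (auto simp: eventually_sequentially)
  qed simp
  then show ?thesis by (simp add: I_Exh Exh_def)
qed

lemma I_finite: "finite A \<Longrightarrow> A \<in> I"
proof (rule I_intro)
  fix e :: ennreal assume e: "0 < e" and "finite A"
  then obtain m where "A \<subseteq> {..m}" using finite_nat_iff_bounded_le by auto
  then have "A - {..m} = {}" by auto
  then have "\<phi> (A - {..m}) < e" using e by (simp only:) simp
  then show "\<exists>m. \<phi> (A - {..m}) < e" by (rule exI)
qed

lemma S_iff: "g \<in> S \<longleftrightarrow> bij g \<and> supp g \<in> I"
  by (simp add: S_ideal_def S_infty_def)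

lemma S_mult [simp]: "f \<otimes>\<^bsub>S_ideal I\<^esub> g = f \<circ> g"
  by (simp add: S_ideal_def S_infty_def)

lemma S_comp: "f \<in> S \<Longrightarrow> g \<in> S \<Longrightarrow> f \<circ> g \<in> S"
  using I_subset[OF I_Un supp_comp] by (simp add: S_iff bij_comp)

lemma S_inv: "g \<in> S \<Longrightarrow> Hilbert_Choice.inv g \<in> S"
  unfolding S_iff using bij_imp_bij_inv[of g] supp_inv[of g] by simp

lemma S_one [simp]: "\<one>\<^bsub>S_ideal I\<^esub> = id"
  by (simp add: S_ideal_def S_infty_def)

lemma S_m_inv: "g \<in> S \<Longrightarrow> inv\<^bsub>S_ideal I\<^esub> g = Hilbert_Choice.inv g"
proof (rule group.inv_equality[OF group_S_ideal[OF ideal]])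
  assume g: "g \<in> S"
  then have "inj g" by (simp add: S_iff bij_is_inj)
  then show "Hilbert_Choice.inv g \<otimes>\<^bsub>S_ideal I\<^esub> g = \<one>\<^bsub>S_ideal I\<^esub>" by simp
  show "Hilbert_Choice.inv g \<in> S" using g by (rule S_inv)
qed

lemma id_S: "id \<in> S"
  by (simp add: S_iff supp_def I_finite)

lemma diff_in_I:
  assumes "f \<in> S" "g \<in> S" shows "{n. f n \<noteq> g n} \<in> I"
proof (rule I_subset)
  show "supp f \<union> supp g \<in> I" using assms by (simp add: S_iff I_Un)
qed (auto simp: supp_def)

lemma diff_dist_less_iff:
  assumes "f \<in> S" "g \<in> S"
  shows "diff_dist \<phi> f g < r \<longleftrightarrow> \<phi> {n. f n \<noteq> g n} < ennreal r"
proof -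
  have "\<phi> {n. f n \<noteq> g n} < \<infinity>"
    using Exh_finite[OF lsc] diff_in_I[OF assms] I_Exh by simp
  then show ?thesis
    by (cases "\<phi> {n. f n \<noteq> g n}") (auto simp: diff_dist_def ennreal_less_iff less_top)
qed

sublocale met: Metric_space S "diff_dist \<phi>"
  using rep ideal by (rule Metric_space_S_ideal)

lemma topspace_T [simp]: "topspace T = S"
  by (simp add: tau_ideal_def)

text \<open>Since \<open>\<phi>\<close> is finite on the sets where two elements of \<open>S\<close>
  differ, the real metric can be replaced by \<open>\<phi>\<close> itself, with radii in the
  extended reals.\<close>

lemma openin_T_iff:
  "openin T U \<longleftrightarrow> U \<subseteq> S \<and> (\<forall>f\<in>U. \<exists>e>0. \<forall>g\<in>S. \<phi> {n. f n \<noteq> g n} < e \<longrightarrow> g \<in> U)"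
proof (cases "U \<subseteq> S")
  case True
  have "(\<exists>r>0. met.mball f r \<subseteq> U) \<longleftrightarrow> (\<exists>e>0. \<forall>g\<in>S. \<phi> {n. f n \<noteq> g n} < e \<longrightarrow> g \<in> U)" if "f \<in> U" for f
  proof
    assume "\<exists>r>0. met.mball f r \<subseteq> U"
    then obtain r where r: "0 < r" "met.mball f r \<subseteq> U" by blast
    have "g \<in> U" if "g \<in> S" "\<phi> {n. f n \<noteq> g n} < ennreal r" for g
    proof -
      have "g \<in> met.mball f r" using that True \<open>f \<in> U\<close> by (auto simp: diff_dist_less_iff)
      then show ?thesis using r(2) by blast
    qed
    then show "\<exists>e>0. \<forall>g\<in>S. \<phi> {n. f n \<noteq> g n} < e \<longrightarrow> g \<in> U"
      using r(1) by (intro exI[of _ "ennreal r"]) simp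
  next
    assume "\<exists>e>0. \<forall>g\<in>S. \<phi> {n. f n \<noteq> g n} < e \<longrightarrow> g \<in> U"
    then obtain e where e: "0 < e" "\<And>g. g \<in> S \<Longrightarrow> \<phi> {n. f n \<noteq> g n} < e \<Longrightarrow> g \<in> U" by blast
    obtain r where r: "0 < r" "ennreal r \<le> e" using ennreal_positive_real_below[OF e(1)] .
    have "met.mball f r \<subseteq> U"
    proof
      fix g assume "g \<in> met.mball f r"
      then have "g \<in> S" "\<phi> {n. f n \<noteq> g n} < ennreal r" by (auto simp: diff_dist_less_iff)
      then show "g \<in> U" using e(2) r(2) by (meson less_le_trans)
    qed
    then show "\<exists>r>0. met.mball f r \<subseteq> U" using r(1) by blast
  qed
  then show ?thesis using True unfolding tau_ideal_def met.openin_mtopology by meson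
qed (simp add: tau_ideal_def met.openin_mtopology)

lemma T_nhd:
  assumes "f \<in> S" "0 < e"
  obtains U where "openin T U" "f \<in> U" "\<And>g. g \<in> U \<Longrightarrow> g \<in> S \<and> \<phi> {n. f n \<noteq> g n} < e"
proof -
  obtain r where r: "0 < r" "ennreal r \<le> e" using ennreal_positive_real_below[OF assms(2)] .
  show ?thesis
  proof (rule that[of "met.mball f r"])
    show "openin T (met.mball f r)" by (simp add: tau_ideal_def)
    show "f \<in> met.mball f r" using assms(1) r(1) by simp
    fix g assume "g \<in> met.mball f r"
    then have "g \<in> S" "\<phi> {n. f n \<noteq> g n} < ennreal r" by (auto simp: diff_dist_less_iff)
    then show "g \<in> S \<and> \<phi> {n. f n \<noteq> g n} < e" using r(2) by (meson less_le_trans)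
  qed
qed

text \<open>\<open>\<phi>\<close> is not invariant under \<open>g\<close>, but the preimage of
  \<open>A\<close> adds to \<open>A\<close> only points of the support of \<open>g\<close>. A tail
  of the support is small, and taking \<open>d\<close> below \<open>\<phi> {g k}\<close> for
  \<open>k \<le> m\<close> keeps the preimage away from the initial part.\<close>

lemma phi_vimage_small:
  assumes "g \<in> S" "0 < e"
  obtains d where "0 < d" "\<And>A. \<phi> A < d \<Longrightarrow> \<phi> (g -` A) < e"
proof -
  obtain c where c: "0 < c" "\<And>a b. a \<le> c \<Longrightarrow> b \<le> c \<Longrightarrow> a + b < e"
    using ennreal_half_gauge[OF assms(2)] by metis
  obtain m where m: "\<phi> (supp g - {..m}) < c" using I_tail[OF _ c(1)] assms(1) by (auto simp: S_iff)
  define d where "d = Min (insert c ((\<lambda>k. \<phi> {g k}) ` {..m}))"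
  have "0 < d" using c(1) phi_pos by (auto simp: d_def)
  moreover have "\<phi> (g -` A) < e" if A: "\<phi> A < d" for A
  proof -
    have "g k \<notin> A" if "k \<le> m" for k
    proof
      assume "g k \<in> A"
      then have "\<phi> {g k} \<le> \<phi> A" by (intro phi_mono) auto
      moreover have "d \<le> \<phi> {g k}" unfolding d_def using that by (intro Min_le) auto
      ultimately show False using A by simp
    qed
    then have "g -` A \<subseteq> A \<union> (supp g - {..m})" by (force simp: supp_def not_le)
    then have "\<phi> (g -` A) \<le> \<phi> A + \<phi> (supp g - {..m})" by (meson phi_mono phi_Un order_trans)
    also have "\<dots> < e"
    proof (rule c(2))
      have "d \<le> c" by (simp add: d_def)
      then show "\<phi> A \<le> c" using A by simp
    qed (use m in simp)
    finally show ?thesis .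
  qed
  ultimately show ?thesis by (rule that)
qed

lemma diff_inv_subset:
  assumes "bij f" "bij g"
  shows "{n. Hilbert_Choice.inv f n \<noteq> Hilbert_Choice.inv g n} \<subseteq> Hilbert_Choice.inv f -` {n. f n \<noteq> g n}"
proof
  fix n assume n: "n \<in> {n. Hilbert_Choice.inv f n \<noteq> Hilbert_Choice.inv g n}"
  have "f (Hilbert_Choice.inv f n) = n" using assms(1) by (meson bij_inv_eq_iff)
  moreover have "g (Hilbert_Choice.inv f n) \<noteq> n" using n assms(2) by (auto simp: bij_inv_eq_iff)
  ultimately show "n \<in> Hilbert_Choice.inv f -` {n. f n \<noteq> g n}" by simp
qed

lemma inv_small:
  assumes "f \<in> S" "0 < e"
  obtains d where "0 < d"
    "\<And>g. g \<in> S \<Longrightarrow> \<phi> {n. f n \<noteq> g n} < d \<Longrightarrow> \<phi> {n. Hilbert_Choice.inv f n \<noteq> Hilbert_Choice.inv g n} < e"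
proof -
  obtain d where d: "0 < d" "\<And>A. \<phi> A < d \<Longrightarrow> \<phi> (Hilbert_Choice.inv f -` A) < e"
    using phi_vimage_small[OF S_inv[OF assms(1)] assms(2)] by metis
  show ?thesis
  proof (rule that[OF d(1)])
    fix g assume "g \<in> S" "\<phi> {n. f n \<noteq> g n} < d"
    then show "\<phi> {n. Hilbert_Choice.inv f n \<noteq> Hilbert_Choice.inv g n} < e"
      using d(2) phi_mono[OF diff_inv_subset[of f g]] assms(1) by (meson S_iff le_less_trans)
  qed
qed

section \<open>Continuity of the operations, separability and completeness\<close>

lemma topological_group_S_ideal: "topological_group (S_ideal I) T"
proof -
  interpret G: group "S_ideal I" using ideal by (rule group_S_ideal)
  show ?thesis
  proof
    show "topspace T = S" by simp
    show "continuous_map (prod_topology T T) T (\<lambda>(x, y). x \<otimes>\<^bsub>S_ideal I\<^esub> y)"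
      unfolding continuous_map_def
    proof (intro conjI allI impI)
      show "(\<lambda>(x, y). x \<otimes>\<^bsub>S_ideal I\<^esub> y) \<in> topspace (prod_topology T T) \<rightarrow> topspace T"
        by (auto simp: S_comp)
      fix U assume U: "openin T U"
      show "openin (prod_topology T T) {p \<in> topspace (prod_topology T T). (case p of (x, y) \<Rightarrow> x \<otimes>\<^bsub>S_ideal I\<^esub> y) \<in> U}"
        unfolding openin_prod_topology_alt
      proof (intro allI impI)
        fix f g assume "(f, g) \<in> {p \<in> topspace (prod_topology T T). (case p of (x, y) \<Rightarrow> x \<otimes>\<^bsub>S_ideal I\<^esub> y) \<in> U}"
        then have f: "f \<in> S" and g: "g \<in> S" and fg: "f \<circ> g \<in> U" by auto
        obtain e where e: "0 < e" "\<And>h. h \<in> S \<Longrightarrow> \<phi> {n. (f \<circ> g) n \<noteq> h n} < e \<Longrightarrow> h \<in> U"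
          using U fg unfolding openin_T_iff by metis
        obtain c where c: "0 < c" "\<And>a b. a \<le> c \<Longrightarrow> b \<le> c \<Longrightarrow> a + b < e"
          using ennreal_half_gauge[OF e(1)] by metis
        obtain d where d: "0 < d" "\<And>A. \<phi> A < d \<Longrightarrow> \<phi> (g -` A) < c"
          using phi_vimage_small[OF g c(1)] by metis
        obtain V where V: "openin T V" "f \<in> V" "\<And>h. h \<in> V \<Longrightarrow> h \<in> S \<and> \<phi> {n. f n \<noteq> h n} < d"
          using T_nhd[OF f d(1)] by metis
        obtain W where W: "openin T W" "g \<in> W" "\<And>h. h \<in> W \<Longrightarrow> h \<in> S \<and> \<phi> {n. g n \<noteq> h n} < c"
          using T_nhd[OF g c(1)] by metis
        have "f' \<circ> g' \<in> U" if "f' \<in> V" "g' \<in> W" for f' g'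
        proof (rule e(2))
          show "f' \<circ> g' \<in> S" using V(3) W(3) that S_comp by blast
          \<comment> \<open>Where the products differ, either \<open>g\<close> and \<open>g'\<close>
            differ already, or \<open>f\<close> and \<open>f'\<close> differ at the common value;
            hence the preimage under \<open>g\<close>.\<close>
          have "{n. (f \<circ> g) n \<noteq> (f' \<circ> g') n} \<subseteq> g -` {n. f n \<noteq> f' n} \<union> {n. g n \<noteq> g' n}" by auto
          then have "\<phi> {n. (f \<circ> g) n \<noteq> (f' \<circ> g') n} \<le> \<phi> (g -` {n. f n \<noteq> f' n}) + \<phi> {n. g n \<noteq> g' n}"
            by (meson phi_mono phi_Un order_trans)
          also have "\<dots> < e"
          proof (rule c(2))
            show "\<phi> (g -` {n. f n \<noteq> f' n}) \<le> c" using d(2) V(3)[OF that(1)] by (meson less_imp_le)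
            show "\<phi> {n. g n \<noteq> g' n} \<le> c" using W(3)[OF that(2)] by (meson less_imp_le)
          qed
          finally show "\<phi> {n. (f \<circ> g) n \<noteq> (f' \<circ> g') n} < e" .
        qed
        moreover have "V \<subseteq> S" "W \<subseteq> S" using V(3) W(3) by auto
        ultimately have "V \<times> W \<subseteq> {p \<in> topspace (prod_topology T T). (case p of (x, y) \<Rightarrow> x \<otimes>\<^bsub>S_ideal I\<^esub> y) \<in> U}"
          by auto
        then show "\<exists>V W. openin T V \<and> openin T W \<and> f \<in> V \<and> g \<in> W \<and>
            V \<times> W \<subseteq> {p \<in> topspace (prod_topology T T). (case p of (x, y) \<Rightarrow> x \<otimes>\<^bsub>S_ideal I\<^esub> y) \<in> U}"
          using V(1,2) W(1,2) by (intro exI[of _ V] exI[of _ W] conjI)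
      qed
    qed
    show "continuous_map T T (\<lambda>x. inv\<^bsub>S_ideal I\<^esub> x)"
      unfolding continuous_map_def
    proof (intro conjI allI impI)
      show "(\<lambda>x. inv\<^bsub>S_ideal I\<^esub> x) \<in> topspace T \<rightarrow> topspace T" by auto
      fix U assume U: "openin T U"
      show "openin T {x \<in> topspace T. inv\<^bsub>S_ideal I\<^esub> x \<in> U}"
        unfolding openin_T_iff
      proof (intro conjI ballI)
        fix f assume "f \<in> {x \<in> topspace T. inv\<^bsub>S_ideal I\<^esub> x \<in> U}"
        then have f: "f \<in> S" "Hilbert_Choice.inv f \<in> U" by (auto simp: S_m_inv)
        obtain e where e: "0 < e" "\<And>h. h \<in> S \<Longrightarrow> \<phi> {n. Hilbert_Choice.inv f n \<noteq> h n} < e \<Longrightarrow> h \<in> U"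
          using U f(2) unfolding openin_T_iff by metis
        obtain d where d: "0 < d"
          "\<And>g. g \<in> S \<Longrightarrow> \<phi> {n. f n \<noteq> g n} < d \<Longrightarrow> \<phi> {n. Hilbert_Choice.inv f n \<noteq> Hilbert_Choice.inv g n} < e"
          using inv_small[OF f(1) e(1)] by metis
        show "\<exists>e>0. \<forall>g\<in>S. \<phi> {n. f n \<noteq> g n} < e \<longrightarrow> g \<in> {x \<in> topspace T. inv\<^bsub>S_ideal I\<^esub> x \<in> U}"
          using d by (intro exI[of _ d]) (auto simp: S_m_inv S_inv intro!: e(2))
      qed auto
    qed
  qed
qed

text \<open>Keep \<open>g\<close> on \<open>{..m}\<close> and complete it to a finite permutation.
  Changes occur only beyond \<open>m\<close> and only at points moved by \<open>g\<close>: a value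
  \<open>g k\<close> with \<open>k \<le> m < g k\<close> cannot be fixed, by injectivity. The tail
  of the support is small.\<close>

lemma finite_support_approx:
  assumes "g \<in> S" "0 < e"
  obtains h where "h \<in> S" "finite (supp h)" "\<phi> {n. g n \<noteq> h n} < e"
proof -
  have g: "bij g" "supp g \<in> I" using assms(1) by (auto simp: S_iff)
  obtain m where m: "\<phi> (supp g - {..m}) < e" using I_tail[OF g(2) assms(2)] .
  obtain h where h: "bij h" "finite (supp h)" "\<And>n. n \<in> {..m} \<Longrightarrow> h n = g n" "\<And>n. n \<notin> {..m} \<union> g ` {..m} \<Longrightarrow> h n = n"
    using finite_permutation_extending[of g "{..m}"] g(1) by (metis bij_is_inj finite_atMost)
  have "{n. g n \<noteq> h n} \<subseteq> supp g - {..m}"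
  proof
    fix n assume n: "n \<in> {n. g n \<noteq> h n}"
    then have nm: "n \<notin> {..m}" using h(3) by auto
    moreover have "g n \<noteq> n"
    proof (cases "n \<in> g ` {..m}")
      case True
      then obtain k where "n = g k" "k \<in> {..m}" by auto
      then show ?thesis using nm g(1) by (metis bij_is_inj inj_eq)
    next
      case False
      then show ?thesis using n nm h(4) by auto
    qed
    ultimately show "n \<in> supp g - {..m}" by (simp add: supp_def)
  qed
  then have "\<phi> {n. g n \<noteq> h n} < e" using m phi_mono le_less_trans by blast
  moreover have "h \<in> S" using h(1,2) by (simp add: S_iff I_finite)
  ultimately show ?thesis using that h(2) by blast
qed

lemma separable_T: "separable_space T"
  unfolding separable_space_def
proof (intro exI conjI)
  let ?C = "{h \<in> S. finite (supp h)}"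
  show "countable ?C" by (rule countable_subset[OF _ countable_finite_support]) auto
  show "?C \<subseteq> topspace T" by auto
  show "T closure_of ?C = topspace T"
  proof (intro equalityI subsetI)
    fix g assume "g \<in> topspace T"
    then have g: "g \<in> S" by simp
    show "g \<in> T closure_of ?C"
      unfolding in_closure_of
    proof (intro conjI allI impI)
      fix U assume "g \<in> U \<and> openin T U"
      then obtain e where e: "0 < e" "\<And>h. h \<in> S \<Longrightarrow> \<phi> {n. g n \<noteq> h n} < e \<Longrightarrow> h \<in> U"
        unfolding openin_T_iff by metis
      obtain h where "h \<in> S" "finite (supp h)" "\<phi> {n. g n \<noteq> h n} < e"
        using finite_support_approx[OF g e(1)] .
      then show "\<exists>y. y \<in> ?C \<and> y \<in> U" using e(2) by blast
    qed (use g in simp)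
  qed (meson closure_of_subset_topspace subsetD)
qed

text \<open>As \<open>\<phi> {i} > 0\<close>, a Cauchy sequence is eventually constant at
  \<open>i\<close>. The Cauchy bound holds on each finite set where \<open>s n\<close> and the limit
  differ, and lower semi-continuity extends it to all such points.\<close>

lemma pointwise_limit:
  fixes s :: "nat \<Rightarrow> nat \<Rightarrow> nat"
  assumes "\<And>e. 0 < e \<Longrightarrow> \<exists>N. \<forall>m\<ge>N. \<forall>n\<ge>N. \<phi> {i. s m i \<noteq> s n i} < e"
  obtains f where "\<And>i. \<exists>N. \<forall>n\<ge>N. s n i = f i"
    "\<And>e. 0 < e \<Longrightarrow> \<exists>N. \<forall>n\<ge>N. \<phi> {i. s n i \<noteq> f i} \<le> e"
proof -
  have "\<exists>k N. \<forall>n\<ge>N. s n i = k" for i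
  proof -
    obtain N where N: "\<And>m n. m \<ge> N \<Longrightarrow> n \<ge> N \<Longrightarrow> \<phi> {j. s m j \<noteq> s n j} < \<phi> {i}"
      using assms[OF phi_pos[of i]] by metis
    have "s n i = s N i" if "n \<ge> N" for n
    proof (rule ccontr)
      assume "s n i \<noteq> s N i"
      then have "\<phi> {i} \<le> \<phi> {j. s n j \<noteq> s N j}" by (intro phi_mono) auto
      then show False using N[OF that, of N] by simp
    qed
    then show ?thesis by metis
  qed
  then obtain f where f: "\<And>i. \<exists>N. \<forall>n\<ge>N. s n i = f i" by metis
  then obtain M where M: "\<And>i n. M i \<le> n \<Longrightarrow> s n i = f i" by metis
  have "\<exists>N. \<forall>n\<ge>N. \<phi> {i. s n i \<noteq> f i} \<le> e" if e: "0 < e" for e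
  proof -
    obtain N where N: "\<And>m n. m \<ge> N \<Longrightarrow> n \<ge> N \<Longrightarrow> \<phi> {j. s m j \<noteq> s n j} < e"
      using assms[OF e] by metis
    have "\<phi> {i. s n i \<noteq> f i} \<le> e" if n: "n \<ge> N" for n
    proof (rule phi_le_finite)
      fix F assume F: "finite F" "F \<subseteq> {i. s n i \<noteq> f i}"
      define m where "m = Max (insert N (M ` F))"
      have "N \<le> m" using F(1) by (simp add: m_def)
      have "M i \<le> m" if "i \<in> F" for i using F(1) that by (simp add: m_def)
      then have "F \<subseteq> {j. s n j \<noteq> s m j}" using F(2) M by auto
      then have "\<phi> F \<le> \<phi> {j. s n j \<noteq> s m j}" by (rule phi_mono)
      also have "\<dots> \<le> e" using N[OF n \<open>N \<le> m\<close>] by (rule less_imp_le)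
      finally show "\<phi> F \<le> e" .
    qed
    then show ?thesis by blast
  qed
  with f show ?thesis by (rule that)
qed

text \<open>The metric \<^const>\<open>diff_dist\<close> itself need not be complete: a Cauchy sequence of permutations
  may converge to an injection that is not surjective.\<close>

definition sym_dist :: "(nat \<Rightarrow> nat) \<Rightarrow> (nat \<Rightarrow> nat) \<Rightarrow> real" where
  "sym_dist f g = diff_dist \<phi> f g + diff_dist \<phi> (Hilbert_Choice.inv f) (Hilbert_Choice.inv g)"

lemma Metric_space_sym_dist: "Metric_space S sym_dist"
proof
  show "0 \<le> sym_dist f g" for f g by (simp add: sym_dist_def)
  show "sym_dist f g = sym_dist g f" for f g by (simp add: sym_dist_def met.commute)
  show "sym_dist f g = 0 \<longleftrightarrow> f = g" if "f \<in> S" "g \<in> S" for f g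
  proof
    assume "sym_dist f g = 0"
    then have "diff_dist \<phi> f g = 0"
      by (simp add: sym_dist_def add_nonneg_eq_0_iff)
    then show "f = g" using that by simp
  qed (use that in \<open>simp add: sym_dist_def S_inv\<close>)
  show "sym_dist f h \<le> sym_dist f g + sym_dist g h" if "f \<in> S" "g \<in> S" "h \<in> S" for f g h
    unfolding sym_dist_def
    using met.triangle[OF that] met.triangle[OF that[THEN S_inv]] by simp
qed

sublocale sym: Metric_space S sym_dist
  by (rule Metric_space_sym_dist)

text \<open>Inversion is continuous by \<open>inv_small\<close>, so adding the distance of the
  inverses gives no new open sets.\<close>

lemma sym_dist_topology: "sym.mtopology = T"
  unfolding topology_eq
proof (intro allI iffI)
  fix U
  assume U: "openin T U"
  show "openin sym.mtopology U"
    unfolding sym.openin_mtopology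
  proof (intro conjI allI impI)
    show "U \<subseteq> S" using U openin_subset[OF U] by simp
    fix f assume "f \<in> U"
    then obtain r where r: "0 < r" "met.mball f r \<subseteq> U"
      using U by (auto simp: tau_ideal_def met.openin_mtopology)
    have "sym.mball f r \<subseteq> met.mball f r"
    proof
      fix g assume "g \<in> sym.mball f r"
      then have "f \<in> S" "g \<in> S" "sym_dist f g < r" by simp_all
      moreover have "diff_dist \<phi> f g \<le> sym_dist f g" by (simp add: sym_dist_def)
      ultimately show "g \<in> met.mball f r" by simp
    qed
    with r show "\<exists>r>0. sym.mball f r \<subseteq> U" by blast
  qed
next
  fix U
  assume U: "openin sym.mtopology U"
  then have US: "U \<subseteq> S" using openin_subset[OF U] by simp
  show "openin T U"
    unfolding openin_T_iff
  proof (intro conjI ballI)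
    fix f assume f: "f \<in> U"
    then obtain r where r: "0 < r" "sym.mball f r \<subseteq> U"
      using U unfolding sym.openin_mtopology by metis
    have fS: "f \<in> S" using f US by auto
    obtain d where d: "0 < d"
       "\<And>g. g \<in> S \<Longrightarrow> \<phi> {n. f n \<noteq> g n} < d \<Longrightarrow> \<phi> {n. Hilbert_Choice.inv f n \<noteq> Hilbert_Choice.inv g n} < ennreal (r/2)"
      using inv_small[OF fS, of "ennreal (r/2)"] r(1) by auto
    have "g \<in> U" if g: "g \<in> S" "\<phi> {n. f n \<noteq> g n} < min d (ennreal (r/2))" for g
    proof -
      have "diff_dist \<phi> f g < r/2" unfolding diff_dist_less_iff[OF fS g(1)] using g(2) by simp
      moreover have "diff_dist \<phi> (Hilbert_Choice.inv f) (Hilbert_Choice.inv g) < r/2"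
        unfolding diff_dist_less_iff[OF S_inv[OF fS] S_inv[OF g(1)]] using d(2) g by simp
      ultimately have "sym_dist f g < r" unfolding sym_dist_def by linarith
      then show "g \<in> U" using r(2) fS g(1) by auto
    qed
    then show "\<exists>e>0. \<forall>g\<in>S. \<phi> {n. f n \<noteq> g n} < e \<longrightarrow> g \<in> U"
      using d(1) r(1) by (intro exI[of _ "min d (ennreal (r/2))"]) simp
  qed (rule US)
qed

text \<open>The sequence and its inverses both converge pointwise, and the limits are inverse to
  each other. Up to a set of small submeasure the support of the limit is contained in that of one
  term, so it belongs to \<open>I\<close>.\<close>

lemma sym_mcomplete: "sym.mcomplete"
  unfolding sym.mcomplete_def
proof (intro allI impI)
  fix \<sigma> assume C: "sym.MCauchy \<sigma>"
  then have S: "\<sigma> n \<in> S" for n by (auto simp: sym.MCauchy_def)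
  have cauchy: "\<exists>N. \<forall>m\<ge>N. \<forall>n\<ge>N. \<phi> {i. \<sigma> m i \<noteq> \<sigma> n i} < e \<and>
     \<phi> {i. Hilbert_Choice.inv (\<sigma> m) i \<noteq> Hilbert_Choice.inv (\<sigma> n) i} < e" if pos: "0 < e" for e
  proof -
    obtain r where r: "0 < r" "ennreal r \<le> e" using ennreal_positive_real_below[OF pos] .
    obtain N where N: "\<And>m n. N \<le> m \<Longrightarrow> N \<le> n \<Longrightarrow> sym_dist (\<sigma> m) (\<sigma> n) < r"
      using C r(1) unfolding sym.MCauchy_def by metis
    have "\<phi> {i. \<sigma> m i \<noteq> \<sigma> n i} < e \<and> \<phi> {i. Hilbert_Choice.inv (\<sigma> m) i \<noteq> Hilbert_Choice.inv (\<sigma> n) i} < e"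
      if "m \<ge> N" "n \<ge> N" for m n
    proof -
      have "diff_dist \<phi> (\<sigma> m) (\<sigma> n) < r" "diff_dist \<phi> (Hilbert_Choice.inv (\<sigma> m)) (Hilbert_Choice.inv (\<sigma> n)) < r"
        using N[OF that] met.nonneg[of "\<sigma> m" "\<sigma> n"]
          met.nonneg[of "Hilbert_Choice.inv (\<sigma> m)" "Hilbert_Choice.inv (\<sigma> n)"]
        unfolding sym_dist_def by linarith+
      then have "\<phi> {i. \<sigma> m i \<noteq> \<sigma> n i} < ennreal r"
         "\<phi> {i. Hilbert_Choice.inv (\<sigma> m) i \<noteq> Hilbert_Choice.inv (\<sigma> n) i} < ennreal r"
        by (simp_all add: diff_dist_less_iff S S_inv)
      then show ?thesis using r(2) by (meson less_le_trans)
    qed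
    then show ?thesis by blast
  qed
  obtain f where f: "\<And>i. \<exists>N. \<forall>n\<ge>N. \<sigma> n i = f i"
    and f_lim: "\<And>e. 0 < e \<Longrightarrow> \<exists>N. \<forall>n\<ge>N. \<phi> {i. \<sigma> n i \<noteq> f i} \<le> e"
  proof (rule pointwise_limit[of \<sigma>])
    fix e :: ennreal assume "0 < e"
    from cauchy[OF this] show "\<exists>N. \<forall>m\<ge>N. \<forall>n\<ge>N. \<phi> {i. \<sigma> m i \<noteq> \<sigma> n i} < e"
      by (elim ex_forward) simp
  qed blast
  obtain h where h: "\<And>i. \<exists>N. \<forall>n\<ge>N. Hilbert_Choice.inv (\<sigma> n) i = h i"
    and h_lim: "\<And>e. 0 < e \<Longrightarrow> \<exists>N. \<forall>n\<ge>N. \<phi> {i. Hilbert_Choice.inv (\<sigma> n) i \<noteq> h i} \<le> e"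
  proof (rule pointwise_limit[of "\<lambda>n. Hilbert_Choice.inv (\<sigma> n)"])
    fix e :: ennreal assume "0 < e"
    from cauchy[OF this]
    show "\<exists>N. \<forall>m\<ge>N. \<forall>n\<ge>N. \<phi> {i. Hilbert_Choice.inv (\<sigma> m) i \<noteq> Hilbert_Choice.inv (\<sigma> n) i} < e"
      by (elim ex_forward) simp
  qed blast
  have bij: "bij (\<sigma> n)" for n using S by (simp add: S_iff)
  have hf: "h (f i) = i" for i
  proof -
    obtain N where N: "\<forall>n\<ge>N. \<sigma> n i = f i" using f by blast
    obtain N' where N': "\<forall>n\<ge>N'. Hilbert_Choice.inv (\<sigma> n) (f i) = h (f i)" using h by blast
    have "\<sigma> (max N N') i = f i" "Hilbert_Choice.inv (\<sigma> (max N N')) (f i) = h (f i)" using N N' by simp_all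
    then show ?thesis using bij by (metis bij_inv_eq_iff)
  qed
  have fh: "f (h i) = i" for i
  proof -
    obtain N where N: "\<forall>n\<ge>N. \<sigma> n (h i) = f (h i)" using f by blast
    obtain N' where N': "\<forall>n\<ge>N'. Hilbert_Choice.inv (\<sigma> n) i = h i" using h by blast
    have "\<sigma> (max N N') (h i) = f (h i)" "Hilbert_Choice.inv (\<sigma> (max N N')) i = h i" using N N' by simp_all
    then show ?thesis using bij by (metis bij_inv_eq_iff)
  qed
  have bij_f: "bij f" by (rule bij_betwI[of _ _ _ h]) (auto simp: hf fh)
  have inv_f: "Hilbert_Choice.inv f = h" using hf fh by (intro inv_equality)
  have "supp f \<in> I"
  proof (rule I_intro)
    fix e :: ennreal assume "0 < e"
    then obtain c where c: "0 < c" "\<And>a b. a \<le> c \<Longrightarrow> b \<le> c \<Longrightarrow> a + b < e"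
      using ennreal_half_gauge by metis
    obtain N where N: "\<phi> {i. \<sigma> N i \<noteq> f i} \<le> c" using f_lim[OF c(1)] by blast
    have "supp (\<sigma> N) \<in> I" using S by (simp add: S_iff)
    then obtain m where m: "\<phi> (supp (\<sigma> N) - {..m}) < c" using I_tail c(1) by blast
    have "supp f - {..m} \<subseteq> (supp (\<sigma> N) - {..m}) \<union> {i. \<sigma> N i \<noteq> f i}" by (auto simp: supp_def)
    then have "\<phi> (supp f - {..m}) \<le> \<phi> (supp (\<sigma> N) - {..m}) + \<phi> {i. \<sigma> N i \<noteq> f i}"
      by (meson phi_mono phi_Un order_trans)
    also have "\<dots> < e" using m N by (intro c(2)) (rule less_imp_le)
    finally show "\<exists>m. \<phi> (supp f - {..m}) < e" by (rule exI)
  qed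
  then have fS: "f \<in> S" using bij_f by (simp add: S_iff)
  have "\<exists>N. \<forall>n\<ge>N. \<sigma> n \<in> S \<and> sym_dist (\<sigma> n) f < r" if r: "0 < r" for r :: real
  proof -
    obtain N where N: "\<And>n. n \<ge> N \<Longrightarrow> \<phi> {i. \<sigma> n i \<noteq> f i} \<le> ennreal (r/3)"
      using f_lim[of "ennreal (r/3)"] r by auto
    obtain N' where N': "\<And>n. n \<ge> N' \<Longrightarrow> \<phi> {i. Hilbert_Choice.inv (\<sigma> n) i \<noteq> h i} \<le> ennreal (r/3)"
      using h_lim[of "ennreal (r/3)"] r by auto
    have "sym_dist (\<sigma> n) f < r" if "n \<ge> max N N'" for n
    proof -
      \<comment> \<open>The limit estimates are non-strict; \<open>r/3\<close> leaves room for the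
        strict bound \<open>r/2\<close> on each summand.\<close>
      have lt: "ennreal (r/3) < ennreal (r/2)" using r by (simp add: ennreal_less_iff)
      have "diff_dist \<phi> (\<sigma> n) f < r/2"
        unfolding diff_dist_less_iff[OF S fS] using N[of n] that lt by simp
      moreover have "diff_dist \<phi> (Hilbert_Choice.inv (\<sigma> n)) (Hilbert_Choice.inv f) < r/2"
        unfolding diff_dist_less_iff[OF S_inv[OF S] S_inv[OF fS]] unfolding inv_f using N'[of n] that lt by simp
      ultimately show ?thesis unfolding sym_dist_def by linarith
    qed
    then show ?thesis using S by blast
  qed
  then have "limitin sym.mtopology \<sigma> f sequentially"
    unfolding sym.limit_metric_sequentially using fS by blast
  then show "\<exists>x. limitin sym.mtopology \<sigma> x sequentially" by (rule exI[of _ f])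
qed

lemma completely_metrizable_T: "completely_metrizable_space T"
  unfolding completely_metrizable_space_def
  using Metric_space_sym_dist sym_mcomplete sym_dist_topology by metis

lemma Polish_group_S_ideal: "Polish_group (S_ideal I) T"
  unfolding Polish_group_def
  using topological_group_S_ideal separable_T completely_metrizable_T by blast

end

section \<open>Failure of the non-archimedean property\<close>

lemma S_infty_open_contains_cylinder:
  assumes "openin S_infty_topology W" "p \<in> W"
  obtains F :: "nat set" where "finite F" "\<And>q. bij q \<Longrightarrow> (\<And>i. i \<in> F \<Longrightarrow> q i = p i) \<Longrightarrow> q \<in> W"
proof -
  obtain W' where W': "openin (product_topology (\<lambda>_. discrete_topology UNIV) UNIV) W'" "W = W' \<inter> carrier S_infty"
    using assms(1) unfolding S_infty_topology_def openin_subtopology by metis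
  obtain V :: "nat \<Rightarrow> nat set" where V: "finite {i. V i \<noteq> UNIV}" "p \<in> Pi\<^sub>E UNIV V" "Pi\<^sub>E UNIV V \<subseteq> W'"
    using W' assms(2) unfolding openin_product_topology_alt by fastforce
  show ?thesis
  proof (rule that[OF V(1)])
    fix q assume q: "bij q" "\<And>i. i \<in> {i. V i \<noteq> UNIV} \<Longrightarrow> q i = p i"
    have "q i \<in> V i" for i
      using q(2)[of i] V(2) by (cases "V i = UNIV") (auto simp: PiE_iff)
    then have "q \<in> W'" using V(3) by (auto simp: PiE_iff)
    then show "q \<in> W" using q(1) by (simp add: W'(2) S_infty_def)
  qed
qed

lemma openin_S_infty_stabilizer:
  assumes "finite F"
  shows "openin S_infty_topology {p. bij p \<and> (\<forall>i\<in>F. p i = i)}"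
proof -
  have cont: "continuous_map S_infty_topology (discrete_topology UNIV) (\<lambda>p. p i)" for i
    unfolding S_infty_topology_def
    by (intro continuous_map_from_subtopology continuous_map_product_projection) simp
  have top: "topspace S_infty_topology = {p. bij p}"
    by (auto simp: S_infty_topology_def S_infty_def)
  have "openin S_infty_topology {p \<in> topspace S_infty_topology. p i \<in> {i}}" for i
    by (rule openin_continuous_map_preimage[OF cont]) simp
  then have "openin S_infty_topology {p \<in> topspace S_infty_topology. p i = i}" for i by simp
  then have "openin S_infty_topology ((\<Inter>i\<in>F. {p \<in> topspace S_infty_topology. p i = i}) \<inter> topspace S_infty_topology)"
    by (intro openin_INT assms)
  also have "(\<Inter>i\<in>F. {p \<in> topspace S_infty_topology. p i = i}) \<inter> topspace S_infty_topology = {p. bij p \<and> (\<forall>i\<in>F. p i = i)}"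
    by (auto simp: top)
  finally show ?thesis .
qed

text \<open>Adding a point \<open>x\<close> to the support by composing with a transposition \<open>(x a)\<close>, \<open>a\<close> in the
  support.\<close>

lemma product_of_transpositions_support:
  fixes V :: "(nat \<Rightarrow> nat) set"
  assumes comp: "\<And>f g. f \<in> V \<Longrightarrow> g \<in> V \<Longrightarrow> f \<circ> g \<in> V"
    and transp: "\<And>x y. x \<in> D \<Longrightarrow> y \<in> D \<Longrightarrow> Transposition.transpose x y \<in> V"
    and inj: "\<And>f. f \<in> V \<Longrightarrow> inj f"
    and ab: "a \<in> D" "b \<in> D" "a \<noteq> b" and "finite F" "F \<subseteq> D"
  shows "\<exists>v\<in>V. supp v = F \<union> {a, b}"
  using assms(7,8)
proof (induction F rule: finite_induct)
  case empty
  have "supp (Transposition.transpose a b) = {a, b}" using ab(3) by (auto simp: supp_def Transposition.transpose_def)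
  then show ?case using transp[OF ab(1,2)] by auto
next
  case (insert x F)
  then obtain v where v: "v \<in> V" "supp v = F \<union> {a, b}" by auto
  show ?case
  proof (cases "x \<in> {a, b}")
    case True
    then show ?thesis using v by auto
  next
    case False
    then have x: "v x = x" using v(2) insert.hyps(2) by (auto simp: supp_def)
    have mem: "n \<in> F \<union> {a, b} \<longleftrightarrow> v n \<noteq> n" for n using v(2) by (auto simp: supp_def)
    have "n \<in> supp (Transposition.transpose x a \<circ> v) \<longleftrightarrow> n \<in> insert x F \<union> {a, b}" for n
    proof -
      \<comment> \<open>The composition differs from \<open>v\<close> at two points:
        \<open>x\<close>, now sent to \<open>a\<close>, and the point that \<open>v\<close> sends to
        \<open>a\<close>, now sent to \<open>x\<close>. The latter was moved by \<open>v\<close>, as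
        \<open>a\<close> is in the support, and it is still moved because it is not
        \<open>x\<close>.\<close>
      have "v n = x \<longleftrightarrow> n = x" using x inj[OF v(1)] by (metis inj_eq)
      then show ?thesis
        using mem[of n] mem[of a] x False by (auto simp: supp_def Transposition.transpose_def)
    qed
    then have "supp (Transposition.transpose x a \<circ> v) = insert x F \<union> {a, b}" by blast
    moreover have "Transposition.transpose x a \<circ> v \<in> V" using comp transp insert.prems ab(1) v(1) by simp
    ultimately show ?thesis by blast
  qed
qed

section \<open>Open subgroups and points of small submeasure\<close>

context represented_ideal
begin

definition small_atoms :: "ennreal \<Rightarrow> nat set" where
  "small_atoms d = {n. \<phi> {n} < d}"

lemma small_atoms_mono: "d \<le> d' \<Longrightarrow> small_atoms d \<subseteq> small_atoms d'"
  by (auto simp: small_atoms_def)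

text \<open>A member of \<open>I\<close> has a tail of submeasure below \<open>d\<close>, hence only
  finitely many points outside \<open>small_atoms d\<close>. If that set were in \<open>I\<close>,
  then \<open>I\<close> would be the modification of \<open>Fin\<close> along its
  complement.\<close>

lemma small_atoms_notin_I:
  assumes "\<not> trivial_modification_of_Fin I" "0 < d"
  shows "small_atoms d \<notin> I"
proof
  assume D: "small_atoms d \<in> I"
  have "B \<in> I \<longleftrightarrow> finite (- small_atoms d \<inter> B)" for B
  proof
    assume "B \<in> I"
    then obtain m where m: "\<phi> (B - {..m}) < d" using I_tail assms(2) by blast
    have "- small_atoms d \<inter> B \<subseteq> {..m}"
    proof (rule subsetI, rule ccontr)
      fix n assume n: "n \<in> - small_atoms d \<inter> B" "n \<notin> {..m}"
      then have "\<phi> {n} \<le> \<phi> (B - {..m})" by (intro phi_mono) auto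
      then have "\<phi> {n} < d" using m by (rule le_less_trans)
      then show False using n(1) by (simp add: small_atoms_def)
    qed
    then show "finite (- small_atoms d \<inter> B)" by (rule finite_subset) simp
  next
    assume "finite (- small_atoms d \<inter> B)"
    then have "small_atoms d \<union> (- small_atoms d \<inter> B) \<in> I" by (intro I_Un D I_finite)
    then show "B \<in> I" by (rule I_subset) auto
  qed
  then have "I = {B. - small_atoms d \<inter> B \<in> Fin}" by (auto simp: Fin_def)
  then show False using assms(1) unfolding trivial_modification_of_Fin_def by blast
qed

text \<open>\<open>V\<close> is the preimage under \<open>h\<close> of the pointwise stabilizer of a
  finite set \<open>F\<close>. Since \<open>h\<close> is open, \<open>F\<close> can be chosen so
  that the part of the stabilizer in \<open>H\<close> lies in the image of the
  \<open>e\<close>-neighbourhood \<open>U\<close>, and injectivity of \<open>h\<close> brings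
  \<open>V\<close> into \<open>U\<close>.\<close>

lemma non_archimedean_open_subgroup:
  assumes "non_archimedean (S_ideal I) T" "0 < e"
  obtains V where "openin T V" "id \<in> V" "\<And>f g. f \<in> V \<Longrightarrow> g \<in> V \<Longrightarrow> f \<circ> g \<in> V"
    "\<And>g. g \<in> V \<Longrightarrow> \<phi> (supp g) < e"
proof -
  obtain H h where H: "subgroup H S_infty" "h \<in> iso (S_ideal I) (S_infty\<lparr>carrier := H\<rparr>)"
    "homeomorphic_map T (subtopology S_infty_topology H) h"
    using assms(1) unfolding non_archimedean_def by metis
  interpret A: group "S_ideal I" using ideal by (rule group_S_ideal)
  have hom: "h \<in> hom (S_ideal I) (S_infty\<lparr>carrier := H\<rparr>)" and bij: "bij_betw h S H"
    using H(2) by (auto simp: iso_def)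
  have h_comp: "h (f \<circ> g) = h f \<circ> h g" if "f \<in> S" "g \<in> S" for f g
    using hom_mult[OF hom that] by (simp add: S_infty_def)
  have h_H: "h g \<in> H" if "g \<in> S" for g using bij that by (auto simp: bij_betw_def)
  have H_bij: "bij q" if "q \<in> H" for q
    using subgroup.subset[OF H(1)] that by (auto simp: S_infty_def)
  have h_id: "h id = id"
  proof -
    have "group (S_infty\<lparr>carrier := H\<rparr>)"
      using subgroup.subgroup_is_group[OF H(1) group_S_infty] .
    from hom_one[OF hom A.group_axioms this] show ?thesis by (simp add: S_infty_def)
  qed
  obtain U where U: "openin T U" "id \<in> U" "\<And>g. g \<in> U \<Longrightarrow> g \<in> S \<and> \<phi> {n. id n \<noteq> g n} < e"
    using T_nhd[OF id_S assms(2)] by metis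
  have "open_map T (subtopology S_infty_topology H) h"
    using H(3) by (rule homeomorphic_imp_open_map)
  then have "openin (subtopology S_infty_topology H) (h ` U)"
    using U(1) unfolding open_map_def by blast
  then obtain W where W: "openin S_infty_topology W" "h ` U = W \<inter> H"
    unfolding openin_subtopology by metis
  have "id \<in> W" using U(2) h_id W(2) by (metis IntD1 imageI)
  then obtain F where F: "finite F" "\<And>q. bij q \<Longrightarrow> (\<And>i. i \<in> F \<Longrightarrow> q i = i) \<Longrightarrow> q \<in> W"
    using S_infty_open_contains_cylinder[OF W(1), of id] by (metis id_apply)
  define V where "V = {g \<in> S. \<forall>i\<in>F. h g i = i}"
  show ?thesis
  proof (rule that[of V])
    have "continuous_map T S_infty_topology h"
      using homeomorphic_imp_continuous_map[OF H(3)] by (simp add: continuous_map_in_subtopology)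
    from openin_continuous_map_preimage[OF this openin_S_infty_stabilizer[OF F(1)]]
    have "openin T {g \<in> S. bij (h g) \<and> (\<forall>i\<in>F. h g i = i)}" by simp
    moreover have "{g \<in> S. bij (h g) \<and> (\<forall>i\<in>F. h g i = i)} = V"
      unfolding V_def using h_H H_bij by blast
    ultimately show "openin T V" by simp
    show "id \<in> V" by (simp add: V_def id_S h_id)
    show "f \<circ> g \<in> V" if "f \<in> V" "g \<in> V" for f g
      using that by (simp add: V_def S_comp h_comp)
    show "\<phi> (supp g) < e" if g: "g \<in> V" for g
    proof -
      have gS: "g \<in> S" using g by (simp add: V_def)
      have "h g \<in> W" using g by (intro F(2) H_bij h_H gS) (simp add: V_def)
      then have "h g \<in> h ` U" using W(2) h_H[OF gS] by simp
      then obtain g' where g': "g' \<in> U" "h g = h g'" by blast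
      then have "g = g'" using bij gS U(3) by (meson bij_betw_imp_inj_on inj_onD)
      then have "\<phi> {n. id n \<noteq> g n} < e" using U(3) g'(1) by blast
      moreover have "{n. id n \<noteq> g n} = supp g" by (auto simp: supp_def)
      ultimately show ?thesis by simp
    qed
  qed
qed

lemma non_archimedean_small_atoms:
  assumes "non_archimedean (S_ideal I) T" "0 < e" and inf: "\<And>d. 0 < d \<Longrightarrow> infinite (small_atoms d)"
  shows "\<exists>d>0. \<phi> (small_atoms d) \<le> e"
proof -
  obtain V where V: "openin T V" "id \<in> V" "\<And>f g. f \<in> V \<Longrightarrow> g \<in> V \<Longrightarrow> f \<circ> g \<in> V"
    "\<And>g. g \<in> V \<Longrightarrow> \<phi> (supp g) < e"
    using non_archimedean_open_subgroup[OF assms(1,2)] by metis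
  obtain c where c: "0 < c" "\<And>g. g \<in> S \<Longrightarrow> \<phi> {n. id n \<noteq> g n} < c \<Longrightarrow> g \<in> V"
    using V(1,2) unfolding openin_T_iff by metis
  \<comment> \<open>A transposition moves at most two points, so atoms below this half of
    \<open>c\<close> yield transpositions in the \<open>c\<close>-neighbourhood of the identity, and
    thus in \<open>V\<close>.\<close>
  obtain d where d: "0 < d" "\<And>a b. a \<le> d \<Longrightarrow> b \<le> d \<Longrightarrow> a + b < c"
    using ennreal_half_gauge[OF c(1)] by metis
  let ?D = "small_atoms d"
  have transp: "Transposition.transpose x y \<in> V" if "x \<in> ?D" "y \<in> ?D" for x y
  proof (rule c(2))
    have "supp (Transposition.transpose x y) \<subseteq> {x, y}" by (auto simp: supp_def Transposition.transpose_def)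
    then show "Transposition.transpose x y \<in> S" by (simp add: S_iff I_finite finite_subset)
    have "{n. id n \<noteq> Transposition.transpose x y n} \<subseteq> {x} \<union> {y}" by (auto simp: Transposition.transpose_def)
    then have "\<phi> {n. id n \<noteq> Transposition.transpose x y n} \<le> \<phi> {x} + \<phi> {y}" by (meson phi_mono phi_Un order_trans)
    also have "\<dots> < c" using that by (intro d(2)) (simp_all add: small_atoms_def)
    finally show "\<phi> {n. id n \<noteq> Transposition.transpose x y n} < c" .
  qed
  have V_inj: "inj f" if "f \<in> V" for f
    using that openin_subset[OF V(1)] by (auto simp: S_iff bij_is_inj)
  obtain a where a: "a \<in> ?D" using infinite_imp_nonempty[OF inf[OF d(1)]] by auto
  have "infinite (?D - {a})" using inf[OF d(1)] by simp
  then obtain b where b: "b \<in> ?D" "b \<noteq> a" using infinite_imp_nonempty by blast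
  have "\<phi> ?D \<le> e"
  proof (rule phi_le_finite)
    fix F assume "finite F" "F \<subseteq> ?D"
    then obtain v where "v \<in> V" "supp v = F \<union> {a, b}"
      using product_of_transpositions_support[of V ?D a b F, OF V(3) transp V_inj a b(1) b(2)[symmetric]] by blast
    then have "\<phi> (F \<union> {a, b}) < e" using V(4) by metis
    moreover have "\<phi> F \<le> \<phi> (F \<union> {a, b})" by (rule phi_mono) auto
    ultimately show "\<phi> F \<le> e" by simp
  qed
  then show ?thesis using d(1) by blast
qed

text \<open>Finite sets grow by ever smaller atoms. Stage \<open>n\<close> fixes an initial segment
  that no member of \<open>C n\<close> shares, and all later points lie beyond it in a set of
  submeasure at most \<open>1 / Suc n\<close>. The union is then in \<open>I\<close> but in no
  \<open>C n\<close>.\<close>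

lemma small_atoms_not_Sigma02:
  assumes "Sigma02 I" and notin: "\<And>d. 0 < d \<Longrightarrow> small_atoms d \<notin> I"
    and small: "\<And>e. 0 < e \<Longrightarrow> \<exists>d>0. \<phi> (small_atoms d) \<le> e"
  shows False
proof -
  obtain C :: "nat \<Rightarrow> nat set set" where C: "\<And>n. closed_family (C n)" and IC: "I = (\<Union>n. C n)"
    using assms(1) unfolding Sigma02_iff by metis
  let ?D = small_atoms
  \<comment> \<open>A state consists of the finite set built so far, the length of the segment
    already decided, and the bound on atoms that may still be added.\<close>
  define P :: "nat set \<times> nat \<times> ennreal \<Rightarrow> bool" where "P = (\<lambda>(A, m, d). finite A \<and> 0 < d)"
  define R :: "nat \<Rightarrow> nat set \<times> nat \<times> ennreal \<Rightarrow> nat set \<times> nat \<times> ennreal \<Rightarrow> bool"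
    where "R n = (\<lambda>(A, m, d) (A', m', d'). A \<subseteq> A' \<and> A' - A \<subseteq> ?D d \<and> d' \<le> d \<and>
      (\<forall>B. (\<forall>i<m'. i \<in> A' \<longleftrightarrow> i \<in> B) \<longrightarrow> B \<notin> C n) \<and> ?D d' \<inter> {..<m'} = {} \<and>
      \<phi> (?D d') \<le> ennreal (1 / Suc n))" for n
  have "\<exists>f. \<forall>n. P (f n) \<and> R n (f n) (f (Suc n))"
  proof (rule dependent_nat_choice)
    show "\<exists>x. P x" unfolding P_def by (intro exI[of _ "({}, 0, 1)"]) simp
  next
    fix x n assume "P x"
    then obtain A m d where x: "x = (A, m, d)" "finite A" "0 < d" by (auto simp: P_def)
    \<comment> \<open>Adding all permitted atoms leaves \<open>I\<close>, hence the closed family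
      \<open>C n\<close>. A long enough initial segment of that set already certifies this, and only
      finitely many atoms are used for it.\<close>
    have "A \<union> ?D d \<notin> I" using notin[OF x(3)] I_subset by blast
    then have "A \<union> ?D d \<notin> C n" unfolding IC by (meson UNIV_I UN_I)
    then have "\<not> (\<forall>m. \<exists>B\<in>C n. \<forall>i<m. i \<in> A \<union> ?D d \<longleftrightarrow> i \<in> B)"
      using C[of n] unfolding closed_family_def by metis
    then obtain m' where m': "\<And>B. B \<in> C n \<Longrightarrow> \<not> (\<forall>i<m'. i \<in> A \<union> ?D d \<longleftrightarrow> i \<in> B)" by metis
    define A' where "A' = A \<union> (?D d \<inter> {..<m'})"
    obtain d1 where d1: "0 < d1" "\<phi> (?D d1) \<le> ennreal (1 / Suc n)"
      using small[of "ennreal (1 / Suc n)"] by auto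
    \<comment> \<open>Being at most \<open>\<phi> {k}\<close> for \<open>k < m'\<close>, the bound
      \<open>d'\<close> forbids later additions inside the decided segment.\<close>
    define d' where "d' = Min (insert d (insert d1 ((\<lambda>k. \<phi> {k}) ` {..<m'})))"
    have d': "0 < d'" using x(3) d1(1) phi_pos by (auto simp: d'_def)
    have d'_le: "d' \<le> d" "d' \<le> d1" "\<And>k. k < m' \<Longrightarrow> d' \<le> \<phi> {k}"
      unfolding d'_def by (rule Min_le; simp)+
    have "finite A'" using x(2) by (simp add: A'_def)
    moreover have "A \<subseteq> A'" "A' - A \<subseteq> ?D d" by (auto simp: A'_def)
    moreover have "B \<notin> C n" if B: "\<forall>i<m'. i \<in> A' \<longleftrightarrow> i \<in> B" for B
    proof
      assume "B \<in> C n"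
      moreover have "\<forall>i<m'. i \<in> A \<union> ?D d \<longleftrightarrow> i \<in> B" using B by (auto simp: A'_def)
      ultimately show False using m' by blast
    qed
    moreover have "?D d' \<inter> {..<m'} = {}"
      using d'_le(3) by (fastforce simp: small_atoms_def)
    moreover have "\<phi> (?D d') \<le> ennreal (1 / Suc n)"
      using phi_mono[OF small_atoms_mono[OF d'_le(2)]] d1(2) by (rule order_trans)
    ultimately have "P (A', m', d') \<and> R n x (A', m', d')"
      using d' d'_le(1) unfolding P_def R_def x(1) by simp
    then show "\<exists>y. P y \<and> R n x y" by (rule exI)
  qed
  then obtain f where f: "\<forall>n. P (f n) \<and> R n (f n) (f (Suc n))" by (rule exE)
  define A where "A n = fst (f n)" for n
  define m where "m n = fst (snd (f n))" for n
  define d where "d n = snd (snd (f n))" for n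
  have f_eq: "f n = (A n, m n, d n)" for n by (simp add: A_def m_def d_def)
  have fin: "finite (A n)" for n using f[rule_format, of n] unfolding f_eq P_def by simp
  have Rn: "A n \<subseteq> A (Suc n)" "A (Suc n) - A n \<subseteq> ?D (d n)" "d (Suc n) \<le> d n"
     "?D (d (Suc n)) \<inter> {..<m (Suc n)} = {}" "\<phi> (?D (d (Suc n))) \<le> ennreal (1 / Suc n)" for n
    using f[rule_format, of n] unfolding f_eq R_def by simp_all
  have avoid: "B \<notin> C n" if "\<forall>i<m (Suc n). i \<in> A (Suc n) \<longleftrightarrow> i \<in> B" for B n
    using f[rule_format, of n] that unfolding f_eq R_def by simp
  have dec: "d k \<le> d n" if "n \<le> k" for n k
    using that by (induction rule: dec_induct) (auto intro: order_trans[OF Rn(3)])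
  have grow: "A k - A n \<subseteq> ?D (d n)" if "n \<le> k" for n k
    using that
  proof (induction rule: dec_induct)
    case (step k)
    have "A (Suc k) - A n \<subseteq> (A (Suc k) - A k) \<union> (A k - A n)" by auto
    also have "\<dots> \<subseteq> ?D (d n)"
      using step.IH Rn(2)[of k] small_atoms_mono[OF dec[OF step.hyps(1)]] by (meson Un_least order_trans)
    finally show ?case .
  qed simp
  have inc: "A n \<subseteq> A k" if "n \<le> k" for n k
    using that by (induction rule: dec_induct) (auto dest: subsetD[OF Rn(1)])
  define L where "L = (\<Union>n. A n)"
  have L: "L - A n \<subseteq> ?D (d n)" for n
  proof
    fix x assume x: "x \<in> L - A n"
    then obtain k where "x \<in> A k" by (auto simp: L_def)
    then have "x \<in> A (max n k) - A n" using x inc[of k "max n k"] by auto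
    then show "x \<in> ?D (d n)" using grow[of n "max n k"] by auto
  qed
  have AL: "A n \<subseteq> L" for n by (auto simp: L_def)
  have "L \<notin> C n" for n
    using L[of "Suc n"] AL[of "Suc n"] Rn(4)[of n] by (intro avoid) blast
  then have "L \<notin> I" unfolding IC by auto
  moreover have "L \<in> I"
  proof (rule I_intro)
    fix e :: ennreal assume e: "0 < e"
    obtain n where n: "ennreal (1 / Suc n) < e"
    proof (cases e)
      case (real r)
      then have "0 < r" using e by simp
      then obtain n where "1 / real (Suc n) < r" using nat_approx_posE by metis
      then show ?thesis using that real by (simp add: ennreal_less_iff del: of_nat_Suc)
    next
      case top
      then show ?thesis by (intro that[of 0]) simp
    qed
    obtain k where "A (Suc n) \<subseteq> {..k}" using fin finite_nat_iff_bounded_le by metis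
    then have "L - {..k} \<subseteq> ?D (d (Suc n))" using L[of "Suc n"] by blast
    then have "\<phi> (L - {..k}) \<le> \<phi> (?D (d (Suc n)))" by (rule phi_mono)
    then have "\<phi> (L - {..k}) < e" using Rn(5)[of n] n by (meson le_less_trans order_trans)
    then show "\<exists>k. \<phi> (L - {..k}) < e" by (rule exI)
  qed
  ultimately show False by blast
qed

theorem not_non_archimedean:
  assumes "Sigma02 I" "\<not> trivial_modification_of_Fin I"
  shows "\<not> non_archimedean (S_ideal I) T"
proof
  assume na: "non_archimedean (S_ideal I) T"
  have notin: "small_atoms d \<notin> I" if "0 < d" for d
    using assms(2) that by (rule small_atoms_notin_I)
  show False
  proof (rule small_atoms_not_Sigma02[OF assms(1)])
    show "\<exists>d>0. \<phi> (small_atoms d) \<le> e" if "0 < e" for e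
      using na that by (rule non_archimedean_small_atoms) (use notin I_finite in blast)
  qed (rule notin)
qed

end

section \<open>Generic tuples\<close>

lemma comeagre_in_dense_open:
  assumes "countable \<U>" and U: "\<And>U. U \<in> \<U> \<Longrightarrow> openin X U \<and> X closure_of U = topspace X"
    and sub: "A \<subseteq> topspace X" "topspace X \<inter> \<Inter>\<U> \<subseteq> A"
  shows "comeagre_in X A"
  unfolding comeagre_in_def meagre_in_def union_of_def
proof (intro conjI exI)
  \<comment> \<open>\<open>meagre_in\<close> asks for an exact union, so \<open>A\<close> is removed
    from each nowhere dense complement.\<close>
  let ?N = "\<lambda>U. (topspace X - U) - A"
  show "countable (?N ` \<U>)" using assms(1) by simp
  show "?N ` \<U> \<subseteq> Collect (nowhere_dense_in X)"
  proof (rule image_subsetI, rule CollectI)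
    fix U assume "U \<in> \<U>"
    then have op: "openin X U" and de: "X closure_of U = topspace X" using U by auto
    have "closedin X (topspace X - U)" using op by blast
    then have "X closure_of (?N U) \<subseteq> topspace X - U" by (intro closure_of_minimal) auto
    then have "X interior_of (X closure_of (?N U)) \<subseteq> X interior_of (topspace X - U)" by (rule interior_of_mono)
    also have "\<dots> = {}" by (simp add: interior_of_complement de)
    finally show "nowhere_dense_in X (?N U)" by (auto simp: nowhere_dense_in_def)
  qed
  show "\<Union>(?N ` \<U>) = topspace X - A" using sub(2) by blast
qed (rule sub(1))

text \<open>For permutations these are the finite unions of finite orbits of the group generated by
  \<open>x 0\<close>, ..., \<open>x n\<close>.\<close>

definition invariant_set :: "nat \<Rightarrow> (nat \<Rightarrow> nat \<Rightarrow> nat) \<Rightarrow> nat set \<Rightarrow> bool" where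
  "invariant_set n x F \<longleftrightarrow> finite F \<and> (\<forall>i\<le>n. x i ` F = F)"

text \<open>A pattern is an action of the free group on \<open>n + 1\<close> generators on \<open>{..<k}\<close>; the list
  \<open>t ! i\<close> is the table of the \<open>i\<close>-th generator. Lists are used because there are only countably
  many of them.\<close>

definition pattern :: "nat \<Rightarrow> nat \<Rightarrow> nat list list \<Rightarrow> bool" where
  "pattern n k t \<longleftrightarrow> (\<forall>i\<le>n. bij_betw (\<lambda>j. t ! i ! j) {..<k} {..<k})"

text \<open>The bound \<open>m\<close> encodes infinitely many disjoint copies: asked for every
  \<open>m\<close>, it provides a copy outside any given finite set.\<close>

definition has_copy :: "nat \<Rightarrow> nat set \<Rightarrow> nat \<Rightarrow> nat list list \<Rightarrow> nat \<Rightarrow> (nat \<Rightarrow> nat \<Rightarrow> nat) \<Rightarrow> bool" where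
  "has_copy n B k t m x \<longleftrightarrow>
     (\<exists>e. inj_on e {..<k} \<and> e ` {..<k} \<subseteq> B - {..m} \<and> (\<forall>i\<le>n. \<forall>j<k. x i (e j) = e (t ! i ! j)))"

text \<open>Partial bijections are kept as relations, so that exchanging the two tuples is just
  passing to the converse.\<close>

definition partial_conj ::
    "nat \<Rightarrow> nat set \<Rightarrow> (nat \<Rightarrow> nat \<Rightarrow> nat) \<Rightarrow> (nat \<Rightarrow> nat \<Rightarrow> nat) \<Rightarrow> (nat \<times> nat) set \<Rightarrow> bool" where
  "partial_conj n A x y p \<longleftrightarrow> finite p \<and> p \<subseteq> A \<times> A \<and>
     (\<forall>a b a' b'. (a, b) \<in> p \<longrightarrow> (a', b') \<in> p \<longrightarrow> (a = a' \<longleftrightarrow> b = b')) \<and>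
     (\<forall>a b. (a, b) \<in> p \<longrightarrow> (\<forall>i\<le>n. (x i a, y i b) \<in> p))"

section \<open>Partial conjugacies and the back-and-forth\<close>

lemma partial_conj_inj:
  "partial_conj n A x y p \<Longrightarrow> (a, b) \<in> p \<Longrightarrow> (a', b') \<in> p \<Longrightarrow> a = a' \<longleftrightarrow> b = b'"
  unfolding partial_conj_def by metis

lemma partial_conj_closed:
  "partial_conj n A x y p \<Longrightarrow> (a, b) \<in> p \<Longrightarrow> i \<le> n \<Longrightarrow> (x i a, y i b) \<in> p"
  unfolding partial_conj_def by simp

lemma partial_conj_converse: "partial_conj n A x y p \<Longrightarrow> partial_conj n A y x (p\<inverse>)"
  unfolding partial_conj_def by auto

text \<open>Take the not yet treated part \<open>R\<close> of a finite invariant set around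
  \<open>a\<close>. The tuple \<open>x\<close> permutes \<open>R\<close>; the tuple \<open>y\<close>
  realizes the same pattern on fresh points of \<open>B\<close>, and matching the two extends
  \<open>p\<close>.\<close>

lemma partial_conj_extend:
  assumes p: "partial_conj n A x y p" and a: "a \<in> A"
    and x_inj: "\<And>i. i \<le> n \<Longrightarrow> inj (x i)" and x_A: "\<And>i c. i \<le> n \<Longrightarrow> c \<in> A \<Longrightarrow> x i c \<in> A"
    and x_inv: "\<And>c. \<exists>F. c \<in> F \<and> invariant_set n x F"
    and y_copy: "\<And>k t m. pattern n k t \<Longrightarrow> has_copy n B k t m y" and BA: "B \<subseteq> A"
  shows "\<exists>p'. partial_conj n A x y p' \<and> p \<subseteq> p' \<and> a \<in> Domain p'"
proof (cases "a \<in> Domain p")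
  case True
  then show ?thesis using p by blast
next
  case False
  have fin: "finite p" and pA: "p \<subseteq> A \<times> A" using p by (simp_all add: partial_conj_def)
  note p_inj = partial_conj_inj[OF p] and p_cl = partial_conj_closed[OF p]
  obtain F where F: "a \<in> F" "finite F" "\<And>i. i \<le> n \<Longrightarrow> x i ` F = F"
    using x_inv unfolding invariant_set_def by metis
  define R where "R = (F \<inter> A) - Domain p"
  have aR: "a \<in> R" using F(1) a False by (simp add: R_def)
  have finR: "finite R" using F(2) by (simp add: R_def)
  \<comment> \<open>The finite domain is mapped injectively into itself, hence onto itself, so no
    point outside can be mapped into it.\<close>
  have xDom: "x i ` Domain p = Domain p" if "i \<le> n" for i
  proof (rule endo_inj_surj)
    show "finite (Domain p)" using fin by (rule finite_Domain)
    show "x i ` Domain p \<subseteq> Domain p" using p_cl that by (auto simp: Domain_iff)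
    show "inj_on (x i) (Domain p)" using x_inj[OF that] by (rule inj_on_subset) simp
  qed
  have xR: "bij_betw (x i) R R" if i: "i \<le> n" for i
  proof -
    have inj: "inj_on (x i) R" using x_inj[OF i] by (rule inj_on_subset) simp
    moreover have "x i ` R \<subseteq> R"
    proof
      fix d assume "d \<in> x i ` R"
      then obtain c where c: "c \<in> R" "d = x i c" by blast
      have "d \<in> F" using F(3)[OF i] c by (auto simp: R_def)
      moreover have "d \<in> A" using x_A[OF i] c by (simp add: R_def)
      moreover have "d \<notin> Domain p"
      proof
        assume "d \<in> Domain p"
        then obtain c' where "c' \<in> Domain p" "x i c = x i c'" using xDom[OF i] c(2) by blast
        then have "c \<in> Domain p" using x_inj[OF i] by (auto dest: injD)
        then show False using c(1) by (simp add: R_def)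
      qed
      ultimately show "d \<in> R" by (simp add: R_def)
    qed
    then have "x i ` R = R" using inj by (intro endo_inj_surj finR)
    ultimately show ?thesis by (simp add: bij_betw_def)
  qed
  obtain r where "bij_betw r {0..<card R} R" using ex_bij_betw_nat_finite[OF finR] by blast
  then have r: "bij_betw r {..<card R} R" by (simp add: atLeast0LessThan)
  let ?k = "card R"
  let ?ri = "inv_into {..<?k} r"
  have ri: "bij_betw ?ri R {..<?k}" using r by (rule bij_betw_inv_into)
  \<comment> \<open>The table of the action of \<open>x\<close> on \<open>R\<close>, read through
    the numbering \<open>r\<close>.\<close>
  define t where "t = map (\<lambda>i. map (\<lambda>j. ?ri (x i (r j))) [0..<?k]) [0..<Suc n]"
  have t: "t ! i ! j = ?ri (x i (r j))" if "i \<le> n" "j < ?k" for i j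
    using that unfolding t_def by (simp del: upt_Suc)
  have bij_t: "bij_betw (\<lambda>j. t ! i ! j) {..<?k} {..<?k}" if "i \<le> n" for i
  proof -
    have "bij_betw (?ri \<circ> (x i \<circ> r)) {..<?k} {..<?k}"
      by (intro bij_betw_trans[OF bij_betw_trans[OF r xR[OF that]] ri])
    then show ?thesis by (subst bij_betw_cong[of _ _ "?ri \<circ> (x i \<circ> r)"]) (simp_all add: t that)
  qed
  then have "pattern n ?k t" by (simp add: pattern_def)
  \<comment> \<open>A copy beyond this bound is disjoint from the range of \<open>p\<close>.\<close>
  moreover obtain m where m: "Range p \<subseteq> {..m}"
    using finite_Range[OF fin] finite_nat_iff_bounded_le by blast
  ultimately obtain e where e: "inj_on e {..<?k}" "e ` {..<?k} \<subseteq> B - {..m}"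
    and ey: "\<And>i j. i \<le> n \<Longrightarrow> j < ?k \<Longrightarrow> y i (e j) = e (t ! i ! j)"
    using y_copy[of ?k t m] unfolding has_copy_def by metis
  define q where "q = (\<lambda>j. (r j, e j)) ` {..<?k}"
  have qI: "(r j, e j) \<in> q" if "j < ?k" for j using that by (simp add: q_def)
  have qE: "\<exists>j<?k. c = r j \<and> d = e j" if "(c, d) \<in> q" for c d using that by (auto simp: q_def)
  have rR: "r j \<in> R" if "j < ?k" for j using r that by (auto simp: bij_betw_def)
  have eB: "e j \<in> B" "e j > m" if "j < ?k" for j using e(2) that by auto
  have r_inj: "r i = r j \<longleftrightarrow> i = j" if "i < ?k" "j < ?k" for i j
    using r that by (auto simp: bij_betw_def inj_on_def)
  have e_inj: "e i = e j \<longleftrightarrow> i = j" if "i < ?k" "j < ?k" for i j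
    using e(1) that by (auto simp: inj_on_def)
  have pq: "c \<noteq> c' \<and> d \<noteq> d'" if cd: "(c, d) \<in> p" "(c', d') \<in> q" for c d c' d'
  proof -
    obtain j where j: "j < ?k" "c' = r j" "d' = e j" using qE[OF cd(2)] by blast
    have "c \<in> Domain p" "d \<in> Range p" using cd(1) by auto
    then show ?thesis using rR[OF j(1)] eB(2)[OF j(1)] m j(2,3) by (auto simp: R_def)
  qed
  have qq: "c = c' \<longleftrightarrow> d = d'" if "(c, d) \<in> q" "(c', d') \<in> q" for c d c' d'
    using qE[OF that(1)] qE[OF that(2)] r_inj e_inj by metis
  have "partial_conj n A x y (p \<union> q)"
    unfolding partial_conj_def
  proof (intro conjI allI impI)
    show "finite (p \<union> q)" using fin by (simp add: q_def)
    show "p \<union> q \<subseteq> A \<times> A"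
    proof (rule Un_least[OF pA], rule subrelI)
      fix c d assume "(c, d) \<in> q"
      then obtain j where "j < ?k" "c = r j" "d = e j" using qE by blast
      then show "(c, d) \<in> A \<times> A" using rR eB(1) BA by (auto simp: R_def)
    qed
    show "c = c' \<longleftrightarrow> d = d'" if cd: "(c, d) \<in> p \<union> q" "(c', d') \<in> p \<union> q" for c d c' d'
    proof -
      consider "(c, d) \<in> p" "(c', d') \<in> p" | "(c, d) \<in> p" "(c', d') \<in> q"
        | "(c, d) \<in> q" "(c', d') \<in> p" | "(c, d) \<in> q" "(c', d') \<in> q" using cd by blast
      then show ?thesis
      proof cases
        case 1 then show ?thesis by (rule p_inj)
      next
        case 2 then show ?thesis using pq by blast
      next
        case 3 then show ?thesis using pq[OF 3(2,1)] by metis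
      next
        case 4 then show ?thesis by (rule qq)
      qed
    qed
    show "(x i c, y i d) \<in> p \<union> q" if cd: "(c, d) \<in> p \<union> q" and i: "i \<le> n" for c d i
    proof (cases "(c, d) \<in> p")
      case True
      then show ?thesis using p_cl i by blast
    next
      case False
      then obtain j where j: "j < ?k" "c = r j" "d = e j" using cd qE by blast
      let ?l = "t ! i ! j"
      have l: "?l < ?k" using bij_t[OF i] j(1) by (auto simp: bij_betw_def)
      have "x i (r j) \<in> R" using xR[OF i] rR[OF j(1)] by (auto simp: bij_betw_def)
      then have "r ?l = x i (r j)"
        unfolding t[OF i j(1)] by (rule bij_betw_inv_into_right[OF r])
      then have "(x i c, y i d) = (r ?l, e ?l)" using ey[OF i j(1)] j by simp
      then show ?thesis using qI[OF l] by simp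
    qed
  qed
  moreover have "a \<in> Domain (p \<union> q)"
  proof -
    have "r (?ri a) = a" using aR by (rule bij_betw_inv_into_right[OF r])
    moreover have "?ri a < ?k" using ri aR by (auto simp: bij_betw_def)
    ultimately show ?thesis using qI[of "?ri a"] by auto
  qed
  ultimately show ?thesis by blast
qed

text \<open>Stage \<open>a\<close> puts the number \<open>a\<close> into domain and range if it lies
  in \<open>A\<close>, so the union of the stages is a bijection of \<open>A\<close>. Outside
  \<open>A\<close> both tuples are trivial and the identity continues the conjugacy.\<close>

lemma back_and_forth_conjugacy:
  assumes x: "\<And>i. i \<le> n \<Longrightarrow> inj (x i)" "\<And>i c. i \<le> n \<Longrightarrow> c \<in> A \<Longrightarrow> x i c \<in> A"
      "\<And>c. \<exists>F. c \<in> F \<and> invariant_set n x F" "\<And>k t m. pattern n k t \<Longrightarrow> has_copy n B k t m x"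
    and y: "\<And>i. i \<le> n \<Longrightarrow> inj (y i)" "\<And>i c. i \<le> n \<Longrightarrow> c \<in> A \<Longrightarrow> y i c \<in> A"
      "\<And>c. \<exists>F. c \<in> F \<and> invariant_set n y F" "\<And>k t m. pattern n k t \<Longrightarrow> has_copy n B k t m y"
    and fixed: "\<And>i c. i \<le> n \<Longrightarrow> c \<notin> A \<Longrightarrow> x i c = c \<and> y i c = c" and BA: "B \<subseteq> A"
  obtains h where "bij h" "supp h \<subseteq> A" "\<And>i c. i \<le> n \<Longrightarrow> h (x i c) = y i (h c)"
proof -
  have step: "\<exists>p'. partial_conj n A x y p' \<and> p \<subseteq> p' \<and> (a \<in> A \<longrightarrow> a \<in> Domain p' \<and> a \<in> Range p')"
    if p: "partial_conj n A x y p" for p a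
  proof (cases "a \<in> A")
    case True
    obtain p1 where p1: "partial_conj n A x y p1" "p \<subseteq> p1" "a \<in> Domain p1"
      using partial_conj_extend[OF p True x(1-3) y(4) BA] by blast
    obtain p2 where p2: "partial_conj n A y x p2" "p1\<inverse> \<subseteq> p2" "a \<in> Domain p2"
      using partial_conj_extend[OF partial_conj_converse[OF p1(1)] True y(1-3) x(4) BA] by blast
    have "partial_conj n A x y (p2\<inverse>)" using p2(1) by (rule partial_conj_converse)
    moreover have "p1 \<subseteq> p2\<inverse>" using p2(2) by auto
    ultimately show ?thesis using p1(2,3) p2(3) by (intro exI[of _ "p2\<inverse>"]) auto
  qed (use p in blast)
  have "\<exists>f. \<forall>a::nat. partial_conj n A x y (f a) \<and>
     (f a \<subseteq> f (Suc a) \<and> (a \<in> A \<longrightarrow> a \<in> Domain (f (Suc a)) \<and> a \<in> Range (f (Suc a))))"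
  proof (rule dependent_nat_choice)
    show "\<exists>p. partial_conj n A x y p" by (intro exI[of _ "{}"]) (simp add: partial_conj_def)
  qed (rule step)
  then obtain f where f: "\<forall>a::nat. partial_conj n A x y (f a) \<and>
     (f a \<subseteq> f (Suc a) \<and> (a \<in> A \<longrightarrow> a \<in> Domain (f (Suc a)) \<and> a \<in> Range (f (Suc a))))" by (rule exE)
  then have pc: "partial_conj n A x y (f a)" and inc: "f a \<subseteq> f (Suc a)"
    and dom: "a \<in> A \<Longrightarrow> a \<in> Domain (f (Suc a))" and ran: "a \<in> A \<Longrightarrow> a \<in> Range (f (Suc a))" for a
    by simp_all
  have mono: "f a \<subseteq> f b" if "a \<le> b" for a b using lift_Suc_mono_le[of f, OF inc that] .
  define H where "H = (\<Union>a. f a)"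
  have H_A: "c \<in> A \<and> d \<in> A" if "(c, d) \<in> H" for c d
    using that pc unfolding H_def partial_conj_def by blast
  have H_inj: "c = c' \<longleftrightarrow> d = d'" if cd: "(c, d) \<in> H" "(c', d') \<in> H" for c d c' d'
  proof -
    obtain a a' where "(c, d) \<in> f a" "(c', d') \<in> f a'" using cd by (auto simp: H_def)
    then have "(c, d) \<in> f (max a a')" "(c', d') \<in> f (max a a')"
      using mono[of a "max a a'"] mono[of a' "max a a'"] by auto
    then show ?thesis by (rule partial_conj_inj[OF pc])
  qed
  have H_cl: "(x i c, y i d) \<in> H" if cd: "(c, d) \<in> H" "i \<le> n" for c d i
  proof -
    obtain a where "(c, d) \<in> f a" using cd(1) by (auto simp: H_def)
    then have "(x i c, y i d) \<in> f a" using cd(2) by (rule partial_conj_closed[OF pc])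
    then show ?thesis by (auto simp: H_def)
  qed
  have H_dom: "\<exists>d. (c, d) \<in> H" if "c \<in> A" for c using dom[OF that] by (auto simp: H_def)
  have H_ran: "\<exists>c. (c, d) \<in> H" if "d \<in> A" for d using ran[OF that] by (auto simp: H_def)
  define h where "h c = (if c \<in> A then SOME d. (c, d) \<in> H else c)" for c
  have h_H: "(c, h c) \<in> H" if "c \<in> A" for c
    using someI_ex[OF H_dom[OF that]] that by (simp add: h_def)
  have h_eq: "h c = d" if "(c, d) \<in> H" for c d
    using H_inj[OF that h_H] H_A[OF that] by auto
  have "bij_betw h A A"
  proof (rule bij_betwI')
    show "h c = h c' \<longleftrightarrow> c = c'" if "c \<in> A" "c' \<in> A" for c c'
      using H_inj[OF h_H[OF that(1)] h_H[OF that(2)]] by simp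
    show "h c \<in> A" if "c \<in> A" for c using H_A[OF h_H[OF that]] by simp
    show "\<exists>c\<in>A. d = h c" if dA: "d \<in> A" for d
    proof -
      obtain c where "(c, d) \<in> H" using H_ran[OF dA] by blast
      then show ?thesis using H_A h_eq by metis
    qed
  qed
  then have "bij h" by (rule bij_extend_id) (simp add: h_def)
  moreover have "supp h \<subseteq> A" by (auto simp: supp_def h_def)
  moreover have "h (x i c) = y i (h c)" if i: "i \<le> n" for i c
  proof (cases "c \<in> A")
    case True
    show ?thesis by (rule h_eq[OF H_cl[OF h_H[OF True] i]])
  next
    case False
    then show ?thesis using fixed[OF i False] by (simp add: h_def)
  qed
  ultimately show ?thesis by (rule that)
qed

lemma bij_maps_superset_of_supp:
  assumes "bij g" "supp g \<subseteq> A" "c \<in> A"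
  shows "g c \<in> A"
proof (cases "g c = c")
  case False
  then have "g (g c) \<noteq> g c" using assms(1) by (metis bij_is_inj injD)
  then show ?thesis using assms(2) by (auto simp: supp_def)
qed (use assms in simp)

lemma bij_image_finite_superset_of_supp:
  assumes "bij g" "supp g \<subseteq> F" "finite F"
  shows "g ` F = F"
proof (rule endo_inj_surj[OF assms(3)])
  show "inj_on g F" using bij_is_inj[OF assms(1)] by (rule inj_on_subset) simp
  show "g ` F \<subseteq> F" using bij_maps_superset_of_supp[OF assms(1,2)] by (rule image_subsetI)
qed

section \<open>Dense open sets of tuples and the comeagre orbit\<close>

context represented_ideal
begin

abbreviation T_power :: "nat \<Rightarrow> (nat \<Rightarrow> nat \<Rightarrow> nat) topology" where
  "T_power n \<equiv> product_topology (\<lambda>_. T) {..n}"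

lemma T_power_D:
  assumes "x \<in> topspace (T_power n)" "i \<le> n"
  shows "x i \<in> S" "bij (x i)" "supp (x i) \<in> I"
  using assms by (auto simp: PiE_iff S_iff)

text \<open>The topology refines pointwise convergence: a change at \<open>j\<close> costs at least
  \<open>\<phi> {j} > 0\<close>.\<close>

lemma openin_T_coordinate: "openin T {g \<in> S. g j = c}"
  unfolding openin_T_iff
proof (intro conjI ballI)
  fix f assume f: "f \<in> {g \<in> S. g j = c}"
  have "g j = c" if "\<phi> {n. f n \<noteq> g n} < \<phi> {j}" for g
  proof (rule ccontr)
    assume "g j \<noteq> c"
    then have "\<phi> {j} \<le> \<phi> {n. f n \<noteq> g n}" using f by (intro phi_mono) auto
    then show False using that by simp
  qed
  then show "\<exists>e>0. \<forall>g\<in>S. \<phi> {n. f n \<noteq> g n} < e \<longrightarrow> g \<in> {g \<in> S. g j = c}"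
    using phi_pos[of j] by (intro exI[of _ "\<phi> {j}"]) simp
qed auto

lemma openin_T_power_agree:
  assumes "finite F"
  shows "openin (T_power n) {y \<in> topspace (T_power n). \<forall>i\<le>n. \<forall>j\<in>F. y i j = x i j}"
proof -
  have "openin (T_power n) {y \<in> topspace (T_power n). y (fst u) (snd u) = x (fst u) (snd u)}"
    if "u \<in> {..n} \<times> F" for u
  proof -
    have "continuous_map (T_power n) T (\<lambda>y. y (fst u))"
      using that by (intro continuous_map_product_projection) auto
    from openin_continuous_map_preimage[OF this openin_T_coordinate[of "snd u" "x (fst u) (snd u)"]]
    have "openin (T_power n) {y \<in> topspace (T_power n). y (fst u) \<in> {g \<in> S. g (snd u) = x (fst u) (snd u)}}" .
    moreover have "{y \<in> topspace (T_power n). y (fst u) \<in> {g \<in> S. g (snd u) = x (fst u) (snd u)}} =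
       {y \<in> topspace (T_power n). y (fst u) (snd u) = x (fst u) (snd u)}"
      using that by (auto simp: PiE_iff)
    ultimately show ?thesis by simp
  qed
  then have "openin (T_power n) ((\<Inter>u\<in>{..n} \<times> F. {y \<in> topspace (T_power n). y (fst u) (snd u) = x (fst u) (snd u)})
     \<inter> topspace (T_power n))"
    using assms by (intro openin_INT) auto
  also have "(\<Inter>u\<in>{..n} \<times> F. {y \<in> topspace (T_power n). y (fst u) (snd u) = x (fst u) (snd u)})
     \<inter> topspace (T_power n) = {y \<in> topspace (T_power n). \<forall>i\<le>n. \<forall>j\<in>F. y i j = x i j}"
    by auto
  finally show ?thesis .
qed

lemma T_power_nhd:
  assumes N: "openin (T_power n) N" "x \<in> N"
  obtains e where "0 < e"
    "\<And>y. y \<in> {..n} \<rightarrow>\<^sub>E S \<Longrightarrow> (\<And>i. i \<le> n \<Longrightarrow> \<phi> {j. x i j \<noteq> y i j} < e) \<Longrightarrow> y \<in> N"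
proof -
  obtain U where U: "\<And>i. i \<in> {..n} \<Longrightarrow> openin T (U i)" "x \<in> Pi\<^sub>E {..n} U" "Pi\<^sub>E {..n} U \<subseteq> N"
    using N unfolding openin_product_topology_alt by meson
  have "\<exists>e>0. \<forall>g\<in>S. \<phi> {j. x i j \<noteq> g j} < e \<longrightarrow> g \<in> U i" if "i \<le> n" for i
  proof -
    have "x i \<in> U i" using U(2) that by (auto simp: PiE_iff)
    then show ?thesis using U(1)[of i] that unfolding openin_T_iff by blast
  qed
  then obtain e where e: "\<And>i. i \<le> n \<Longrightarrow> 0 < e i"
    "\<And>i g. i \<le> n \<Longrightarrow> g \<in> S \<Longrightarrow> \<phi> {j. x i j \<noteq> g j} < e i \<Longrightarrow> g \<in> U i" by metis
  show ?thesis
  proof (rule that[of "Min (e ` {..n})"])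
    show "0 < Min (e ` {..n})" using e(1) by (subst Min_gr_iff) auto
    fix y assume y: "y \<in> {..n} \<rightarrow>\<^sub>E S" and d: "\<And>i. i \<le> n \<Longrightarrow> \<phi> {j. x i j \<noteq> y i j} < Min (e ` {..n})"
    have "y i \<in> U i" if "i \<le> n" for i
    proof (rule e(2)[OF that])
      show "y i \<in> S" using y that by (auto simp: PiE_iff)
      have "Min (e ` {..n}) \<le> e i" using that by (intro Min_le) auto
      then show "\<phi> {j. x i j \<noteq> y i j} < e i" using d[OF that] by (rule less_le_trans[rotated])
    qed
    then have "y \<in> Pi\<^sub>E {..n} U" using y by (auto simp: PiE_iff)
    then show "y \<in> N" using U(3) by blast
  qed
qed

lemma T_power_finite_support_dense:
  assumes "openin (T_power n) N" "N \<noteq> {}"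
  obtains x where "x \<in> N" "x \<in> {..n} \<rightarrow>\<^sub>E S" "\<And>i. i \<le> n \<Longrightarrow> finite (supp (x i))"
proof -
  obtain z where z: "z \<in> N" using assms(2) by blast
  then have zS: "z \<in> {..n} \<rightarrow>\<^sub>E S" using openin_subset[OF assms(1)] by auto
  obtain e where e: "0 < e"
    "\<And>y. y \<in> {..n} \<rightarrow>\<^sub>E S \<Longrightarrow> (\<And>i. i \<le> n \<Longrightarrow> \<phi> {j. z i j \<noteq> y i j} < e) \<Longrightarrow> y \<in> N"
    using T_power_nhd[OF assms(1) z] by blast
  have "\<exists>h. h \<in> S \<and> finite (supp h) \<and> \<phi> {j. z i j \<noteq> h j} < e" if "i \<le> n" for i
  proof -
    have "z i \<in> S" using zS that by (auto simp: PiE_iff)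
    then show ?thesis using finite_support_approx[OF _ e(1)] by metis
  qed
  then obtain h where h: "\<And>i. i \<le> n \<Longrightarrow> h i \<in> S \<and> finite (supp (h i)) \<and> \<phi> {j. z i j \<noteq> h i j} < e" by metis
  let ?x = "\<lambda>i\<in>{..n}. h i"
  have "?x \<in> {..n} \<rightarrow>\<^sub>E S" using h by auto
  moreover from this have "?x \<in> N" by (rule e(2)) (use h in simp)
  ultimately show ?thesis by (intro that[of ?x]) (use h in simp_all)
qed

definition copy_set :: "nat \<Rightarrow> nat set \<Rightarrow> nat \<Rightarrow> nat list list \<Rightarrow> nat \<Rightarrow> (nat \<Rightarrow> nat \<Rightarrow> nat) set" where
  "copy_set n B k t m = {x \<in> topspace (T_power n). has_copy n B k t m x}"

definition locally_finite_set :: "nat \<Rightarrow> nat \<Rightarrow> (nat \<Rightarrow> nat \<Rightarrow> nat) set" where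
  "locally_finite_set n p = {x \<in> topspace (T_power n). \<exists>F. p \<in> F \<and> invariant_set n x F}"

lemma openin_copy_set:
  assumes "pattern n k t"
  shows "openin (T_power n) (copy_set n B k t m)"
proof (subst openin_subopen, intro ballI)
  fix x assume "x \<in> copy_set n B k t m"
  then obtain e where x: "x \<in> topspace (T_power n)" and e: "inj_on e {..<k}" "e ` {..<k} \<subseteq> B - {..m}"
    "\<forall>i\<le>n. \<forall>j<k. x i (e j) = e (t ! i ! j)"
    unfolding copy_set_def has_copy_def by blast
  let ?N = "{y \<in> topspace (T_power n). \<forall>i\<le>n. \<forall>j\<in>e ` {..<k}. y i j = x i j}"
  have "?N \<subseteq> copy_set n B k t m"
  proof
    fix y assume y: "y \<in> ?N"
    have "\<forall>i\<le>n. \<forall>j<k. y i (e j) = e (t ! i ! j)" using y e(3) by simp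
    then have "has_copy n B k t m y" unfolding has_copy_def using e(1,2) by metis
    then show "y \<in> copy_set n B k t m" using y unfolding copy_set_def by blast
  qed
  moreover have "openin (T_power n) ?N" by (rule openin_T_power_agree) simp
  moreover have "x \<in> ?N" using x by simp
  ultimately show "\<exists>N. openin (T_power n) N \<and> x \<in> N \<and> N \<subseteq> copy_set n B k t m" by blast
qed

lemma openin_locally_finite_set: "openin (T_power n) (locally_finite_set n p)"
proof (subst openin_subopen, intro ballI)
  fix x assume "x \<in> locally_finite_set n p"
  then obtain F where x: "x \<in> topspace (T_power n)" and F: "p \<in> F" "finite F" "\<forall>i\<le>n. x i ` F = F"
    unfolding locally_finite_set_def invariant_set_def by blast
  let ?N = "{y \<in> topspace (T_power n). \<forall>i\<le>n. \<forall>j\<in>F. y i j = x i j}"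
  have "?N \<subseteq> locally_finite_set n p"
  proof
    fix y assume y: "y \<in> ?N"
    have "y i ` F = F" if "i \<le> n" for i
    proof -
      have "y i ` F = x i ` F" using y that by (intro image_cong) auto
      then show ?thesis using F(3) that by simp
    qed
    then show "y \<in> locally_finite_set n p"
      using y F(1,2) unfolding locally_finite_set_def invariant_set_def by blast
  qed
  moreover have "openin (T_power n) ?N" using F(2) by (rule openin_T_power_agree)
  moreover have "x \<in> ?N" using x by simp
  ultimately show "\<exists>N. openin (T_power n) N \<and> x \<in> N \<and> N \<subseteq> locally_finite_set n p" by blast
qed

text \<open>Tuples of finitely supported permutations are dense, and for them \<open>p\<close>
  together with all supports is a finite invariant set.\<close>

lemma dense_locally_finite_set: "T_power n closure_of locally_finite_set n p = topspace (T_power n)"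
  unfolding dense_intersects_open
proof (intro allI impI)
  fix N assume "openin (T_power n) N \<and> N \<noteq> {}"
  then obtain x where x: "x \<in> N" "x \<in> {..n} \<rightarrow>\<^sub>E S" "\<And>i. i \<le> n \<Longrightarrow> finite (supp (x i))"
    using T_power_finite_support_dense by blast
  define F where "F = insert p (\<Union>i\<le>n. supp (x i))"
  have "finite F" using x(3) by (simp add: F_def)
  have "x i ` F = F" if "i \<le> n" for i
  proof (rule bij_image_finite_superset_of_supp)
    show "bij (x i)" using x(2) that by (auto simp: PiE_iff S_iff)
    show "supp (x i) \<subseteq> F" using that by (auto simp: F_def)
  qed fact
  then have "invariant_set n x F" using \<open>finite F\<close> by (simp add: invariant_set_def)
  moreover have "p \<in> F" by (simp add: F_def)
  ultimately have "x \<in> locally_finite_set n p" unfolding locally_finite_set_def using x(2) by auto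
  then show "locally_finite_set n p \<inter> N \<noteq> {}" using x(1) by blast
qed

text \<open>Starting from a finitely supported tuple in \<open>N\<close>, install the pattern on
  \<open>k\<close> points of \<open>B\<close> that are fixed by the tuple. Since \<open>B\<close> is
  in \<open>I\<close>, points far out make this change small enough to stay in
  \<open>N\<close>.\<close>

lemma dense_copy_set:
  assumes B: "B \<in> I" "infinite B" and t: "pattern n k t"
  shows "T_power n closure_of copy_set n B k t m = topspace (T_power n)"
  unfolding dense_intersects_open
proof (intro allI impI)
  fix N assume N: "openin (T_power n) N \<and> N \<noteq> {}"
  then obtain x where x: "x \<in> N" "x \<in> {..n} \<rightarrow>\<^sub>E S" "\<And>i. i \<le> n \<Longrightarrow> finite (supp (x i))"
    using T_power_finite_support_dense by blast
  obtain c where c: "0 < c"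
    "\<And>y. y \<in> {..n} \<rightarrow>\<^sub>E S \<Longrightarrow> (\<And>i. i \<le> n \<Longrightarrow> \<phi> {j. x i j \<noteq> y i j} < c) \<Longrightarrow> y \<in> N"
    using T_power_nhd[of n N x] N x(1) by blast
  obtain m1 where m1: "\<phi> (B - {..m1}) < c" using I_tail[OF B(1) c(1)] .
  have "finite (\<Union>i\<le>n. supp (x i))" using x(3) by simp
  then obtain m2 where m2: "(\<Union>i\<le>n. supp (x i)) \<subseteq> {..m2}" using finite_nat_iff_bounded_le by blast
  \<comment> \<open>Beyond \<open>m\<close> the copy is where it is wanted, beyond \<open>m1\<close>
    the change is small, and beyond \<open>m2\<close> the tuple \<open>x\<close> is the
    identity.\<close>
  define M where "M = m + m1 + m2"
  have "infinite (B - {..M})" using B(2) by simp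
  then obtain F where F: "finite F" "card F = k" "F \<subseteq> B - {..M}"
    using infinite_arbitrarily_large by blast
  obtain e where "bij_betw e {0..<k} F" using ex_bij_betw_nat_finite[OF F(1)] F(2) by blast
  then have e: "bij_betw e {..<k} F" by (simp add: atLeast0LessThan)
  let ?ei = "inv_into {..<k} e"
  have ei: "bij_betw ?ei F {..<k}" using e by (rule bij_betw_inv_into)
  define q where "q i b = (if b \<in> F then e (t ! i ! (?ei b)) else b)" for i b
  have fixF: "x i b = b" if "i \<le> n" "b \<in> F" for i b
  proof -
    have "b \<notin> {..m2}" using that(2) F(3) by (auto simp: M_def)
    then have "b \<notin> supp (x i)" using m2 that(1) by blast
    then show ?thesis by (simp add: supp_def)
  qed
  have q_e: "q i (e j) = e (t ! i ! j)" if "j < k" for i j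
  proof -
    have "e j \<in> F" using e that by (auto simp: bij_betw_def)
    moreover have "?ei (e j) = j" using e that by (intro bij_betw_inv_into_left) auto
    ultimately show ?thesis by (simp add: q_def)
  qed
  have bij_t: "bij_betw (\<lambda>j. t ! i ! j) {..<k} {..<k}" if "i \<le> n" for i
    using t that by (simp add: pattern_def)
  have qS: "q i \<in> S" if "i \<le> n" for i
  proof -
    have "bij_betw (e \<circ> ((\<lambda>j. t ! i ! j) \<circ> ?ei)) F F"
      by (intro bij_betw_trans[OF bij_betw_trans[OF ei bij_t[OF that]] e])
    then have "bij_betw (q i) F F"
      by (subst bij_betw_cong[of _ _ "e \<circ> ((\<lambda>j. t ! i ! j) \<circ> ?ei)"]) (simp_all add: q_def)
    then have "bij (q i)" by (rule bij_extend_id) (simp add: q_def)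
    moreover have "supp (q i) \<subseteq> F" by (auto simp: supp_def q_def)
    then have "supp (q i) \<in> I" using F(1) by (meson I_finite finite_subset)
    ultimately show ?thesis by (simp add: S_iff)
  qed
  define y where "y = (\<lambda>i\<in>{..n}. x i \<circ> q i)"
  have yS: "y \<in> {..n} \<rightarrow>\<^sub>E S"
    unfolding y_def using x(2) qS by (auto simp: PiE_iff intro: S_comp)
  have "y \<in> N"
  proof (rule c(2)[OF yS])
    fix i assume i: "i \<le> n"
    have "{j. x i j \<noteq> y i j} \<subseteq> B - {..m1}"
    proof
      fix j assume "j \<in> {j. x i j \<noteq> y i j}"
      then have "q i j \<noteq> j" using i by (auto simp: y_def)
      then have "j \<in> F" by (auto simp: q_def split: if_splits)
      then show "j \<in> B - {..m1}" using F(3) by (auto simp: M_def)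
    qed
    then show "\<phi> {j. x i j \<noteq> y i j} < c" using m1 by (meson phi_mono le_less_trans)
  qed
  moreover have "has_copy n B k t m y"
    unfolding has_copy_def
  proof (intro exI[of _ e] conjI allI impI)
    show "inj_on e {..<k}" using e by (simp add: bij_betw_def)
    have "e ` {..<k} = F" using e by (simp add: bij_betw_def)
    then show "e ` {..<k} \<subseteq> B - {..m}" using F(3) by (auto simp: M_def)
    fix i j assume ij: "i \<le> n" "j < k"
    have "t ! i ! j < k" using bij_t[OF ij(1)] ij(2) by (auto simp: bij_betw_def)
    then have "e (t ! i ! j) \<in> F" using e by (auto simp: bij_betw_def)
    then show "y i (e j) = e (t ! i ! j)" using ij by (simp add: y_def q_e fixF)
  qed
  ultimately show "copy_set n B k t m \<inter> N \<noteq> {}"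
    using yS unfolding copy_set_def by auto
qed

text \<open>Not the tuples themselves but the countable family of dense open sets whose intersection
  consists of the generic ones.\<close>

definition generic_tuples :: "nat \<Rightarrow> nat set \<Rightarrow> (nat \<Rightarrow> nat \<Rightarrow> nat) set set" where
  "generic_tuples n B = (\<lambda>(k, t, m). copy_set n B k t m) ` {(k, t, m). pattern n k t} \<union> range (locally_finite_set n)"

lemma generic_tuplesD:
  assumes "x \<in> topspace (T_power n)" "x \<in> \<Inter>(generic_tuples n B)"
  shows "pattern n k t \<Longrightarrow> has_copy n B k t m x" "\<exists>F. p \<in> F \<and> invariant_set n x F"
proof -
  show "has_copy n B k t m x" if "pattern n k t"
  proof -
    have "copy_set n B k t m \<in> generic_tuples n B"
      unfolding generic_tuples_def using that by (intro UnI1 image_eqI[of _ _ "(k, t, m)"]) auto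
    then have "x \<in> copy_set n B k t m" using assms(2) by (rule InterD[rotated])
    then show ?thesis by (simp add: copy_set_def)
  qed
  have "locally_finite_set n p \<in> generic_tuples n B" by (simp add: generic_tuples_def)
  then have "x \<in> locally_finite_set n p" using assms(2) by (rule InterD[rotated])
  then show "\<exists>F. p \<in> F \<and> invariant_set n x F" by (simp add: locally_finite_set_def)
qed

lemma generic_tuples_conjugate:
  assumes x: "x \<in> topspace (T_power n)" "x \<in> \<Inter>(generic_tuples n B)"
    and y: "y \<in> topspace (T_power n)" "y \<in> \<Inter>(generic_tuples n B)" and B: "B \<in> I"
  shows "y \<in> orbit (S_ideal I) (diag_conj (S_ideal I) n) x"
proof -
  \<comment> \<open>A finite union of members of \<open>I\<close>: every permutation supported in
    \<open>A\<close> belongs to the group.\<close>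
  define A where "A = B \<union> (\<Union>i\<in>{..n}. supp (x i) \<union> supp (y i))"
  have "(\<Union>i\<in>J. supp (x i) \<union> supp (y i)) \<in> I" if "finite J" "J \<subseteq> {..n}" for J
    using that
  proof (induction J rule: finite_induct)
    case (insert i J)
    then have "i \<le> n" by simp
    then have "supp (x i) \<in> I" "supp (y i) \<in> I" using T_power_D x(1) y(1) by auto
    then have "(supp (x i) \<union> supp (y i)) \<union> (\<Union>i\<in>J. supp (x i) \<union> supp (y i)) \<in> I"
      using insert by (intro I_Un) auto
    then show ?case by simp
  qed (simp add: I_finite)
  then have "A \<in> I" unfolding A_def using B by (intro I_Un) auto
  have suppA: "supp (x i) \<subseteq> A" "supp (y i) \<subseteq> A" if "i \<le> n" for i using that by (auto simp: A_def)
  have bij: "bij (x i)" "bij (y i)" if "i \<le> n" for i using T_power_D that x(1) y(1) by auto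
  have fixed: "x i c = c \<and> y i c = c" if "i \<le> n" "c \<notin> A" for i c
    using suppA[OF that(1)] that(2) by (auto simp: supp_def)
  obtain h where h: "bij h" "supp h \<subseteq> A" "\<And>i c. i \<le> n \<Longrightarrow> h (x i c) = y i (h c)"
  proof (rule back_and_forth_conjugacy[of n x A B y])
    show "inj (x i)" "inj (y i)" if "i \<le> n" for i using bij[OF that] by (auto simp: bij_is_inj)
    show "x i c \<in> A" "y i c \<in> A" if "i \<le> n" "c \<in> A" for i c
      using bij_maps_superset_of_supp[OF bij(1) suppA(1)] bij_maps_superset_of_supp[OF bij(2) suppA(2)] that by simp_all
    show "\<exists>F. c \<in> F \<and> invariant_set n x F" "\<exists>F. c \<in> F \<and> invariant_set n y F" for c
      using generic_tuplesD(2)[OF x] generic_tuplesD(2)[OF y] by blast+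
    show "has_copy n B k t m x" "has_copy n B k t m y" if "pattern n k t" for k t m
      using generic_tuplesD(1)[OF x that] generic_tuplesD(1)[OF y that] by blast+
    show "B \<subseteq> A" by (auto simp: A_def)
  qed (use fixed in auto)
  have hS: "h \<in> S" using h(1,2) \<open>A \<in> I\<close> I_subset by (auto simp: S_iff)
  have "y = diag_conj (S_ideal I) n h x"
  proof (rule ext)
    fix i
    show "y i = diag_conj (S_ideal I) n h x i"
    proof (cases "i \<le> n")
      case True
      have "y i b = h (x i (Hilbert_Choice.inv h b))" for b
        using h(3)[OF True] h(1) by (simp add: bij_is_surj surj_f_inv_f)
      then show ?thesis using True hS by (auto simp: diag_conj_def S_m_inv)
    next
      case False
      then show ?thesis using y(1) by (auto simp: diag_conj_def PiE_iff extensional_def)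
    qed
  qed
  then show ?thesis using hS unfolding orbit_def by blast
qed

theorem ample_generics_S_ideal:
  assumes B: "B \<in> I" "infinite B"
  shows "ample_generics (S_ideal I) T"
  unfolding ample_generics_def
proof
  fix n
  interpret G: group "S_ideal I" using ideal by (rule group_S_ideal)
  have gen: "openin (T_power n) U \<and> T_power n closure_of U = topspace (T_power n)"
    if "U \<in> generic_tuples n B" for U
    using that openin_copy_set dense_copy_set[OF B] openin_locally_finite_set dense_locally_finite_set
    unfolding generic_tuples_def by auto
  have cnt: "countable (generic_tuples n B)" unfolding generic_tuples_def by simp
  have "completely_metrizable_space (T_power n)"
    unfolding completely_metrizable_space_product_topology using completely_metrizable_T by (auto intro: countable_finite)
  then have dense: "T_power n closure_of \<Inter>(generic_tuples n B) = topspace (T_power n)"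
    using gen cnt by (intro Baire_category) auto
  \<comment> \<open>The product is nonempty, so the dense intersection given by the Baire category
    theorem contains a tuple.\<close>
  have "(\<lambda>i\<in>{..n}. id) \<in> topspace (T_power n)" using id_S by auto
  then have "\<exists>x. x \<in> topspace (T_power n) \<and> x \<in> \<Inter>(generic_tuples n B)"
    using dense unfolding closure_of_def by blast
  then obtain x where x: "x \<in> topspace (T_power n)" "x \<in> \<Inter>(generic_tuples n B)" by blast
  show "\<exists>x\<in>{..n} \<rightarrow>\<^sub>E S. comeagre_in (T_power n) (orbit (S_ideal I) (diag_conj (S_ideal I) n) x)"
  proof (rule bexI)
    show "x \<in> {..n} \<rightarrow>\<^sub>E S" using x(1) by simp
    show "comeagre_in (T_power n) (orbit (S_ideal I) (diag_conj (S_ideal I) n) x)"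
    proof (rule comeagre_in_dense_open[OF cnt gen])
      show "orbit (S_ideal I) (diag_conj (S_ideal I) n) x \<subseteq> topspace (T_power n)"
      proof
        fix y assume "y \<in> orbit (S_ideal I) (diag_conj (S_ideal I) n) x"
        then obtain g where g: "g \<in> S" "y = diag_conj (S_ideal I) n g x" unfolding orbit_def by blast
        have "g \<otimes>\<^bsub>S_ideal I\<^esub> x i \<otimes>\<^bsub>S_ideal I\<^esub> inv\<^bsub>S_ideal I\<^esub> g \<in> S" if "i \<le> n" for i
          using T_power_D(1)[OF x(1) that] g(1) by (intro G.m_closed G.inv_closed)
        then show "y \<in> topspace (T_power n)" unfolding g(2) diag_conj_def by auto
      qed
      show "topspace (T_power n) \<inter> \<Inter>(generic_tuples n B) \<subseteq> orbit (S_ideal I) (diag_conj (S_ideal I) n) x"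
        using generic_tuples_conjugate[OF x _ _ B(1)] by blast
    qed
  qed
qed

text \<open>If all members were finite, \<open>I\<close> would be \<open>Fin\<close>, its own
  modification along \<open>UNIV\<close>.\<close>

lemma ex_infinite_in_I:
  assumes "\<not> trivial_modification_of_Fin I"
  shows "\<exists>B\<in>I. infinite B"
proof (rule ccontr)
  assume "\<not> (\<exists>B\<in>I. infinite B)"
  then have "I = {B. UNIV \<inter> B \<in> Fin}" using I_finite by (auto simp: Fin_def)
  then show False using assms unfolding trivial_modification_of_Fin_def by blast
qed

end

section \<open>The summable ideal\<close>

text \<open>Division by zero gives \<open>1 / real 0 = 0\<close>, so the point 0 has no mass, in
  agreement with the restriction \<open>n \<ge> 1\<close> in \<open>summable_ideal\<close>.\<close>

definition harmonic_measure :: "nat measure" where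
  "harmonic_measure = density (count_space UNIV) (\<lambda>n. ennreal (1 / real n))"

lemma sets_harmonic_measure [simp]: "sets harmonic_measure = UNIV" 
  by (simp add: harmonic_measure_def)

lemma emeasure_harmonic_measure:
  "emeasure harmonic_measure A = (\<integral>\<^sup>+n. ennreal (1 / real n) \<partial>count_space A)"
  unfolding harmonic_measure_def
  by (simp add: emeasure_density nn_integral_count_space_indicator)

lemma emeasure_harmonic_measure_singleton: "emeasure harmonic_measure {n} = ennreal (1 / real n)"
  by (simp add: emeasure_harmonic_measure nn_integral_count_space_finite)

lemma summable_ideal_iff: "A \<in> summable_ideal \<longleftrightarrow> emeasure harmonic_measure A < \<infinity>"
proof -
  let ?f = "\<lambda>n. 1 / real n" and ?B = "{n \<in> A. n \<ge> 1}"
  have "A \<in> summable_ideal \<longleftrightarrow> ?f summable_on ?B" by (simp add: summable_ideal_def)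
  also have "\<dots> \<longleftrightarrow> ?f summable_on A"
    by (rule summable_on_cong_neutral) (auto simp: not_le)
  also have "\<dots> \<longleftrightarrow> Infinite_Sum.abs_summable_on ?f A"
    by (rule summable_on_iff_abs_summable_on_real)
  also have "\<dots> \<longleftrightarrow> integrable (count_space A) ?f"
    unfolding abs_summable_equivalent abs_summable_on_def ..
  also have "\<dots> \<longleftrightarrow> emeasure harmonic_measure A < \<infinity>"
    by (simp add: integrable_iff_bounded emeasure_harmonic_measure)
  finally show ?thesis .
qed

text \<open>Countable subadditivity against the geometric series. It serves both the P-property and
  the construction of a sparse infinite member.\<close>

lemma summable_ideal_UN:
  assumes "\<And>k. emeasure harmonic_measure (A k) \<le> ennreal ((1/2) ^ k)"
  shows "(\<Union>k. A k) \<in> summable_ideal"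
proof -
  have "emeasure harmonic_measure (\<Union>k. A k) \<le> (\<Sum>k. emeasure harmonic_measure (A k))"
    by (rule emeasure_subadditive_countably) simp
  also have "\<dots> \<le> (\<Sum>k. ennreal ((1/2) ^ k))"
    using assms by (intro suminf_le) auto
  also have "\<dots> = ennreal (\<Sum>k. (1/2) ^ k)"
    by (intro suminf_ennreal2) (auto intro: summable_geometric)
  also have "\<dots> < \<infinity>" by simp
  finally show ?thesis by (simp add: summable_ideal_iff)
qed

lemma ideal_on_nat_summable_ideal: "ideal_on_nat summable_ideal"
  unfolding ideal_on_nat_def
proof (intro conjI ballI allI impI)
  show "{} \<in> summable_ideal" by (simp add: summable_ideal_iff)
  show "B \<in> summable_ideal" if "A \<in> summable_ideal" "B \<subseteq> A" for A B
    using that emeasure_mono[of B A harmonic_measure] by (auto simp: summable_ideal_iff intro: le_less_trans)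
  show "A \<union> B \<in> summable_ideal" if "A \<in> summable_ideal" "B \<in> summable_ideal" for A B
  proof -
    have "emeasure harmonic_measure (A \<union> B) \<le> emeasure harmonic_measure A + emeasure harmonic_measure B"
      by (rule emeasure_subadditive) simp_all
    also have "\<dots> < \<infinity>" using that by (simp add: summable_ideal_iff)
    finally show ?thesis by (simp add: summable_ideal_iff)
  qed
qed

lemma Fin_subset_summable_ideal: "Fin \<subseteq> summable_ideal"
  by (auto simp: Fin_def summable_ideal_iff emeasure_harmonic_measure nn_integral_count_space_finite)

text \<open>By continuity from above each \<open>A k\<close> has a tail of mass below
  \<open>(1/2) ^ k\<close>; the union of these tails almost contains every
  \<open>A k\<close>.\<close>

lemma P_ideal_summable_ideal: "P_ideal summable_ideal"
  unfolding P_ideal_def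
proof (intro conjI allI impI)
  fix A :: "nat \<Rightarrow> nat set" assume A: "\<forall>k. A k \<in> summable_ideal"
  have "\<exists>m. emeasure harmonic_measure (A k - {..m}) < ennreal ((1/2) ^ k)" for k
  proof -
    have fin: "emeasure harmonic_measure (A k - {..m}) \<noteq> \<infinity>" for m
    proof -
      have "emeasure harmonic_measure (A k - {..m}) \<le> emeasure harmonic_measure (A k)"
        by (rule emeasure_mono) auto
      also have "\<dots> < \<infinity>" using A by (simp add: summable_ideal_iff)
      finally show ?thesis by (rule less_imp_neq)
    qed
    have "(\<lambda>m. emeasure harmonic_measure (A k - {..m})) \<longlonglongrightarrow> emeasure harmonic_measure (\<Inter>m. A k - {..m})"
      by (rule Lim_emeasure_decseq) (use fin in \<open>auto simp: decseq_def\<close>)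
    moreover have "(\<Inter>m. A k - {..m}) = {}" by auto
    ultimately have "(\<lambda>m. emeasure harmonic_measure (A k - {..m})) \<longlonglongrightarrow> 0"
      by (simp only: emeasure_empty)
    then have "\<forall>\<^sub>F m in sequentially. emeasure harmonic_measure (A k - {..m}) < ennreal ((1/2) ^ k)"
      by (rule order_tendstoD) simp
    then show ?thesis by (auto simp: eventually_sequentially)
  qed
  then obtain m where m: "\<And>k. emeasure harmonic_measure (A k - {..m k}) < ennreal ((1/2) ^ k)" by metis
  have "finite (A k - (\<Union>k. A k - {..m k}))" for k
    by (rule finite_subset[of _ "{..m k}"]) auto
  moreover have "(\<Union>k. A k - {..m k}) \<in> summable_ideal"
    using m by (intro summable_ideal_UN less_imp_le)
  ultimately show "\<exists>B\<in>summable_ideal. \<forall>k. finite (A k - B)" by (intro bexI[of _ "\<Union>k. A k - {..m k}"]) simp_all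
qed (rule ideal_on_nat_summable_ideal)

text \<open>The pieces are the sets of mass at most \<open>n\<close>. They are closed because, by
  continuity from below, the mass is the supremum over initial segments.\<close>

lemma Sigma02_summable_ideal: "Sigma02 summable_ideal"
  unfolding Sigma02_iff
proof (intro exI conjI allI)
  fix n
  show "closed_family {A. emeasure harmonic_measure A \<le> of_nat n}"
    unfolding closed_family_def
  proof (intro allI impI, rule CollectI)
    fix A assume A: "\<forall>m. \<exists>B\<in>{A. emeasure harmonic_measure A \<le> of_nat n}. \<forall>i<m. (i \<in> A) = (i \<in> B)"
    have "emeasure harmonic_measure (A \<inter> {..<m}) \<le> of_nat n" for m
    proof -
      obtain B where B: "B \<in> {A. emeasure harmonic_measure A \<le> of_nat n}" "\<forall>i<m. (i \<in> A) = (i \<in> B)"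
        using A[THEN spec, of m] by (rule bexE)
      have "A \<inter> {..<m} \<subseteq> B" using B(2) by auto
      then have "emeasure harmonic_measure (A \<inter> {..<m}) \<le> emeasure harmonic_measure B"
        by (rule emeasure_mono) simp
      also have "\<dots> \<le> of_nat n" using B(1) by simp
      finally show ?thesis .
    qed
    then have "(SUP m. emeasure harmonic_measure (A \<inter> {..<m})) \<le> of_nat n" by (rule SUP_least)
    also have "(SUP m. emeasure harmonic_measure (A \<inter> {..<m})) = emeasure harmonic_measure (\<Union>m. A \<inter> {..<m})"
      by (rule SUP_emeasure_incseq) (auto simp: incseq_def)
    also have "(\<Union>m. A \<inter> {..<m}) = A" by auto
    finally show "emeasure harmonic_measure A \<le> of_nat n" .
  qed
next
  show "summable_ideal = (\<Union>n. {A. emeasure harmonic_measure A \<le> of_nat n})"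
  proof (intro equalityI subsetI)
    fix A assume "A \<in> summable_ideal"
    then obtain n where "emeasure harmonic_measure A < of_nat n"
      using ennreal_Ex_less_of_nat by (auto simp: summable_ideal_iff)
    then show "A \<in> (\<Union>n. {A. emeasure harmonic_measure A \<le> of_nat n})" by (auto intro: less_imp_le)
  next
    fix A assume "A \<in> (\<Union>n. {A. emeasure harmonic_measure A \<le> of_nat n})"
    then obtain n where "emeasure harmonic_measure A \<le> of_nat n" by auto
    also have "of_nat n < (\<infinity> :: ennreal)" by (simp add: of_nat_less_top)
    finally show "A \<in> summable_ideal" by (simp add: summable_ideal_iff)
  qed
qed

lemma UNIV_notin_summable_ideal: "UNIV \<notin> summable_ideal"
proof
  assume "UNIV \<in> summable_ideal"
  then have "(\<lambda>n. 1 / real n) summable_on {n. n \<ge> 1}" by (simp add: summable_ideal_def)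
  moreover have "(\<lambda>n. 1 / real n) summable_on {n. n \<ge> 1} \<longleftrightarrow> (\<lambda>n. 1 / real n) summable_on UNIV"
    by (rule summable_on_cong_neutral) (auto simp: not_le)
  ultimately have "summable (\<lambda>n. 1 / real n)" using summable_on_imp_summable by blast
  then show False using not_summable_harmonic[where 'a=real] by (simp add: inverse_eq_divide)
qed

text \<open>The set \<open>A\<close> of such a modification is infinite, since the harmonic series
  diverges. Points \<open>f k \<ge> 2 ^ k\<close> of \<open>A\<close> then form an infinite subset
  of \<open>A\<close> that is summable, contradicting the form of the ideal.\<close>

lemma not_trivial_modification_summable_ideal: "\<not> trivial_modification_of_Fin summable_ideal"
proof
  assume "trivial_modification_of_Fin summable_ideal"
  then obtain A where A: "summable_ideal = {B. A \<inter> B \<in> Fin}" by (auto simp: trivial_modification_of_Fin_def)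
  have inf: "infinite A"
    using UNIV_notin_summable_ideal unfolding A by (simp add: Fin_def)
  then have "\<exists>n\<in>A. n \<ge> 2 ^ k" for k :: nat
    by (meson infinite_nat_iff_unbounded_le)
  then obtain f where f: "\<And>k. f k \<in> A" "\<And>k. f k \<ge> 2 ^ k" by metis
  have "(\<Union>k. {f k}) \<in> summable_ideal"
  proof (rule summable_ideal_UN)
    fix k
    have "(2::real) ^ k \<le> real (f k)" using f(2)[of k] by (metis of_nat_le_iff of_nat_numeral of_nat_power)
    then have "1 / real (f k) \<le> (1/2) ^ k" by (simp add: power_one_over frac_le)
    then show "emeasure harmonic_measure {f k} \<le> ennreal ((1/2) ^ k)"
      by (simp add: emeasure_harmonic_measure_singleton ennreal_leI)
  qed
  then have "range f \<in> summable_ideal" by (simp add: UNION_singleton_eq_range)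
  then have "finite (A \<inter> range f)" unfolding A by (simp add: Fin_def)
  moreover have "A \<inter> range f = range f" using f(1) by auto
  ultimately obtain m where m: "range f \<subseteq> {..m}" using finite_nat_iff_bounded_le by auto
  have "m < 2 ^ m" by simp
  then have "m < f m" using f(2)[of m] by (rule less_le_trans)
  moreover have "f m \<le> m" using m by auto
  ultimately show False by simp
qed

text \<open>Quantifying over all representing \<open>\<phi>\<close> makes the claims independent of
  the choice of the submeasure; the separate existence clauses keep them from being vacuous.\<close>

theorem corollary4:
  shows "(\<forall>I. ideal_on_nat I \<and> Sigma02 I \<and> P_ideal I \<and> Fin \<subseteq> I \<and> \<not> trivial_modification_of_Fin I \<longrightarrow>
            (\<exists>\<phi>. represents \<phi> I) \<and>
            (\<forall>\<phi>. represents \<phi> I \<longrightarrow>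
               Polish_group (S_ideal I) (tau_ideal I \<phi>) \<and>
               ample_generics (S_ideal I) (tau_ideal I \<phi>) \<and>
               \<not> non_archimedean (S_ideal I) (tau_ideal I \<phi>)))
       \<and> (\<exists>(G :: (nat \<Rightarrow> nat) monoid) T.
            Polish_group G T \<and> ample_generics G T \<and> \<not> non_archimedean G T)
       \<and> (\<exists>\<phi>. represents \<phi> summable_ideal)
       \<and> (\<forall>\<phi>. represents \<phi> summable_ideal \<longrightarrow>
            Polish_group (S_ideal summable_ideal) (tau_ideal summable_ideal \<phi>) \<and>
            ample_generics (S_ideal summable_ideal) (tau_ideal summable_ideal \<phi>) \<and>
            \<not> non_archimedean (S_ideal summable_ideal) (tau_ideal summable_ideal \<phi>))"
proof -
  have ex: "\<exists>\<phi>. represents \<phi> I" if "Sigma02 I" "P_ideal I" "Fin \<subseteq> I" for I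
    using that by (rule Sigma02_P_ideal_represents)
  have main: "Polish_group (S_ideal I) (tau_ideal I \<phi>) \<and> ample_generics (S_ideal I) (tau_ideal I \<phi>) \<and>
      \<not> non_archimedean (S_ideal I) (tau_ideal I \<phi>)"
    if I: "ideal_on_nat I" "Sigma02 I" "\<not> trivial_modification_of_Fin I" and "represents \<phi> I" for I \<phi>
  proof -
    interpret represented_ideal \<phi> I using that by unfold_locales
    obtain B where "B \<in> I" "infinite B" using ex_infinite_in_I[OF I(3)] by blast
    then show ?thesis
      using Polish_group_S_ideal ample_generics_S_ideal not_non_archimedean[OF I(2,3)] by blast
  qed
  note summable = ideal_on_nat_summable_ideal Sigma02_summable_ideal not_trivial_modification_summable_ideal
  have ex_summable: "\<exists>\<phi>. represents \<phi> summable_ideal"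
    using ex Sigma02_summable_ideal P_ideal_summable_ideal Fin_subset_summable_ideal by simp
  then obtain \<phi> where "represents \<phi> summable_ideal" by (rule exE)
  from main[OF summable this]
  have "\<exists>(G :: (nat \<Rightarrow> nat) monoid) T. Polish_group G T \<and> ample_generics G T \<and> \<not> non_archimedean G T"
    by blast
  with ex main ex_summable main[OF summable] show ?thesis by simp
qed

end
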